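(* Let $G$ be a countable ICC group and let $\pi:G\to\mathcal U(\mathcal H)$ be a unitary representation of $G$ on a nonzero Hilbert space $\mathcal H$. Suppose $\xi_1\in\mathcal H$ is a Parseval frame vector for $\mathcal H$. Let $N:=\left\lfloor \frac{1}{\|\xi_1\|^2}\right\rfloor\in\mathbb N$. (i) There exist $\xi_2,\dots,\xi_N,\xi_{N+1}\in\mathcal H$ with the following properties: (a) $\xi_2,\dots,\xi_N$ are Parseval frame vectors for $\mathcal H$. (b) $\|\xi_{N+1}\|^2=1-N\|\xi_1\|^2=:r<\|\xi_1\|^2$, and there exists a projection $p_r'\in\pi(G)'$ such that $\{\pi(g)\xi_{N+1}\,|\,g\in G\}$ is a Parseval frame for $p_r'\mathcal H$ (so $\xi_{N+1}$ is a Parseval frame vector for $p_r'\mathcal H$ with the representation $\pi^r:=\pi p_r'$). (c) $\xi_1,\dots,\xi_{N+1}$ is a strongly disjoint $(N+1)$-tuple of Parseval frame vectors (for $\mathcal H,\dots,\mathcal H$ ($N$ times) and $p_r'\mathcal H$, respectively). (ii) If $\xi_1,\dots,\xi_{N+1}$ are as in (i), then there is no nonzero vector $\xi_{N+2}$ such that $\xi_{N+2}$ is a Parseval frame vector for some unitary representation $\pi_{N+2}$ of $G$ and $\xi_{N+2}$ is strongly disjoint from all $\xi_i$, $i=1,\dots,N+1$. (iii) If $1\le M\le N$ and $\xi_1,\dots,\xi_M$ is a strongly disjoint $M$-tuple of Parseval frame vectors for $\mathcal H$, then there exist $\xi_{M+1},\dots,\xi_N,\xi_{N+1}\in\mathcal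 H$ such that $\xi_1,\dots,\xi_{N+1}$ satisfy properties (a), (b), (c) of (i).
   Context: A group $G$ is ICC if for every $g\in G$, $g\ne e$, the conjugacy class $\{hgh^{-1}\,|\,h\in G\}$ is infinite. A family $\{e_i\,|\,i\in I\}$ in a Hilbert space $\mathcal K$ is a Parseval frame for $\mathcal K$ if $\|f\|^2=\sum_{i\in I}|\langle f,e_i\rangle|^2$ for all $f\in\mathcal K$. Given a unitary representation $\sigma$ of $G$ on $\mathcal K$, a vector $\xi\in\mathcal K$ is a Parseval frame vector for $\mathcal K$ (with the representation $\sigma$) if $\{\sigma(g)\xi\,|\,g\in G\}$ (indexed by $G$) is a Parseval frame for $\mathcal K$. Parseval frames $\{e_i^1\,|\,i\in I\},\dots,\{e_i^n\,|\,i\in I\}$ for Hilbert spaces $\mathcal H_1,\dots,\mathcal H_n$ form a strongly disjoint $n$-tuple if $\{e_i^1\oplus\dots\oplus e_i^n\,|\,i\in I\}$ is a Parseval frame for $\mathcal H_1\oplus\dots\oplus\mathcal H_n$; for $n=2$ they are called strongly disjoint. Parseval frame vectors (possibly for different representations of $G$) are strongly disjoint, or form a strongly disjoint $n$-tuple, if the Parseval frames indexed by $G$ which they generate do. $\pi(G)'$ is the commutant of $\pi(G)$. "Projection" means orthogonal projection. For a projection $p'\in\pi(G)'$, $\pi p'$ is the representation of $G$ on $p'\mathcal H$ given by $g\mapsto p'\pi(g)p'$. *)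

theory Defs
  imports "HOL-Analysis.Analysis" "HOL-Algebra.Group"
begin

section \<open>Complex Hilbert spaces\<close>

text \<open>
  The real Hilbert space structure (norm, topology, completeness) is the one of the library; the
  complex structure is compatible with it.  Positive definiteness of \<open>cinner\<close> and
  \<open>norm x ^ 2 = cinner x x\<close> follow from \<open>Re_cinner\<close> and \<open>cinner_commute\<close>.
\<close>

class complex_hilbert = real_inner + complete_space +
  fixes scaleC :: "complex \<Rightarrow> 'a \<Rightarrow> 'a"  (infixr "*\<^sub>C" 75)
    and cinner :: "'a \<Rightarrow> 'a \<Rightarrow> complex"
  assumes scaleC_add_right: "c *\<^sub>C (x + y) = c *\<^sub>C x + c *\<^sub>C y"
    and scaleC_add_left: "(c + d) *\<^sub>C x = c *\<^sub>C x + d *\<^sub>C x"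
    and scaleC_scaleC: "c *\<^sub>C d *\<^sub>C x = (c * d) *\<^sub>C x"
    and scaleC_complex_of_real: "complex_of_real r *\<^sub>C x = r *\<^sub>R x"
    and cinner_commute: "cinner x y = cnj (cinner y x)"
    and cinner_add_left: "cinner (x + y) z = cinner x z + cinner y z"
    and cinner_scaleC_left: "cinner (c *\<^sub>C x) y = c * cinner x y"
    and Re_cinner: "Re (cinner x y) = x \<bullet> y"

definition closed_csubspace :: "'a::complex_hilbert set \<Rightarrow> bool" where
  "closed_csubspace V \<longleftrightarrow> closed V \<and> subspace V \<and> (\<forall>c. \<forall>x\<in>V. c *\<^sub>C x \<in> V)"

definition bounded_clinear :: "('a::complex_hilbert \<Rightarrow> 'b::complex_hilbert) \<Rightarrow> bool" where
  "bounded_clinear T \<longleftrightarrow> bounded_linear T \<and> (\<forall>c x. T (c *\<^sub>C x) = c *\<^sub>C T x)"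

definition commutant ::
    "('a::complex_hilbert \<Rightarrow> 'a) set \<Rightarrow> ('a \<Rightarrow> 'a) set" where
  "commutant A = {T. bounded_clinear T \<and> (\<forall>S\<in>A. T \<circ> S = S \<circ> T)}"

definition is_projection :: "('a::complex_hilbert \<Rightarrow> 'a) \<Rightarrow> bool" where
  "is_projection p \<longleftrightarrow>
     bounded_clinear p \<and> p \<circ> p = p \<and> (\<forall>x y. cinner (p x) y = cinner x (p y))"


section \<open>Groups and unitary representations\<close>

definition icc :: "('g, 'm) monoid_scheme \<Rightarrow> bool" where
  "icc G \<longleftrightarrow>
     (\<forall>g\<in>carrier G. g \<noteq> \<one>\<^bsub>G\<^esub> \<longrightarrow>
        infinite {h \<otimes>\<^bsub>G\<^esub> g \<otimes>\<^bsub>G\<^esub> inv\<^bsub>G\<^esub> h | h. h \<in> carrier G})"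

text \<open>
  From here on, a Hilbert space is a closed complex subspace of a type of class
  \<open>complex_hilbert\<close> (possibly the whole type), so that \<open>p' H\<close> is again one.  Operators on \<open>V\<close>
  are functions on the ambient type, of which only the values on \<open>V\<close> matter.
\<close>

definition unitary_on :: "'a::complex_hilbert set \<Rightarrow> ('a \<Rightarrow> 'a) \<Rightarrow> bool" where
  "unitary_on V U \<longleftrightarrow>
     U ` V = V \<and>
     (\<forall>x\<in>V. \<forall>y\<in>V. U (x + y) = U x + U y) \<and>
     (\<forall>c. \<forall>x\<in>V. U (c *\<^sub>C x) = c *\<^sub>C U x) \<and>
     (\<forall>x\<in>V. \<forall>y\<in>V. cinner (U x) (U y) = cinner x y)"

definition unitary_rep ::
    "('g, 'm) monoid_scheme \<Rightarrow> 'a::complex_hilbert set \<Rightarrow> ('g \<Rightarrow> 'a \<Rightarrow> 'a) \<Rightarrow> bool" where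
  "unitary_rep G V \<sigma> \<longleftrightarrow>
     closed_csubspace V \<and>
     (\<forall>g\<in>carrier G. unitary_on V (\<sigma> g)) \<and>
     (\<forall>g\<in>carrier G. \<forall>h\<in>carrier G. \<forall>x\<in>V. \<sigma> (g \<otimes>\<^bsub>G\<^esub> h) x = \<sigma> g (\<sigma> h x))"

text \<open>The representation \<open>\<pi> p'\<close> on \<open>p' H\<close>.\<close>

definition compress :: "('a \<Rightarrow> 'a) \<Rightarrow> ('g \<Rightarrow> 'a \<Rightarrow> 'a) \<Rightarrow> 'g \<Rightarrow> 'a \<Rightarrow> 'a" where
  "compress p \<pi> g = p \<circ> \<pi> g \<circ> p"


section \<open>Parseval frames and strong disjointness\<close>

text \<open>
  The Hilbert space is given by its underlying set \<open>V\<close> and its inner product \<open>ip\<close>, because direct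
  sums of a variable number of Hilbert spaces are not types; \<open>Re (ip f f)\<close> is the squared norm.
\<close>

definition parseval_frame ::
    "'v set \<Rightarrow> ('v \<Rightarrow> 'v \<Rightarrow> complex) \<Rightarrow> 'i set \<Rightarrow> ('i \<Rightarrow> 'v) \<Rightarrow> bool" where
  "parseval_frame V ip I e \<longleftrightarrow>
     (\<forall>i\<in>I. e i \<in> V) \<and>
     (\<forall>f\<in>V. ((\<lambda>i. (cmod (ip f (e i)))\<^sup>2) has_sum Re (ip f f)) I)"

definition parseval_frame_vector ::
    "('g, 'm) monoid_scheme \<Rightarrow> 'a::complex_hilbert set \<Rightarrow> ('g \<Rightarrow> 'a \<Rightarrow> 'a) \<Rightarrow> 'a \<Rightarrow> bool" where
  "parseval_frame_vector G V \<sigma> \<xi> \<longleftrightarrow>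
     unitary_rep G V \<sigma> \<and> \<xi> \<in> V \<and> parseval_frame V cinner (carrier G) (\<lambda>g. \<sigma> g \<xi>)"

text \<open>
  The Hilbert space direct sum of \<open>V 1, \<dots>, V n\<close> has underlying set
  \<open>\<Pi>\<^sub>E k\<in>{1..n}. V k\<close> and the following inner product.
\<close>

definition sum_cinner ::
    "nat \<Rightarrow> (nat \<Rightarrow> 'a::complex_hilbert) \<Rightarrow> (nat \<Rightarrow> 'a) \<Rightarrow> complex" where
  "sum_cinner n x y = (\<Sum>k=1..n. cinner (x k) (y k))"

definition strongly_disjoint_tuple ::
    "nat \<Rightarrow> (nat \<Rightarrow> 'a::complex_hilbert set) \<Rightarrow> 'i set \<Rightarrow> (nat \<Rightarrow> 'i \<Rightarrow> 'a) \<Rightarrow> bool" where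
  "strongly_disjoint_tuple n V I e \<longleftrightarrow>
     (\<forall>k\<in>{1..n}. parseval_frame (V k) cinner I (e k)) \<and>
     parseval_frame (\<Pi>\<^sub>E k\<in>{1..n}. V k) (sum_cinner n) I (\<lambda>i. \<lambda>k\<in>{1..n}. e k i)"

definition strongly_disjoint_vectors ::
    "('g, 'm) monoid_scheme \<Rightarrow> nat \<Rightarrow> (nat \<Rightarrow> 'a::complex_hilbert set) \<Rightarrow>
     (nat \<Rightarrow> 'g \<Rightarrow> 'a \<Rightarrow> 'a) \<Rightarrow> (nat \<Rightarrow> 'a) \<Rightarrow> bool" where
  "strongly_disjoint_vectors G n V \<sigma> \<xi> \<longleftrightarrow>
     (\<forall>k\<in>{1..n}. parseval_frame_vector G (V k) (\<sigma> k) (\<xi> k)) \<and>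
     strongly_disjoint_tuple n V (carrier G) (\<lambda>k g. \<sigma> k g (\<xi> k))"

text \<open>
  The case \<open>n = 2\<close> separately, since the two Hilbert spaces may live in different types.
\<close>

definition pair_cinner ::
    "'a::complex_hilbert \<times> 'b::complex_hilbert \<Rightarrow> 'a \<times> 'b \<Rightarrow> complex" where
  "pair_cinner x y = cinner (fst x) (fst y) + cinner (snd x) (snd y)"

definition strongly_disjoint ::
    "'a::complex_hilbert set \<Rightarrow> 'b::complex_hilbert set \<Rightarrow> 'i set \<Rightarrow>
     ('i \<Rightarrow> 'a) \<Rightarrow> ('i \<Rightarrow> 'b) \<Rightarrow> bool" where
  "strongly_disjoint V W I e f \<longleftrightarrow>
     parseval_frame V cinner I e \<and> parseval_frame W cinner I f \<and>
     parseval_frame (V \<times> W) pair_cinner I (\<lambda>i. (e i, f i))"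


section \<open>Completing tuples of Parseval frame vectors\<close>

text \<open>
  The spaces \<open>H, \<dots>, H, p' H\<close> (\<open>N\<close> times \<open>H\<close>), with the representations
  \<open>\<pi>, \<dots>, \<pi>, \<pi> p'\<close>.
\<close>

definition tuple_space :: "nat \<Rightarrow> ('a::complex_hilbert \<Rightarrow> 'a) \<Rightarrow> nat \<Rightarrow> 'a set" where
  "tuple_space N p k = (if k \<le> N then UNIV else range p)"

definition tuple_rep ::
    "nat \<Rightarrow> ('a::complex_hilbert \<Rightarrow> 'a) \<Rightarrow> ('g \<Rightarrow> 'a \<Rightarrow> 'a) \<Rightarrow> nat \<Rightarrow> 'g \<Rightarrow> 'a \<Rightarrow> 'a" where
  "tuple_rep N p \<pi> k = (if k \<le> N then \<pi> else compress p \<pi>)"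

definition properties_abc ::
    "('g, 'm) monoid_scheme \<Rightarrow> ('g \<Rightarrow> 'a::complex_hilbert \<Rightarrow> 'a) \<Rightarrow> nat \<Rightarrow>
     (nat \<Rightarrow> 'a) \<Rightarrow> ('a \<Rightarrow> 'a) \<Rightarrow> bool" where
  "properties_abc G \<pi> N \<xi> p \<longleftrightarrow>
     (\<forall>k\<in>{2..N}. parseval_frame_vector G UNIV \<pi> (\<xi> k)) \<and>
     (norm (\<xi> (N + 1)))\<^sup>2 = 1 - real N * (norm (\<xi> 1))\<^sup>2 \<and>
     1 - real N * (norm (\<xi> 1))\<^sup>2 < (norm (\<xi> 1))\<^sup>2 \<and>
     is_projection p \<and> p \<in> commutant (\<pi> ` carrier G) \<and>
     parseval_frame (range p) cinner (carrier G) (\<lambda>g. \<pi> g (\<xi> (N + 1))) \<and>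
     parseval_frame_vector G (range p) (compress p \<pi>) (\<xi> (N + 1)) \<and>
     strongly_disjoint_vectors G (N + 1) (tuple_space N p) (tuple_rep N p \<pi>) \<xi>"

end

theory Submission imports Defs begin

text \<open>
  Let \<open>\<delta>\<close> be the unit vector of \<open>\<ell>\<^sup>2(G)\<close> at the identity.  A Parseval frame vector \<open>\<xi>\<close> for a representation
  \<open>\<sigma>\<close> on \<open>V\<close> turns \<open>V\<close> into a subspace of \<open>\<ell>\<^sup>2(G)\<close>: the coefficient map \<open>\<Theta> x = (\<langle>x, \<sigma> g \<xi>\<rangle>)\<^sub>g\<close> is isometric and
  carries \<open>\<sigma>\<close> to left translation, and \<open>\<Theta> \<xi>\<close> is the projection of \<open>\<delta>\<close> to the range of \<open>\<Theta>\<close>.  So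
  \<open>\<parallel>\<xi>\<parallel>\<^sup>2\<close> is the value at that projection of the trace \<open>P \<mapsto> \<parallel>P \<delta>\<parallel>\<^sup>2\<close>, the von Neumann dimension of
  \<open>V\<close>.  It depends only on the representation (\<open>parseval_vectors_same_norm\<close>), it is strictly monotone
  (\<open>invariant_whole_if_norm_le\<close>), and the whole of \<open>\<ell>\<^sup>2(G)\<close> has dimension \<open>1\<close>.  Frame vectors are strongly
  disjoint exactly when the ranges of their coefficient maps are orthogonal
  (\<open>strongly_disjoint_vectors_iff\<close>).  The theorem is therefore about packing copies of a space of dimension
  \<open>t = \<parallel>\<xi>\<^sub>1\<parallel>\<^sup>2\<close> into a space of dimension \<open>1\<close>.

  After \<open>M\<close> disjoint copies of \<open>H\<close> the orthogonal complement \<open>F\<close> of their ranges has dimension \<open>1 - M t\<close>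
  (\<open>norm_proj_residual_space\<close>).  For an ICC group the operators commuting with left translation form a
  factor, so that of the representations \<open>H\<close> and \<open>F\<close> one embeds into the other (\<open>comparison\<close>).  An
  isomorphism between a subspace \<open>K\<close> of \<open>H\<close> and a subspace \<open>L\<close> of \<open>F\<close> moves the projection of \<open>\<delta>\<close> to \<open>L\<close> back
  to a Parseval frame vector for \<open>K\<close>, whose coefficients lie in \<open>L\<close>
  (\<open>parseval_vector_with_coefficients_in\<close>).  If \<open>(M + 1) t \<le> 1\<close>, then by dimension \<open>K\<close> is all of \<open>H\<close>, and one
  more vector is found (\<open>disjoint_tuple_Suc\<close>).  If \<open>M = N\<close>, then \<open>L\<close> is all of \<open>F\<close>, and \<open>K\<close> is the
  remainder \<open>p' H\<close> (\<open>complete_disjoint_tuple\<close>).  This gives (iii), and (i) is the case \<open>M = 1\<close>.  For (ii), the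
  dimensions of a complete tuple add up to \<open>1\<close>, so that \<open>\<delta> = \<Theta>\<^sub>1 \<xi>\<^sub>1 + \<dots> + \<Theta>\<^sub>N\<^sub>+\<^sub>1 \<xi>\<^sub>N\<^sub>+\<^sub>1\<close>; the coefficients of a vector
  \<open>\<eta>\<close> that is disjoint from all \<open>\<xi>\<^sub>i\<close> are orthogonal to \<open>\<delta>\<close>, which says \<open>\<langle>\<eta>, \<eta>\<rangle> = 0\<close>
  (\<open>no_further_disjoint_vector\<close>).

  The comparison of \<open>H\<close> and \<open>F\<close> has two ingredients.  Any two nonzero invariant subspaces \<open>X\<close> and \<open>Y\<close> of
  \<open>\<ell>\<^sup>2(G)\<close> are connected by a nonzero operator \<open>T = P\<^sub>Y \<rho>\<^sub>h P\<^sub>X\<close>, where \<open>\<rho>\<^sub>h\<close> is a right translation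
  (\<open>icc_right_translates_meet\<close>, where ICC is used).  With a self-adjoint square root \<open>R\<close> of \<open>T\<^sup>* T\<close>, the vectors \<open>R x\<close>
  of \<open>X\<close> and \<open>T x\<close> of \<open>Y\<close> have the same coefficient function, which makes the cyclic subspaces that they
  generate isomorphic.  Zorn's lemma then extends such partial isomorphisms until one of the two spaces
  is exhausted.
\<close>

section \<open>Inner products in complex Hilbert spaces\<close>

lemma cinner_add_right: "cinner x (y + z) = cinner x y + cinner x z"
  by (metis cinner_add_left cinner_commute complex_cnj_add)

lemma cinner_scaleC_right: "cinner x (c *\<^sub>C y) = cnj c * cinner x y"
  by (metis cinner_scaleC_left cinner_commute complex_cnj_mult)

lemma cinner_scaleR_left: "cinner (r *\<^sub>R x) y = of_real r * cinner x y"
  by (metis cinner_scaleC_left scaleC_complex_of_real)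

lemma cinner_scaleR_right: "cinner x (r *\<^sub>R y) = of_real r * cinner x y"
  by (metis cinner_scaleC_right scaleC_complex_of_real complex_cnj_complex_of_real)

lemma cinner_zero_left [simp]: "cinner 0 y = 0"
  using cinner_scaleR_left[of 0 0 y] by simp

lemma cinner_zero_right [simp]: "cinner x 0 = 0"
  using cinner_scaleR_right[of x 0 0] by simp

lemma cinner_minus_left [simp]: "cinner (- x) y = - cinner x y"
  using cinner_scaleR_left[of "-1" x y] by simp

lemma cinner_minus_right [simp]: "cinner x (- y) = - cinner x y"
  using cinner_scaleR_right[of x "-1" y] by simp

lemma cinner_diff_left: "cinner (x - y) z = cinner x z - cinner y z"
  using cinner_add_left[of x "- y" z] by simp

lemma cinner_diff_right: "cinner x (y - z) = cinner x y - cinner x z"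
  using cinner_add_right[of x y "- z"] by simp

lemmas cinner_algebra = cinner_add_left cinner_add_right cinner_diff_left cinner_diff_right
  cinner_scaleC_left cinner_scaleC_right cinner_scaleR_left cinner_scaleR_right

lemma cinner_sum_left: "cinner (\<Sum>i\<in>A. f i) y = (\<Sum>i\<in>A. cinner (f i) y)"
  by (induction A rule: infinite_finite_induct) (auto simp: cinner_add_left)

lemma cinner_sum_right: "cinner y (\<Sum>i\<in>A. f i) = (\<Sum>i\<in>A. cinner y (f i))"
  by (induction A rule: infinite_finite_induct) (auto simp: cinner_add_right)

lemma cinner_self: "cinner x x = of_real ((norm x)\<^sup>2)"
proof -
  have "Im (cinner x x) = 0"
    using arg_cong[OF cinner_commute[of x x], of Im] by simp
  thus ?thesis by (simp add: complex_eq_iff Re_cinner power2_norm_eq_inner)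
qed

lemma cinner_self_eq_0 [simp]: "cinner x x = 0 \<longleftrightarrow> x = 0"
  by (simp add: cinner_self)

lemma scaleC_one [simp]: "1 *\<^sub>C x = x"
  using scaleC_complex_of_real[of 1 x] by simp

lemma scaleC_minus_one: "(-1) *\<^sub>C x = - x"
  using scaleC_complex_of_real[of "-1" x] by simp

lemma scaleC_scaleR: "c *\<^sub>C (r *\<^sub>R x) = r *\<^sub>R (c *\<^sub>C x)"
  by (simp add: scaleC_complex_of_real[symmetric] scaleC_scaleC mult.commute)

lemma norm_scaleC: "norm (c *\<^sub>C x) = cmod c * norm x"
proof -
  have "of_real ((norm (c *\<^sub>C x))\<^sup>2) = (of_real ((cmod c * norm x)\<^sup>2) :: complex)"
    unfolding cinner_self[symmetric] cinner_scaleC_left cinner_scaleC_right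
    using complex_norm_square[of c] by (simp add: cinner_self power_mult_distrib)
  hence "(norm (c *\<^sub>C x))\<^sup>2 = (cmod c * norm x)\<^sup>2" by (simp only: of_real_eq_iff)
  thus ?thesis by (rule power2_eq_imp_eq) auto
qed

lemma cmod_cinner_le: "cmod (cinner x y) \<le> norm x * norm y"
proof (cases "cinner x y = 0")
  case False
  \<comment> \<open>A phase that makes the inner product real and nonnegative.\<close>
  define c where "c = cnj (cinner x y) / cmod (cinner x y)"
  have "cmod c = 1" using False by (simp add: c_def norm_divide)
  have "cmod (cinner x y) = Re (cinner (c *\<^sub>C x) y)"
    using False by (simp add: c_def cinner_scaleC_left complex_norm_square[symmetric] power2_eq_square mult.commute)
  also have "\<dots> \<le> norm (c *\<^sub>C x) * norm y"
    by (simp add: Re_cinner norm_cauchy_schwarz)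
  finally show ?thesis by (simp add: norm_scaleC \<open>cmod c = 1\<close>)
qed auto

lemma cinner_bounded_bilinear: "bounded_bilinear (cinner :: 'a::complex_hilbert \<Rightarrow> _)"
proof
  show "\<exists>K. \<forall>a b. cmod (cinner (a::'a) b) \<le> norm a * norm b * K"
    by (rule exI[of _ 1]) (auto simp: cmod_cinner_le)
qed (auto simp: cinner_algebra scaleR_conv_of_real)

lemmas tendsto_cinner = bounded_bilinear.tendsto[OF cinner_bounded_bilinear]

lemma cinner_eq_0_commute: "cinner x y = 0 \<longleftrightarrow> cinner y x = 0"
  by (metis cinner_commute complex_cnj_zero)

lemma norm_add_sq: "(norm (x + y))\<^sup>2 = (norm x)\<^sup>2 + 2 * Re (cinner x y) + (norm y)\<^sup>2"
  by (simp add: Re_cinner power2_norm_eq_inner inner_add_left inner_add_right inner_commute)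

lemma cinner_eq_if_Re_eq:
  assumes "\<And>c. Re (c * z) = Re (c * w)" shows "z = w"
  using assms[of 1] assms[of \<i>] by (simp add: complex_eq_iff)

text \<open>
  Polarization: the norms of \<open>c x + y\<close>, for all scalars \<open>c\<close>, determine the inner product of \<open>x\<close> and \<open>y\<close>.
\<close>

lemma cinner_preserved_if_norm_preserved:
  assumes "\<And>x y. x \<in> V \<Longrightarrow> y \<in> V \<Longrightarrow> T (x + y) = T x + T y"
    and "\<And>c x. x \<in> V \<Longrightarrow> T (c *\<^sub>C x) = c *\<^sub>C T x"
    and "\<And>x. x \<in> V \<Longrightarrow> norm (T x) = norm x"
    and V: "closed_csubspace V" and "x \<in> V" "y \<in> V"
  shows "cinner (T x) (T y) = cinner x y"
proof (rule cinner_eq_if_Re_eq)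
  fix c
  have c: "c *\<^sub>C x \<in> V" using V \<open>x \<in> V\<close> by (auto simp: closed_csubspace_def)
  have "c *\<^sub>C x + y \<in> V" using V c \<open>y \<in> V\<close> by (auto simp: closed_csubspace_def subspace_add)
  hence "norm (T (c *\<^sub>C x) + T y) = norm (c *\<^sub>C x + y)"
    using assms c by metis
  hence "Re (cinner (T (c *\<^sub>C x)) (T y)) = Re (cinner (c *\<^sub>C x) y)"
    using norm_add_sq[of "T (c *\<^sub>C x)" "T y"] norm_add_sq[of "c *\<^sub>C x" y] assms(3) c \<open>y \<in> V\<close> by simp
  thus "Re (c * cinner (T x) (T y)) = Re (c * cinner x y)"
    using assms(2) \<open>x \<in> V\<close> by (simp add: cinner_scaleC_left)
qed

section \<open>Closed subspaces and orthogonal projections\<close>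

lemma closed_csubspaceD:
  assumes "closed_csubspace V"
  shows "0 \<in> V" "x \<in> V \<Longrightarrow> y \<in> V \<Longrightarrow> x + y \<in> V" "x \<in> V \<Longrightarrow> y \<in> V \<Longrightarrow> x - y \<in> V"
    "x \<in> V \<Longrightarrow> c *\<^sub>C x \<in> V" "x \<in> V \<Longrightarrow> r *\<^sub>R x \<in> V" "x \<in> V \<Longrightarrow> - x \<in> V"
  using assms by (auto simp: closed_csubspace_def subspace_0 subspace_add subspace_diff subspace_scale subspace_neg)

lemma closed_csubspace_limit:
  "closed_csubspace V \<Longrightarrow> (\<And>n. f n \<in> V) \<Longrightarrow> f \<longlonglongrightarrow> x \<Longrightarrow> x \<in> V"
  by (auto simp: closed_csubspace_def closed_sequential_limits)

lemma closed_csubspaceI: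
  assumes "0 \<in> V" "\<And>x y. x \<in> V \<Longrightarrow> y \<in> V \<Longrightarrow> x + y \<in> V" "\<And>c x. x \<in> V \<Longrightarrow> c *\<^sub>C x \<in> V"
    "\<And>f x. (\<And>n. f n \<in> V) \<Longrightarrow> f \<longlonglongrightarrow> x \<Longrightarrow> x \<in> V"
  shows "closed_csubspace V"
  unfolding closed_csubspace_def subspace_def closed_sequential_limits
proof (intro conjI allI impI ballI)
  show "r *\<^sub>R x \<in> V" if "x \<in> V" for r x
    using assms(3)[OF that, of "complex_of_real r"] by (simp add: scaleC_complex_of_real)
qed (use assms in blast)+

lemma closed_csubspace_orthogonal: "closed_csubspace {x. \<forall>y\<in>A. cinner x y = 0}"
proof (rule closed_csubspaceI)
  fix f :: "nat \<Rightarrow> 'a" and x assume f: "\<And>n. f n \<in> {x. \<forall>y\<in>A. cinner x y = 0}" "f \<longlonglongrightarrow> x"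
  { fix y assume "y \<in> A"
    have "(\<lambda>n. cinner (f n) y) \<longlonglongrightarrow> cinner x y" using f(2) by (intro tendsto_cinner) auto
    moreover have "(\<lambda>n. cinner (f n) y) = (\<lambda>_. 0)" using f(1) \<open>y \<in> A\<close> by auto
    ultimately have "cinner x y = 0" using LIMSEQ_const_iff by metis }
  thus "x \<in> {x. \<forall>y\<in>A. cinner x y = 0}" by auto
qed (auto simp: cinner_algebra)

lemma closed_csubspace_Int: "closed_csubspace V \<Longrightarrow> closed_csubspace W \<Longrightarrow> closed_csubspace (V \<inter> W)"
  by (auto simp: closed_csubspace_def subspace_inter closed_Int)

text \<open>
  The nearest point of \<open>V\<close> exists by completeness, and minimality of the distance along every real line in
  \<open>V\<close> makes the real part of the inner product vanish; complex multiples then give the imaginary part.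
\<close>

lemma exists_orthogonal_projection:
  assumes V: "closed_csubspace V"
  shows "\<exists>y\<in>V. \<forall>v\<in>V. cinner (x - y) v = 0"
proof -
  define d where "d = (INF v\<in>V. (norm (x - v))\<^sup>2)"
  have bdd: "bdd_below ((\<lambda>v. (norm (x - v))\<^sup>2) ` V)" by (rule bdd_belowI[of _ 0]) auto
  have d_le: "d \<le> (norm (x - v))\<^sup>2" if "v \<in> V" for v
    unfolding d_def by (rule cINF_lower[OF bdd that])
  have "\<exists>v\<in>V. (norm (x - v))\<^sup>2 < d + inverse (real (Suc n))" for n
  proof -
    have "V \<noteq> {}" using closed_csubspaceD(1)[OF V] by auto
    thus ?thesis using cINF_less_iff[OF _ bdd, of "d + inverse (real (Suc n))"] by (auto simp: d_def)
  qed
  then obtain v where v: "\<And>n. v n \<in> V" "\<And>n. (norm (x - v n))\<^sup>2 < d + inverse (real (Suc n))" by metis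
  \<comment> \<open>The parallelogram law makes a minimising sequence Cauchy.\<close>
  have par: "(norm (v m - v n))\<^sup>2 \<le> 2 * inverse (real (Suc m)) + 2 * inverse (real (Suc n))" for m n
  proof -
    have "(1/2) *\<^sub>R (v m + v n) \<in> V" using v(1) V by (intro closed_csubspaceD) auto
    hence "d \<le> (norm (x - (1/2) *\<^sub>R (v m + v n)))\<^sup>2" by (rule d_le)
    moreover have "(norm (v m - v n))\<^sup>2 + 4 * (norm (x - (1/2) *\<^sub>R (v m + v n)))\<^sup>2
        = 2 * (norm (x - v m))\<^sup>2 + 2 * (norm (x - v n))\<^sup>2"
      by (simp add: power2_norm_eq_inner inner_diff_left inner_diff_right inner_add_left inner_add_right
          inner_commute algebra_simps)
    ultimately show ?thesis using v(2)[of m] v(2)[of n] by simp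
  qed
  have "Cauchy v"
  proof (rule metric_CauchyI)
    fix e :: real assume "e > 0"
    then obtain K where K: "inverse (real (Suc K)) < e\<^sup>2 / 4"
      using reals_Archimedean[of "e\<^sup>2/4"] by auto
    { fix m n assume "m \<ge> K" "n \<ge> K"
      hence "inverse (real (Suc m)) \<le> inverse (real (Suc K))" "inverse (real (Suc n)) \<le> inverse (real (Suc K))" by auto
      hence "(norm (v m - v n))\<^sup>2 < e\<^sup>2" using par[of m n] K by linarith
      hence "dist (v m) (v n) < e" using \<open>e > 0\<close> by (simp add: dist_norm power2_less_imp_less) }
    thus "\<exists>M. \<forall>m\<ge>M. \<forall>n\<ge>M. dist (v m) (v n) < e" by blast
  qed
  then obtain y where y: "v \<longlonglongrightarrow> y" by (auto simp: Cauchy_convergent_iff convergent_def)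
  have "y \<in> V" using closed_csubspace_limit[OF V v(1) y] .
  have "(norm (x - y))\<^sup>2 \<le> d"
  proof (rule LIMSEQ_le)
    show "(\<lambda>n. (norm (x - v n))\<^sup>2) \<longlonglongrightarrow> (norm (x - y))\<^sup>2" by (intro tendsto_intros y)
    show "(\<lambda>n. d + inverse (real (Suc n))) \<longlonglongrightarrow> d"
      using tendsto_add[OF tendsto_const LIMSEQ_inverse_real_of_nat, of d] by simp
  qed (use v(2) less_imp_le in blast)
  have Re: "Re (cinner (x - y) w) = 0" if "w \<in> V" for w
  proof (cases "w = 0")
    case False
    \<comment> \<open>The value of \<open>t\<close> that minimises the distance from \<open>x\<close> to \<open>y + t w\<close>.\<close>
    define t where "t = Re (cinner (x - y) w) / (norm w)\<^sup>2"
    have "y + t *\<^sub>R w \<in> V" using \<open>y \<in> V\<close> that V by (intro closed_csubspaceD) auto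
    from order_trans[OF \<open>(norm (x - y))\<^sup>2 \<le> d\<close> d_le[OF this]]
    have "(norm (x - y))\<^sup>2 \<le> (norm ((x - y) + - (t *\<^sub>R w)))\<^sup>2" by (simp add: diff_diff_eq)
    hence "0 \<le> - 2 * t * Re (cinner (x - y) w) + t\<^sup>2 * (norm w)\<^sup>2"
      by (subst (asm) norm_add_sq) (simp add: cinner_scaleR_right power_mult_distrib)
    also have "\<dots> = - (Re (cinner (x - y) w))\<^sup>2 / (norm w)\<^sup>2"
      using False by (simp add: t_def power2_eq_square field_simps)
    finally have "(Re (cinner (x - y) w))\<^sup>2 / (norm w)\<^sup>2 \<le> 0" by simp
    hence "(Re (cinner (x - y) w))\<^sup>2 \<le> 0"
      using False by (simp add: divide_le_0_iff)
    thus ?thesis by simp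
  qed auto
  have "cinner (x - y) w = 0" if "w \<in> V" for w
  proof (rule cinner_eq_if_Re_eq)
    fix c
    show "Re (c * cinner (x - y) w) = Re (c * 0)"
      using Re[of "cnj c *\<^sub>C w"] closed_csubspaceD(4)[OF V that] by (simp add: cinner_scaleC_right)
  qed
  thus ?thesis using \<open>y \<in> V\<close> by blast
qed

text \<open>
  The orthogonal projection; the value is arbitrary unless \<open>V\<close> is a closed complex subspace.
\<close>

definition proj :: "'a::complex_hilbert set \<Rightarrow> 'a \<Rightarrow> 'a" where
  "proj V x = (SOME y. y \<in> V \<and> (\<forall>v\<in>V. cinner (x - y) v = 0))"

lemma
  assumes "closed_csubspace V"
  shows proj_in: "proj V x \<in> V" and proj_orthogonal: "v \<in> V \<Longrightarrow> cinner (x - proj V x) v = 0"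
  using someI_ex[of "\<lambda>y. y \<in> V \<and> (\<forall>v\<in>V. cinner (x - y) v = 0)"] exists_orthogonal_projection[OF assms, of x]
  unfolding proj_def by blast+

lemma proj_cinner:
  assumes "closed_csubspace V" "v \<in> V"
  shows "cinner (proj V x) v = cinner x v" "cinner v (proj V x) = cinner v x"
proof -
  show *: "cinner (proj V x) v = cinner x v"
    using proj_orthogonal[OF assms(1), of v x] assms(2) by (simp add: cinner_diff_left)
  show "cinner v (proj V x) = cinner v x" using * cinner_commute by metis
qed

lemma proj_eqI:
  assumes "closed_csubspace V" "y \<in> V" "\<And>v. v \<in> V \<Longrightarrow> cinner x v = cinner y v"
  shows "proj V x = y"
proof -
  have "proj V x - y \<in> V" using assms proj_in closed_csubspaceD by metis
  hence "cinner (proj V x - y) (proj V x - y) = 0"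
    using assms(3) proj_cinner(1)[OF assms(1), of "proj V x - y" x] by (simp add: cinner_diff_left)
  thus ?thesis by simp
qed

lemma proj_ident: "closed_csubspace V \<Longrightarrow> x \<in> V \<Longrightarrow> proj V x = x"
  by (rule proj_eqI) auto

lemma proj_add: "closed_csubspace V \<Longrightarrow> proj V (x + y) = proj V x + proj V y"
  by (rule proj_eqI) (auto simp: cinner_add_left proj_cinner proj_in closed_csubspaceD)

lemma proj_scaleC: "closed_csubspace V \<Longrightarrow> proj V (c *\<^sub>C x) = c *\<^sub>C proj V x"
  by (rule proj_eqI) (auto simp: cinner_scaleC_left proj_cinner proj_in closed_csubspaceD)

lemma proj_symmetric:
  assumes "closed_csubspace V" shows "cinner (proj V x) y = cinner x (proj V y)"
  using proj_cinner[OF assms proj_in[OF assms]] by metis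

lemma norm_proj_sq:
  assumes "closed_csubspace V"
  shows "(norm x)\<^sup>2 = (norm (proj V x))\<^sup>2 + (norm (x - proj V x))\<^sup>2"
proof -
  have "cinner (proj V x) (x - proj V x) = 0"
    using proj_orthogonal[OF assms proj_in[OF assms]] cinner_eq_0_commute by blast
  thus ?thesis using norm_add_sq[of "proj V x" "x - proj V x"] by simp
qed

lemma norm_proj_le:
  assumes "closed_csubspace V" shows "norm (proj V x) \<le> norm x"
proof (rule power2_le_imp_le)
  have "0 \<le> (norm (x - proj V x))\<^sup>2" by simp
  thus "(norm (proj V x))\<^sup>2 \<le> (norm x)\<^sup>2" using norm_proj_sq[OF assms, of x] by linarith
qed simp

lemma range_proj:
  assumes V: "closed_csubspace V" shows "range (proj V) = V"
proof
  show "range (proj V) \<subseteq> V" using proj_in[OF V] by blast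
  show "V \<subseteq> range (proj V)"
  proof
    fix x assume "x \<in> V"
    thus "x \<in> range (proj V)" using proj_ident[OF V, of x] by (metis rangeI)
  qed
qed

lemma is_projection_proj:
  assumes V: "closed_csubspace V" shows "is_projection (proj V)"
  unfolding is_projection_def bounded_clinear_def
proof (intro conjI allI)
  show "bounded_linear (proj V)"
    by (rule bounded_linear_intro[where K = 1])
      (auto simp: proj_add[OF V] proj_scaleC[OF V] norm_proj_le[OF V] scaleC_complex_of_real[symmetric])
qed (auto simp: fun_eq_iff proj_scaleC[OF V] proj_ident[OF V] proj_in[OF V] proj_symmetric[OF V])

lemma proj_commute:
  assumes V: "closed_csubspace V" and inv: "\<And>x. x \<in> V \<Longrightarrow> U x \<in> V" "\<And>x. x \<in> V \<Longrightarrow> U' x \<in> V"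
    and adj: "\<And>x y. y \<in> V \<Longrightarrow> cinner (U x) y = cinner x (U' y)"
  shows "proj V (U x) = U (proj V x)"
  by (rule proj_eqI[OF V]) (auto simp: V inv proj_in adj proj_cinner)

section \<open>Square roots of positive operators\<close>

text \<open>
  The iteration \<open>Y\<^sub>0 = 0\<close>, \<open>Y\<^sub>n\<^sub>+\<^sub>1 = ((1 - A) + Y\<^sub>n\<^sup>2) / 2\<close>.  A fixed point \<open>Y\<close> satisfies \<open>(1 - Y)\<^sup>2 = A\<close>, so the
  iterates approximate the defect \<open>1 - \<surd>A\<close>.
\<close>

primrec sqrt_defect :: "('a::complex_hilbert \<Rightarrow> 'a) \<Rightarrow> nat \<Rightarrow> 'a \<Rightarrow> 'a" where
  "sqrt_defect A 0 x = 0"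
| "sqrt_defect A (Suc n) x = (1/2) *\<^sub>R ((x - A x) + sqrt_defect A n (sqrt_defect A n x))"

text \<open>
  The same iteration for the scalar \<open>A = 0\<close>.  All \<open>Y\<^sub>n\<close> are polynomials in \<open>1 - A\<close> with nonnegative
  coefficients, so when \<open>1 - A\<close> has norm at most \<open>1\<close> this increasing, bounded sequence dominates the norms of the
  iterates and of their increments.
\<close>

primrec scalar_defect :: "nat \<Rightarrow> real" where
  "scalar_defect 0 = 0"
| "scalar_defect (Suc n) = (1 + (scalar_defect n)\<^sup>2) / 2"

lemma scalar_defect_bounds: "0 \<le> scalar_defect n" "scalar_defect n \<le> 1"
proof (induction n)
  case (Suc n)
  { case 1 show ?case by simp
  next case 2 show ?case using Suc power_le_one[of "scalar_defect n" 2] by simp }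
qed auto

lemma scalar_defect_mono: "mono scalar_defect"
proof (rule incseq_SucI)
  fix n show "scalar_defect n \<le> scalar_defect (Suc n)"
    using zero_le_power2[of "scalar_defect n - 1"] by (simp add: power2_eq_square algebra_simps)
qed

lemma scalar_defect_Cauchy: "Cauchy scalar_defect"
proof -
  obtain L where "scalar_defect \<longlonglongrightarrow> L"
    using incseq_convergent[OF scalar_defect_mono, of 1] scalar_defect_bounds by blast
  thus ?thesis by (rule LIMSEQ_imp_Cauchy)
qed

lemma linear_sqrt_defect:
  assumes "linear A" shows "linear (sqrt_defect A n)"
proof (induction n)
  case 0 show ?case by (auto intro!: linearI)
next
  case (Suc n)
  note A = linear_add[OF assms] linear_scale[OF assms]
    and S = linear_add[OF Suc] linear_scale[OF Suc]
  show ?case by (rule linearI) (simp_all add: A S algebra_simps)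
qed

lemma sqrt_defect_commute:
  assumes "linear U" "\<And>x. U (A x) = A (U x)"
  shows "U (sqrt_defect A n x) = sqrt_defect A n (U x)"
  by (induction n arbitrary: x)
    (auto simp: linear_add[OF assms(1)] linear_diff[OF assms(1)] linear_scale[OF assms(1)] linear_0[OF assms(1)] assms(2))

lemma sqrt_defect_norm:
  assumes "\<And>x. norm (x - A x) \<le> norm x"
  shows "norm (sqrt_defect A n x) \<le> scalar_defect n * norm x"
proof (induction n arbitrary: x)
  case (Suc n)
  have "norm (sqrt_defect A n (sqrt_defect A n x)) \<le> scalar_defect n * norm (sqrt_defect A n x)"
    by (rule Suc)
  also have "\<dots> \<le> scalar_defect n * (scalar_defect n * norm x)"
    by (intro mult_left_mono Suc scalar_defect_bounds)
  finally have "norm ((x - A x) + sqrt_defect A n (sqrt_defect A n x)) \<le> norm x + (scalar_defect n)\<^sup>2 * norm x"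
    using norm_triangle_mono[OF assms] by (simp add: power2_eq_square mult.assoc)
  thus ?case unfolding sqrt_defect.simps norm_scaleR by (simp add: field_simps)
qed simp

text \<open>
  The iterates commute, hence \<open>Y\<^sub>n\<^sub>+\<^sub>1\<^sup>2 - Y\<^sub>n\<^sup>2 = (Y\<^sub>n\<^sub>+\<^sub>1 - Y\<^sub>n) (Y\<^sub>n\<^sub>+\<^sub>1 + Y\<^sub>n)\<close>, and the same factorization of the scalar
  sequence carries the bound through the induction.
\<close>

lemma sqrt_defect_increment:
  assumes "linear A" "\<And>x. norm (x - A x) \<le> norm x"
  shows "norm (sqrt_defect A (Suc n) x - sqrt_defect A n x) \<le> (scalar_defect (Suc n) - scalar_defect n) * norm x"
proof (induction n arbitrary: x)
  case 0 show ?case using assms(2)[of x] by simp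
next
  case (Suc n)
  define P Q p q where "P = sqrt_defect A (Suc n)" and "Q = sqrt_defect A n"
    and "p = scalar_defect (Suc n)" and "q = scalar_defect n"
  have lin: "linear P" "linear Q" unfolding P_def Q_def by (rule linear_sqrt_defect[OF assms(1)])+
  have "Q (A x) = A (Q x)" for x
    unfolding Q_def by (rule sqrt_defect_commute[OF assms(1), symmetric]) simp
  hence comm: "P (Q x) = Q (P x)"
    unfolding P_def by (intro sqrt_defect_commute[OF lin(2), symmetric])
  have "P (P x) - Q (Q x) = P (P x + Q x) - Q (P x + Q x)"
    by (simp add: linear_add[OF lin(1)] linear_add[OF lin(2)] comm)
  hence "norm (P (P x) - Q (Q x)) \<le> (p - q) * norm (P x + Q x)"
    using Suc unfolding P_def Q_def p_def q_def by metis
  also have "norm (P x + Q x) \<le> (p + q) * norm x"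
    unfolding P_def Q_def p_def q_def distrib_right
    by (intro norm_triangle_mono sqrt_defect_norm assms(2))
  hence "(p - q) * norm (P x + Q x) \<le> (p - q) * ((p + q) * norm x)"
    using scalar_defect_mono by (intro mult_left_mono) (auto simp: p_def q_def mono_def simp del: scalar_defect.simps)
  finally have *: "norm (P (P x) - Q (Q x)) \<le> (p\<^sup>2 - q\<^sup>2) * norm x"
    by (simp add: power2_eq_square algebra_simps)
  have "sqrt_defect A (Suc (Suc n)) x - sqrt_defect A (Suc n) x = (1/2) *\<^sub>R (P (P x) - Q (Q x))"
    by (simp add: P_def Q_def algebra_simps)
  moreover have "scalar_defect (Suc (Suc n)) - scalar_defect (Suc n) = (1/2) * (p\<^sup>2 - q\<^sup>2)"
    by (simp add: p_def q_def field_simps)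
  ultimately show ?case using * by (simp only: norm_scaleR mult.assoc)
qed

lemma sqrt_defect_convergent:
  assumes "linear A" "\<And>x. norm (x - A x) \<le> norm x"
  shows "convergent (\<lambda>n. sqrt_defect A n x)"
proof -
  have le: "norm (sqrt_defect A (n + k) x - sqrt_defect A n x) \<le> (scalar_defect (n + k) - scalar_defect n) * norm x" for n k
  proof (induction k)
    case (Suc k)
    have "norm (sqrt_defect A (n + Suc k) x - sqrt_defect A n x)
      \<le> norm (sqrt_defect A (Suc (n + k)) x - sqrt_defect A (n + k) x) + norm (sqrt_defect A (n + k) x - sqrt_defect A n x)"
      using norm_triangle_ineq[of "sqrt_defect A (Suc (n + k)) x - sqrt_defect A (n + k) x"
          "sqrt_defect A (n + k) x - sqrt_defect A n x"] by simp
    also have "\<dots> \<le> (scalar_defect (Suc (n + k)) - scalar_defect (n + k)) * norm x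
        + (scalar_defect (n + k) - scalar_defect n) * norm x"
      by (intro add_mono Suc sqrt_defect_increment assms)
    finally show ?case by (simp add: algebra_simps)
  qed simp
  have "Cauchy (\<lambda>n. sqrt_defect A n x)"
  proof (rule CauchyI')
    fix e :: real assume "e > 0"
    hence "e / (norm x + 1) > 0" by (simp add: add_nonneg_pos)
    then obtain M where M: "\<And>m n. m \<ge> M \<Longrightarrow> n \<ge> M \<Longrightarrow> dist (scalar_defect m) (scalar_defect n) < e / (norm x + 1)"
      using scalar_defect_Cauchy by (meson metric_CauchyD)
    { fix m n assume "m \<ge> M" "n > m"
      then obtain k where n: "n = m + k" using less_imp_add_positive by blast
      have "scalar_defect n - scalar_defect m \<le> e / (norm x + 1)"
        using M[of n m] \<open>m \<ge> M\<close> \<open>n > m\<close> by (simp add: dist_real_def)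
      hence "(scalar_defect n - scalar_defect m) * norm x \<le> e / (norm x + 1) * norm x"
        by (rule mult_right_mono) simp
      also have "\<dots> < e" using \<open>e > 0\<close> by (simp add: pos_divide_less_eq add_nonneg_pos)
      finally have "norm (sqrt_defect A n x - sqrt_defect A m x) < e" using le[of m k] n by simp
      hence "dist (sqrt_defect A m x) (sqrt_defect A n x) < e" by (simp add: dist_norm norm_minus_commute) }
    thus "\<exists>M. \<forall>m\<ge>M. \<forall>n>m. dist (sqrt_defect A m x) (sqrt_defect A n x) < e" by blast
  qed
  thus ?thesis by (simp add: Cauchy_convergent_iff)
qed

text \<open>
  Positivity of the self-adjoint operator \<open>A\<close> is expressed by \<open>\<parallel>1 - A\<parallel> \<le> 1\<close>.  Being a strong limit of
  polynomials in \<open>A\<close>, the root commutes with whatever commutes with \<open>A\<close> and preserves the closed subspaces that \<open>A\<close>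
  preserves.
\<close>

lemma positive_operator_has_sqrt:
  fixes A :: "'a::complex_hilbert \<Rightarrow> 'a"
  assumes A: "linear A" "\<And>x. norm (x - A x) \<le> norm x" "\<And>x y. cinner (A x) y = cinner x (A y)"
  obtains R where "\<And>x. R (R x) = A x" "\<And>x y. cinner (R x) y = cinner x (R y)"
    "\<And>U x. bounded_linear U \<Longrightarrow> (\<And>x. U (A x) = A (U x)) \<Longrightarrow> U (R x) = R (U x)"
    "\<And>X x. closed_csubspace X \<Longrightarrow> (\<And>x. x \<in> X \<Longrightarrow> A x \<in> X) \<Longrightarrow> x \<in> X \<Longrightarrow> R x \<in> X"
proof -
  define Y where "Y x = lim (\<lambda>n. sqrt_defect A n x)" for x
  have lim: "(\<lambda>n. sqrt_defect A n x) \<longlonglongrightarrow> Y x" for x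
    unfolding Y_def using sqrt_defect_convergent[OF A(1,2)] by (simp add: convergent_LIMSEQ_iff)
  have le: "norm (sqrt_defect A n x) \<le> norm x" for n x
    using sqrt_defect_norm[of A n x, OF A(2)] mult_right_mono[OF scalar_defect_bounds(2)[of n], of "norm x"] by simp
  have add: "Y (x + y) = Y x + Y y" for x y
  proof (rule LIMSEQ_unique[OF lim])
    show "(\<lambda>n. sqrt_defect A n (x + y)) \<longlonglongrightarrow> Y x + Y y"
      unfolding linear_add[OF linear_sqrt_defect[OF A(1)]] by (intro tendsto_add lim)
  qed
  have minus: "Y (- x) = - Y x" for x
  proof (rule LIMSEQ_unique[OF lim])
    show "(\<lambda>n. sqrt_defect A n (- x)) \<longlonglongrightarrow> - Y x"
      unfolding linear_neg[OF linear_sqrt_defect[OF A(1)]] by (intro tendsto_minus lim)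
  qed
  have YY: "(\<lambda>n. sqrt_defect A n (sqrt_defect A n x)) \<longlonglongrightarrow> Y (Y x)" for x
  proof -
    have "(\<lambda>n. sqrt_defect A n (sqrt_defect A n x - Y x)) \<longlonglongrightarrow> 0"
    proof (rule Lim_null_comparison)
      show "\<forall>\<^sub>F n in sequentially. norm (sqrt_defect A n (sqrt_defect A n x - Y x)) \<le> norm (sqrt_defect A n x - Y x)"
        using le by auto
      show "(\<lambda>n. norm (sqrt_defect A n x - Y x)) \<longlonglongrightarrow> 0"
        using lim[of x] LIM_zero tendsto_norm_zero by blast
    qed
    from tendsto_add[OF this lim[of "Y x"]] show ?thesis
      by (simp add: linear_diff[OF linear_sqrt_defect[OF A(1)]])
  qed
  have fixpoint: "Y x = (1/2) *\<^sub>R ((x - A x) + Y (Y x))" for x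
  proof (rule LIMSEQ_unique)
    show "(\<lambda>n. sqrt_defect A (Suc n) x) \<longlonglongrightarrow> Y x" using lim LIMSEQ_Suc by blast
    show "(\<lambda>n. sqrt_defect A (Suc n) x) \<longlonglongrightarrow> (1/2) *\<^sub>R ((x - A x) + Y (Y x))"
      by (simp, intro tendsto_intros YY)
  qed
  have sym: "cinner (sqrt_defect A n x) y = cinner x (sqrt_defect A n y)" for n x y
    by (induction n arbitrary: x y) (simp_all add: cinner_algebra A(3))
  define R where "R x = x - Y x" for x
  show ?thesis
  proof (rule that[of R])
    fix x y
    have "R (R x) = x - 2 *\<^sub>R Y x + Y (Y x)"
      using add[of x "- Y x"] minus[of "Y x"] by (simp add: R_def scaleR_2)
    also have "2 *\<^sub>R Y x = (x - A x) + Y (Y x)" by (subst fixpoint) simp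
    finally show "R (R x) = A x" by simp
    have "cinner (Y x) y = cinner x (Y y)"
    proof (rule LIMSEQ_unique)
      show "(\<lambda>n. cinner (sqrt_defect A n x) y) \<longlonglongrightarrow> cinner (Y x) y" by (intro tendsto_cinner lim tendsto_const)
      show "(\<lambda>n. cinner (sqrt_defect A n x) y) \<longlonglongrightarrow> cinner x (Y y)" unfolding sym by (intro tendsto_cinner lim tendsto_const)
    qed
    thus "cinner (R x) y = cinner x (R y)" by (simp add: R_def cinner_algebra)
  next
    fix U :: "'a \<Rightarrow> 'a" and x assume U: "bounded_linear U" "\<And>x. U (A x) = A (U x)"
    have lU: "linear U" using U(1) bounded_linear.linear by blast
    have "U (Y x) = Y (U x)"
    proof (rule LIMSEQ_unique)
      show "(\<lambda>n. U (sqrt_defect A n x)) \<longlonglongrightarrow> U (Y x)" by (intro bounded_linear.tendsto[OF U(1)] lim)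
      show "(\<lambda>n. U (sqrt_defect A n x)) \<longlonglongrightarrow> Y (U x)"
        unfolding sqrt_defect_commute[of U A, OF lU U(2)] by (rule lim)
    qed
    thus "U (R x) = R (U x)" by (simp add: R_def linear_diff[OF lU])
  next
    fix X x assume X: "closed_csubspace X" "\<And>x. x \<in> X \<Longrightarrow> A x \<in> X" and "x \<in> X"
    have "sqrt_defect A n x \<in> X" if "x \<in> X" for n x
      using that by (induction n arbitrary: x) (auto intro!: closed_csubspaceD(1,2,3,5) X)
    thus "R x \<in> X"
      unfolding R_def using closed_csubspace_limit[OF X(1) _ lim] closed_csubspaceD(3)[OF X(1)] \<open>x \<in> X\<close> by blast
  qed
qed

section \<open>Square-summable functions\<close>

typedef 'i ell2 = "{f :: 'i \<Rightarrow> complex. (\<lambda>i. (cmod (f i))\<^sup>2) summable_on UNIV}"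
  morphisms apply_ell2 Abs_ell2
  by (rule exI[of _ "\<lambda>_. 0"]) auto

lemma ell2_summable: "(\<lambda>i. (cmod (apply_ell2 f i))\<^sup>2) summable_on UNIV"
  using apply_ell2[of f] by simp

lemma apply_Abs_ell2: "(\<lambda>i. (cmod (f i))\<^sup>2) summable_on UNIV \<Longrightarrow> apply_ell2 (Abs_ell2 f) = f"
  by (simp add: Abs_ell2_inverse)

lemma ell2_eqI: "(\<And>i. apply_ell2 f i = apply_ell2 g i) \<Longrightarrow> f = g"
  by (metis apply_ell2_inject ext)

lemma square_summable_add:
  assumes "(\<lambda>i. (cmod (f i))\<^sup>2) summable_on A" "(\<lambda>i. (cmod (g i))\<^sup>2) summable_on A"
  shows "(\<lambda>i. (cmod (f i + g i))\<^sup>2) summable_on A"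
proof (rule summable_on_comparison_test)
  show "(\<lambda>i. 2 * (cmod (f i))\<^sup>2 + 2 * (cmod (g i))\<^sup>2) summable_on A"
    by (intro summable_on_add summable_on_cmult_right assms)
  fix i
  have "(cmod (f i + g i))\<^sup>2 \<le> (cmod (f i) + cmod (g i))\<^sup>2"
    by (intro power_mono norm_triangle_ineq) simp
  also have "\<dots> \<le> 2 * (cmod (f i))\<^sup>2 + 2 * (cmod (g i))\<^sup>2"
    using zero_le_power2[of "cmod (f i) - cmod (g i)"] by (simp add: power2_eq_square algebra_simps)
  finally show "(cmod (f i + g i))\<^sup>2 \<le> 2 * (cmod (f i))\<^sup>2 + 2 * (cmod (g i))\<^sup>2" .
qed auto

lemma square_summable_mult:
  assumes "(\<lambda>i. (cmod (f i))\<^sup>2) summable_on A"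
  shows "(\<lambda>i. (cmod (c * f i))\<^sup>2) summable_on A"
  using summable_on_cmult_right[OF assms, of "(cmod c)\<^sup>2"] by (simp add: norm_mult power_mult_distrib)

lemma summable_mult_cnj:
  assumes "(\<lambda>i. (cmod (f i))\<^sup>2) summable_on A" "(\<lambda>i. (cmod (g i))\<^sup>2) summable_on A"
  shows "(\<lambda>i. f i * cnj (g i)) summable_on A"
proof (rule abs_summable_summable, rule summable_on_comparison_test)
  show "(\<lambda>i. (cmod (f i))\<^sup>2 + (cmod (g i))\<^sup>2) summable_on A"
    by (intro summable_on_add assms)
  fix i
  have "0 \<le> cmod (f i) * cmod (g i)" by simp
  hence "cmod (f i) * cmod (g i) \<le> (cmod (f i))\<^sup>2 + (cmod (g i))\<^sup>2"
    using sum_squares_bound[of "cmod (f i)" "cmod (g i)"] by linarith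
  thus "cmod (f i * cnj (g i)) \<le> (cmod (f i))\<^sup>2 + (cmod (g i))\<^sup>2" by (simp add: norm_mult)
qed auto

instantiation ell2 :: (type) real_vector
begin

definition "0 = Abs_ell2 (\<lambda>_. 0)"
definition "f + g = Abs_ell2 (\<lambda>i. apply_ell2 f i + apply_ell2 g i)"
definition "- f = Abs_ell2 (\<lambda>i. (-1) * apply_ell2 f i)"
definition "f - g = f + (- g :: 'a ell2)"
definition "r *\<^sub>R f = Abs_ell2 (\<lambda>i. of_real r * apply_ell2 f i)"

lemma apply_ell2_ops [simp]:
  fixes f g :: "'a ell2"
  shows "apply_ell2 0 i = 0" "apply_ell2 (f + g) i = apply_ell2 f i + apply_ell2 g i"
    "apply_ell2 (- f) i = - apply_ell2 f i" "apply_ell2 (f - g) i = apply_ell2 f i - apply_ell2 g i"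
    "apply_ell2 (r *\<^sub>R f) i = of_real r * apply_ell2 f i"
  unfolding zero_ell2_def plus_ell2_def uminus_ell2_def minus_ell2_def scaleR_ell2_def
  by (simp_all only: apply_Abs_ell2 square_summable_add square_summable_mult ell2_summable) (simp_all add: apply_Abs_ell2)

instance
  by standard (auto intro!: ell2_eqI simp: algebra_simps)

end

instantiation ell2 :: (type) real_inner
begin

definition "inner f g = Re (\<Sum>\<^sub>\<infinity>i. apply_ell2 f i * cnj (apply_ell2 g i))"
definition "norm f = sqrt (inner f (f :: 'a ell2))"
definition "sgn f = f /\<^sub>R norm (f :: 'a ell2)"
definition "dist f g = norm (f - g :: 'a ell2)"
definition "uniformity = (INF e\<in>{0 <..}. principal {(f, g :: 'a ell2). dist f g < e})"
definition "open U = (\<forall>x\<in>U. eventually (\<lambda>(x', y). x' = x \<longrightarrow> y \<in> (U :: 'a ell2 set)) uniformity)"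

lemma ell2_cinner_has_sum:
  "((\<lambda>i. apply_ell2 f i * cnj (apply_ell2 g i)) has_sum (\<Sum>\<^sub>\<infinity>i. apply_ell2 f i * cnj (apply_ell2 g i))) UNIV"
  by (intro has_sum_infsum summable_mult_cnj ell2_summable)

lemma ell2_inner_self_has_sum: "((\<lambda>i. (cmod (apply_ell2 f i))\<^sup>2) has_sum inner f f) UNIV"
  using has_sum_Re[OF ell2_cinner_has_sum[of f f]]
  by (simp add: inner_ell2_def complex_norm_square[symmetric] del: of_real_power)

instance
proof
  fix f g h :: "'a ell2" and r :: real
  have comm: "(\<Sum>\<^sub>\<infinity>i. apply_ell2 f i * cnj (apply_ell2 g i)) = cnj (\<Sum>\<^sub>\<infinity>i. apply_ell2 g i * cnj (apply_ell2 f i))" for f g :: "'a ell2"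
    by (simp add: mult.commute flip: infsum_cnj)
  show "inner f g = inner g f"
    unfolding inner_ell2_def by (subst comm) simp
  show "inner (f + g) h = inner f h + inner g h"
    unfolding inner_ell2_def
    using infsumI[OF has_sum_add[OF ell2_cinner_has_sum[of f h] ell2_cinner_has_sum[of g h]]]
    by (simp add: distrib_right)
  show "inner (r *\<^sub>R f) g = r * inner f g"
    unfolding inner_ell2_def
    using infsumI[OF has_sum_cmult_right[OF ell2_cinner_has_sum[of f g], of "of_real r"]]
    by (simp add: mult.assoc)
  show "0 \<le> inner f f"
    using has_sum_nonneg[OF ell2_inner_self_has_sum[of f]] by simp
  show "inner f f = 0 \<longleftrightarrow> f = 0"
  proof
    assume "inner f f = 0"
    hence "((\<lambda>i. (cmod (apply_ell2 f i))\<^sup>2) has_sum 0) UNIV" using ell2_inner_self_has_sum[of f] by simp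
    hence "(cmod (apply_ell2 f i))\<^sup>2 = 0" for i
      by (rule nonneg_has_sum_le_0D[where A = UNIV]) auto
    thus "f = 0" by (intro ell2_eqI) simp
  qed (simp add: inner_ell2_def)
qed (auto simp: norm_ell2_def sgn_ell2_def dist_ell2_def uniformity_ell2_def open_ell2_def)

end

lemma norm_ell2_has_sum: "((\<lambda>i. (cmod (apply_ell2 f i))\<^sup>2) has_sum (norm f)\<^sup>2) UNIV"
  using ell2_inner_self_has_sum[of f] by (simp add: power2_norm_eq_inner)

lemma cmod_apply_ell2_le: "cmod (apply_ell2 f i) \<le> norm f"
proof (rule power2_le_imp_le)
  show "(cmod (apply_ell2 f i))\<^sup>2 \<le> (norm f)\<^sup>2"
    using has_sum_mono2[OF has_sum_finite[of "{i}" "\<lambda>i. (cmod (apply_ell2 f i))\<^sup>2"] norm_ell2_has_sum[of f]] by simp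
qed simp

instance ell2 :: (type) complete_space
proof
  fix X :: "nat \<Rightarrow> 'a ell2" assume X: "Cauchy X"
  have "Cauchy (\<lambda>n. apply_ell2 (X n) i)" for i
  proof (rule metric_CauchyI)
    fix e :: real assume "e > 0"
    then obtain M where M: "\<And>m n. m \<ge> M \<Longrightarrow> n \<ge> M \<Longrightarrow> dist (X m) (X n) < e"
      using X by (meson metric_CauchyD)
    have "dist (apply_ell2 (X m) i) (apply_ell2 (X n) i) \<le> dist (X m) (X n)" for m n
      using cmod_apply_ell2_le[of "X m - X n" i] by (simp add: dist_norm)
    thus "\<exists>M. \<forall>m\<ge>M. \<forall>n\<ge>M. dist (apply_ell2 (X m) i) (apply_ell2 (X n) i) < e"
      using M le_less_trans by blast
  qed
  hence "\<exists>l. (\<lambda>n. apply_ell2 (X n) i) \<longlonglongrightarrow> l" for i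
    by (simp add: Cauchy_convergent_iff convergent_def)
  then obtain l where l: "\<And>i. (\<lambda>n. apply_ell2 (X n) i) \<longlonglongrightarrow> l i" by metis
  \<comment> \<open>A bound on the norms of \<open>X m - X n\<close> passes, on finite sets of indices, to the pointwise limit.\<close>
  have bound: "(\<Sum>i\<in>F. (cmod (apply_ell2 (X n) i - l i))\<^sup>2) \<le> e\<^sup>2"
    if "finite F" and M: "\<And>m. m \<ge> M \<Longrightarrow> dist (X n) (X m) < e" for F e M n
  proof (rule LIMSEQ_le_const2)
    show "(\<lambda>m. \<Sum>i\<in>F. (cmod (apply_ell2 (X n) i - apply_ell2 (X m) i))\<^sup>2)
        \<longlonglongrightarrow> (\<Sum>i\<in>F. (cmod (apply_ell2 (X n) i - l i))\<^sup>2)"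
      by (intro tendsto_intros l)
    { fix m assume "m \<ge> M"
      have "(\<Sum>i\<in>F. (cmod (apply_ell2 (X n) i - apply_ell2 (X m) i))\<^sup>2) \<le> (norm (X n - X m))\<^sup>2"
        using has_sum_mono2[OF has_sum_finite[OF \<open>finite F\<close>] norm_ell2_has_sum[of "X n - X m"]] by simp
      also have "\<dots> \<le> e\<^sup>2" using M[OF \<open>m \<ge> M\<close>] by (intro power_mono) (auto simp: dist_norm)
      finally have "(\<Sum>i\<in>F. (cmod (apply_ell2 (X n) i - apply_ell2 (X m) i))\<^sup>2) \<le> e\<^sup>2" . }
    thus "\<exists>N. \<forall>m\<ge>N. (\<Sum>i\<in>F. (cmod (apply_ell2 (X n) i - apply_ell2 (X m) i))\<^sup>2) \<le> e\<^sup>2" by blast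
  qed
  have diff: "(\<lambda>i. (cmod (apply_ell2 (X n) i - l i))\<^sup>2) summable_on UNIV"
    if "\<And>m. m \<ge> M \<Longrightarrow> dist (X n) (X m) < e" for e M n
    by (rule nonneg_bdd_above_summable_on) (auto intro!: bdd_aboveI[of _ "e\<^sup>2"] bound that)
  obtain M1 where M1: "\<And>m n. m \<ge> M1 \<Longrightarrow> n \<ge> M1 \<Longrightarrow> dist (X n) (X m) < 1"
    using metric_CauchyD[OF X, of 1] by auto
  have "(\<lambda>i. (cmod (l i))\<^sup>2) summable_on UNIV"
  proof -
    have "(\<lambda>i. (cmod ((-1) * (apply_ell2 (X M1) i - l i)))\<^sup>2) summable_on UNIV"
      by (intro square_summable_mult diff[of M1 _ 1] M1) auto
    from square_summable_add[OF ell2_summable[of "X M1"] this] show ?thesis by simp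
  qed
  hence L: "apply_ell2 (Abs_ell2 l) = l" by (rule apply_Abs_ell2)
  have "X \<longlonglongrightarrow> Abs_ell2 l"
  proof (rule metric_LIMSEQ_I)
    fix e :: real assume "e > 0"
    then obtain M where M: "\<And>m n. m \<ge> M \<Longrightarrow> n \<ge> M \<Longrightarrow> dist (X n) (X m) < e/2"
      using metric_CauchyD[OF X, of "e/2"] by auto
    { fix n assume "n \<ge> M"
      have "(norm (X n - Abs_ell2 l))\<^sup>2 \<le> (e/2)\<^sup>2"
      proof (rule has_sum_le_finite_sums[OF norm_ell2_has_sum])
        fix F :: "'a set" assume "finite F"
        thus "(\<Sum>i\<in>F. (cmod (apply_ell2 (X n - Abs_ell2 l) i))\<^sup>2) \<le> (e/2)\<^sup>2"
          using bound[of F M n "e/2"] M \<open>n \<ge> M\<close> by (simp add: L)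
      qed
      hence "norm (X n - Abs_ell2 l) \<le> e / 2" by (rule power2_le_imp_le) (use \<open>e > 0\<close> in simp)
      hence "dist (X n) (Abs_ell2 l) < e" using \<open>e > 0\<close> by (simp add: dist_norm) }
    thus "\<exists>M. \<forall>n\<ge>M. dist (X n) (Abs_ell2 l) < e" by blast
  qed
  thus "convergent X" by (auto simp: convergent_def)
qed

instantiation ell2 :: (type) complex_hilbert
begin

definition "c *\<^sub>C f = Abs_ell2 (\<lambda>i. c * apply_ell2 f i)"
definition "cinner f g = (\<Sum>\<^sub>\<infinity>i. apply_ell2 f i * cnj (apply_ell2 g i))"

lemma apply_ell2_scaleC [simp]: "apply_ell2 (c *\<^sub>C f) i = c * apply_ell2 f i"
  unfolding scaleC_ell2_def by (simp add: apply_Abs_ell2 square_summable_mult ell2_summable)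

instance
proof
  fix f g h :: "'a ell2" and c :: complex
  show "cinner f g = cnj (cinner g f)"
    by (simp add: cinner_ell2_def mult.commute flip: infsum_cnj)
  show "cinner (f + g) h = cinner f h + cinner g h"
    unfolding cinner_ell2_def
    using infsumI[OF has_sum_add[OF ell2_cinner_has_sum[of f h] ell2_cinner_has_sum[of g h]]]
    by (simp add: distrib_right)
  show "cinner (c *\<^sub>C f) g = c * cinner f g"
    unfolding cinner_ell2_def
    using infsumI[OF has_sum_cmult_right[OF ell2_cinner_has_sum[of f g], of c]]
    by (simp add: mult.assoc)
qed (auto intro!: ell2_eqI simp: algebra_simps inner_ell2_def cinner_ell2_def)

end

definition unit_ell2 :: "'i \<Rightarrow> 'i ell2" where
  "unit_ell2 j = Abs_ell2 (\<lambda>i. if i = j then 1 else 0)"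

lemma apply_unit_ell2: "apply_ell2 (unit_ell2 j) i = (if i = j then 1 else 0)"
proof -
  have "((\<lambda>i. (cmod (if i = j then 1 else 0))\<^sup>2) has_sum 1) UNIV"
    by (rule has_sum_finite_neutralI[of "{j}"]) auto
  hence "(\<lambda>i. (cmod (if i = j then 1 else 0))\<^sup>2) summable_on UNIV" by (rule has_sum_imp_summable)
  thus ?thesis unfolding unit_ell2_def by (subst apply_Abs_ell2) auto
qed

lemma cinner_unit_ell2: "cinner f (unit_ell2 j) = apply_ell2 f j"
  unfolding cinner_ell2_def
  by (intro infsumI has_sum_finite_neutralI[of "{j}"]) (auto simp: apply_unit_ell2)

lemma norm_unit_ell2: "norm (unit_ell2 j) = 1"
proof -
  have "of_real ((norm (unit_ell2 j))\<^sup>2) = (1 :: complex)"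
    using cinner_unit_ell2[of "unit_ell2 j" j] unfolding cinner_self by (simp add: apply_unit_ell2)
  hence "(norm (unit_ell2 j))\<^sup>2 = 1" using of_real_eq_1_iff by blast
  thus ?thesis using norm_ge_zero[of "unit_ell2 j"] by (simp add: power2_eq_1_iff)
qed

section \<open>Analysis operators\<close>

text \<open>
  The extension by \<open>0\<close> outside of the index set lets frames over any subset of \<open>'i\<close>, in different Hilbert
  spaces, be compared within the one type \<open>'i ell2\<close>.
\<close>

definition analysis :: "'i set \<Rightarrow> ('i \<Rightarrow> 'a::complex_hilbert) \<Rightarrow> 'a \<Rightarrow> 'i ell2" where
  "analysis I e x = Abs_ell2 (\<lambda>i. if i \<in> I then cinner x (e i) else 0)"

lemma has_sum_extend_zero:
  assumes "(f has_sum s) I" "\<And>i. i \<in> I \<Longrightarrow> f' i = f i" "\<And>i. i \<notin> I \<Longrightarrow> f' i = 0"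
  shows "(f' has_sum s) UNIV"
  using assms(1) by (subst has_sum_cong_neutral[where T = I and g = f]) (auto simp: assms(2,3))

context
  fixes V :: "'a::complex_hilbert set" and I :: "'i set" and e :: "'i \<Rightarrow> 'a"
  assumes frame: "parseval_frame V cinner I e"
begin

lemma analysis_has_sum:
  assumes "x \<in> V"
  shows "((\<lambda>i. (cmod (if i \<in> I then cinner x (e i) else 0))\<^sup>2) has_sum (norm x)\<^sup>2) UNIV"
proof (rule has_sum_extend_zero)
  show "((\<lambda>i. (cmod (cinner x (e i)))\<^sup>2) has_sum (norm x)\<^sup>2) I"
    using frame assms by (simp add: parseval_frame_def Re_cinner power2_norm_eq_inner)
qed auto

lemma apply_analysis:
  assumes "x \<in> V"
  shows "apply_ell2 (analysis I e x) i = (if i \<in> I then cinner x (e i) else 0)"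
  unfolding analysis_def by (subst apply_Abs_ell2) (use analysis_has_sum[OF assms] has_sum_imp_summable in blast, simp)

lemma norm_analysis:
  assumes "x \<in> V" shows "norm (analysis I e x) = norm x"
proof -
  have "(norm (analysis I e x))\<^sup>2 = (norm x)\<^sup>2"
    using norm_ell2_has_sum[of "analysis I e x"] analysis_has_sum[OF assms]
    unfolding apply_analysis[OF assms] by (rule has_sum_unique)
  thus ?thesis by (simp add: power2_eq_iff_nonneg)
qed

lemma analysis_add:
  "x \<in> V \<Longrightarrow> y \<in> V \<Longrightarrow> x + y \<in> V \<Longrightarrow> analysis I e (x + y) = analysis I e x + analysis I e y"
  by (rule ell2_eqI) (auto simp: apply_analysis cinner_algebra)

lemma analysis_scaleC:
  "x \<in> V \<Longrightarrow> c *\<^sub>C x \<in> V \<Longrightarrow> analysis I e (c *\<^sub>C x) = c *\<^sub>C analysis I e x"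
  by (rule ell2_eqI) (auto simp: apply_analysis cinner_algebra)

lemma cinner_analysis:
  assumes "closed_csubspace V" "x \<in> V" "y \<in> V"
  shows "cinner (analysis I e x) (analysis I e y) = cinner x y"
  by (rule cinner_preserved_if_norm_preserved[OF _ _ _ assms])
    (auto simp: norm_analysis analysis_add analysis_scaleC closed_csubspaceD[OF assms(1)])

lemma closed_csubspace_analysis_image:
  assumes V: "closed_csubspace V" and W: "closed_csubspace W" and "W \<subseteq> V"
  shows "closed_csubspace (analysis I e ` W)"
proof (rule closed_csubspaceI)
  note V' = closed_csubspaceD[OF V] and W' = closed_csubspaceD[OF W]
  have diff: "norm (analysis I e x - analysis I e y) = norm (x - y)" if "x \<in> W" "y \<in> W" for x y
  proof -
    have "x - y \<in> V" "y \<in> V" using that W'(3) \<open>W \<subseteq> V\<close> by auto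
    from analysis_add[OF this] that \<open>W \<subseteq> V\<close>
    have "analysis I e x - analysis I e y = analysis I e (x - y)" by auto
    thus ?thesis using norm_analysis[OF \<open>x - y \<in> V\<close>] by simp
  qed
  have "analysis I e 0 = 0" using norm_analysis[OF V'(1)] by simp
  thus "0 \<in> analysis I e ` W" using W'(1) by force
  show "x + y \<in> analysis I e ` W" if xy: "x \<in> analysis I e ` W" "y \<in> analysis I e ` W" for x y
  proof -
    obtain v w where vw: "v \<in> W" "w \<in> W" "x = analysis I e v" "y = analysis I e w" using xy by blast
    hence "x + y = analysis I e (v + w)" using analysis_add W'(2) \<open>W \<subseteq> V\<close> by (simp add: subset_eq)
    thus ?thesis using W'(2) vw by blast
  qed
  show "c *\<^sub>C x \<in> analysis I e ` W" if x: "x \<in> analysis I e ` W" for c x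
  proof -
    obtain w where w: "w \<in> W" "x = analysis I e w" using x by blast
    hence "c *\<^sub>C x = analysis I e (c *\<^sub>C w)" using analysis_scaleC W'(4) \<open>W \<subseteq> V\<close> by (simp add: subset_eq)
    thus ?thesis using W'(4) w by blast
  qed
  fix f x assume "\<And>n. f n \<in> analysis I e ` W" and lim: "f \<longlonglongrightarrow> x"
  hence "\<exists>w. w \<in> W \<and> f n = analysis I e w" for n by auto
  then obtain w where w: "\<And>n. w n \<in> W" "\<And>n. f n = analysis I e (w n)" by metis
  have "Cauchy w"
    using LIMSEQ_imp_Cauchy[OF lim] diff[OF w(1) w(1)] by (simp add: Cauchy_def dist_norm w(2))
  then obtain y where y: "w \<longlonglongrightarrow> y" by (auto simp: Cauchy_convergent_iff convergent_def)
  have "y \<in> W" using closed_csubspace_limit[OF W w(1) y] .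
  have "f \<longlonglongrightarrow> analysis I e y"
    using y diff[OF w(1) \<open>y \<in> W\<close>] by (simp add: LIMSEQ_iff w(2))
  hence "x = analysis I e y" using lim LIMSEQ_unique by blast
  thus "x \<in> analysis I e ` W" using \<open>y \<in> W\<close> by blast
qed

end

lemma apply_ell2_sum: "apply_ell2 (\<Sum>k\<in>A. f k) i = (\<Sum>k\<in>A. apply_ell2 (f k) i)"
  by (induction A rule: infinite_finite_induct) auto

text \<open>
  The defining sum of the direct sum at \<open>(f\<^sub>k)\<close> is the squared norm of \<open>\<Theta>\<^sub>1 f\<^sub>1 + \<dots> + \<Theta>\<^sub>n f\<^sub>n\<close>, where \<open>\<Theta>\<^sub>k\<close> is the analysis operator
  of the \<open>k\<close>-th frame.  So strong disjointness says that \<open>(f\<^sub>k) \<mapsto> \<Theta>\<^sub>1 f\<^sub>1 + \<dots> + \<Theta>\<^sub>n f\<^sub>n\<close> is isometric; on tuples with two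
  nonzero entries this means that the ranges are orthogonal, and then Pythagoras gives it for all tuples.
\<close>

lemma strongly_disjoint_tuple_iff:
  fixes V :: "nat \<Rightarrow> 'a::complex_hilbert set" and e :: "nat \<Rightarrow> 'i \<Rightarrow> 'a"
  assumes V: "\<And>k. k \<in> {1..n} \<Longrightarrow> closed_csubspace (V k)"
    and frame: "\<And>k. k \<in> {1..n} \<Longrightarrow> parseval_frame (V k) cinner I (e k)"
  shows "strongly_disjoint_tuple n V I e \<longleftrightarrow>
    (\<forall>j\<in>{1..n}. \<forall>k\<in>{1..n}. j \<noteq> k \<longrightarrow> (\<forall>x\<in>V j. \<forall>y\<in>V k. cinner (analysis I (e j) x) (analysis I (e k) y) = 0))"
    (is "_ \<longleftrightarrow> ?orth")
proof -
  define S where "S f = (\<Sum>k=1..n. analysis I (e k) (f k))" for f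
  have sum: "((\<lambda>i. (cmod (sum_cinner n f (\<lambda>k\<in>{1..n}. e k i)))\<^sup>2) has_sum (norm (S f))\<^sup>2) I"
    if "f \<in> (\<Pi>\<^sub>E k\<in>{1..n}. V k)" for f
  proof -
    have f: "f k \<in> V k" if "k \<in> {1..n}" for k using that \<open>f \<in> _\<close> by auto
    have "apply_ell2 (S f) i = (if i \<in> I then sum_cinner n f (\<lambda>k\<in>{1..n}. e k i) else 0)" for i
      by (auto simp: S_def apply_ell2_sum apply_analysis[OF frame f] sum_cinner_def intro!: sum.cong)
    hence "((\<lambda>i. (cmod (if i \<in> I then sum_cinner n f (\<lambda>k\<in>{1..n}. e k i) else 0))\<^sup>2) has_sum (norm (S f))\<^sup>2) UNIV"
      using norm_ell2_has_sum[of "S f"] by simp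
    thus ?thesis by (subst (asm) has_sum_cong_neutral[where T = I and g = "\<lambda>i. (cmod (sum_cinner n f (\<lambda>k\<in>{1..n}. e k i)))\<^sup>2"]) auto
  qed
  have self: "Re (sum_cinner n f f) = (\<Sum>k=1..n. (norm (f k))\<^sup>2)" for f
    by (simp add: sum_cinner_def Re_cinner power2_norm_eq_inner)
  have "(\<lambda>k\<in>{1..n}. e k i) \<in> (\<Pi>\<^sub>E k\<in>{1..n}. V k)" if "i \<in> I" for i
    using frame that by (auto simp: parseval_frame_def)
  hence "strongly_disjoint_tuple n V I e \<longleftrightarrow> (\<forall>f\<in>(\<Pi>\<^sub>E k\<in>{1..n}. V k).
      ((\<lambda>i. (cmod (sum_cinner n f (\<lambda>k\<in>{1..n}. e k i)))\<^sup>2) has_sum Re (sum_cinner n f f)) I)"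
    unfolding strongly_disjoint_tuple_def parseval_frame_def[of "Pi\<^sub>E _ _"] using frame by blast
  also have "\<dots> \<longleftrightarrow> (\<forall>f\<in>(\<Pi>\<^sub>E k\<in>{1..n}. V k). (norm (S f))\<^sup>2 = (\<Sum>k=1..n. (norm (f k))\<^sup>2))"
  proof (rule ball_cong[OF refl])
    fix f assume "f \<in> (\<Pi>\<^sub>E k\<in>{1..n}. V k)"
    from has_sum_unique[OF sum[OF this]] sum[OF this]
    show "((\<lambda>i. (cmod (sum_cinner n f (\<lambda>k\<in>{1..n}. e k i)))\<^sup>2) has_sum Re (sum_cinner n f f)) I
        \<longleftrightarrow> (norm (S f))\<^sup>2 = (\<Sum>k=1..n. (norm (f k))\<^sup>2)"
      unfolding self by metis
  qed
  also have "\<dots> \<longleftrightarrow> ?orth"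
  proof (intro iffI ballI impI)
    fix j k x y
    assume norm_S: "\<forall>f\<in>(\<Pi>\<^sub>E k\<in>{1..n}. V k). (norm (S f))\<^sup>2 = (\<Sum>k=1..n. (norm (f k))\<^sup>2)"
      and jk: "j \<in> {1..n}" "k \<in> {1..n}" "j \<noteq> k" and "x \<in> V j" "y \<in> V k"
    show "cinner (analysis I (e j) x) (analysis I (e k) y) = 0"
    proof (rule cinner_eq_if_Re_eq)
      fix c
      have cx: "c *\<^sub>C x \<in> V j" using closed_csubspaceD(4)[OF V] jk \<open>x \<in> V j\<close> by blast
      \<comment> \<open>The scalar \<open>c\<close> in the \<open>j\<close>-th entry is what recovers the imaginary part.\<close>
      define f where "f = (\<lambda>m\<in>{1..n}. if m = j then c *\<^sub>C x else if m = k then y else 0)"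
      have f: "f \<in> (\<Pi>\<^sub>E k\<in>{1..n}. V k)"
        using cx \<open>y \<in> V k\<close> closed_csubspaceD(1)[OF V] by (auto simp: f_def)
      have zero: "analysis I (e m) 0 = 0" if "m \<in> {1..n}" for m
        using norm_analysis[OF frame[OF that] closed_csubspaceD(1)[OF V[OF that]]] by simp
      have two: "(\<Sum>m=1..n. h m) = h j + h k"
        if "\<And>m. m \<in> {1..n} \<Longrightarrow> m \<noteq> j \<Longrightarrow> m \<noteq> k \<Longrightarrow> h m = 0" for h :: "nat \<Rightarrow> 'z::comm_monoid_add"
      proof -
        have "(\<Sum>m=1..n. h m) = (\<Sum>m\<in>{j,k}. h m)" using jk that by (intro sum.mono_neutral_right) auto
        thus ?thesis using \<open>j \<noteq> k\<close> by simp
      qed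
      have "S f = analysis I (e j) (c *\<^sub>C x) + analysis I (e k) y"
        unfolding S_def by (subst two) (use jk zero in \<open>auto simp: f_def\<close>)
      moreover have "(\<Sum>m=1..n. (norm (f m))\<^sup>2) = (norm (c *\<^sub>C x))\<^sup>2 + (norm y)\<^sup>2"
        by (subst two) (use jk in \<open>auto simp: f_def\<close>)
      ultimately have "(norm (analysis I (e j) (c *\<^sub>C x) + analysis I (e k) y))\<^sup>2 = (norm (c *\<^sub>C x))\<^sup>2 + (norm y)\<^sup>2"
        using norm_S f by metis
      hence "Re (cinner (analysis I (e j) (c *\<^sub>C x)) (analysis I (e k) y)) = 0"
        unfolding norm_add_sq using norm_analysis[OF frame[OF jk(1)] cx] norm_analysis[OF frame[OF jk(2)] \<open>y \<in> V k\<close>] by simp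
      thus "Re (c * cinner (analysis I (e j) x) (analysis I (e k) y)) = Re (c * 0)"
        using analysis_scaleC[OF frame[OF jk(1)] \<open>x \<in> V j\<close> cx] by (simp add: cinner_scaleC_left)
    qed
  next
    fix f assume orth: ?orth and f: "f \<in> (\<Pi>\<^sub>E k\<in>{1..n}. V k)"
    have fk: "f k \<in> V k" if "k \<in> {1..n}" for k using that f by auto
    have "cinner (S f) (S f) = (\<Sum>j=1..n. \<Sum>k=1..n. cinner (analysis I (e j) (f j)) (analysis I (e k) (f k)))"
      unfolding S_def cinner_sum_left by (intro sum.cong refl cinner_sum_right)
    also have "\<dots> = (\<Sum>j=1..n. \<Sum>k=1..n. if k = j then of_real ((norm (f j))\<^sup>2) else 0)"
    proof (intro sum.cong refl)
      fix j k assume "j \<in> {1..n}" "k \<in> {1..n}"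
      thus "cinner (analysis I (e j) (f j)) (analysis I (e k) (f k)) = (if k = j then of_real ((norm (f j))\<^sup>2) else 0)"
        using orth fk norm_analysis[OF frame fk] by (auto simp: cinner_self)
    qed
    also have "\<dots> = of_real (\<Sum>j=1..n. (norm (f j))\<^sup>2)" by simp
    finally show "(norm (S f))\<^sup>2 = (\<Sum>k=1..n. (norm (f k))\<^sup>2)"
      unfolding cinner_self of_real_eq_iff .
  qed
  finally show ?thesis .
qed

lemma strongly_disjoint_imp_orthogonal:
  assumes V: "closed_csubspace V" and disj: "strongly_disjoint V W I e f" and "x \<in> V" "y \<in> W"
  shows "cinner (analysis I e x) (analysis I f y) = 0"
proof (rule cinner_eq_if_Re_eq)
  fix c
  have e: "parseval_frame V cinner I e" and f: "parseval_frame W cinner I f"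
    and ef: "parseval_frame (V \<times> W) pair_cinner I (\<lambda>i. (e i, f i))"
    using disj by (auto simp: strongly_disjoint_def)
  have cx: "c *\<^sub>C x \<in> V" using closed_csubspaceD(4)[OF V \<open>x \<in> V\<close>] .
  have "((\<lambda>i. (cmod (pair_cinner (c *\<^sub>C x, y) (e i, f i)))\<^sup>2) has_sum (norm (c *\<^sub>C x))\<^sup>2 + (norm y)\<^sup>2) I"
    using ef cx \<open>y \<in> W\<close> by (auto simp: parseval_frame_def pair_cinner_def Re_cinner power2_norm_eq_inner)
  hence "((\<lambda>i. (cmod (apply_ell2 (analysis I e (c *\<^sub>C x) + analysis I f y) i))\<^sup>2) has_sum (norm (c *\<^sub>C x))\<^sup>2 + (norm y)\<^sup>2) UNIV"
    by (rule has_sum_extend_zero) (auto simp: apply_analysis[OF e cx] apply_analysis[OF f \<open>y \<in> W\<close>] pair_cinner_def)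
  hence "(norm (analysis I e (c *\<^sub>C x) + analysis I f y))\<^sup>2 = (norm (c *\<^sub>C x))\<^sup>2 + (norm y)\<^sup>2"
    using norm_ell2_has_sum has_sum_unique by blast
  hence "Re (cinner (analysis I e (c *\<^sub>C x)) (analysis I f y)) = 0"
    unfolding norm_add_sq using norm_analysis[OF e cx] norm_analysis[OF f \<open>y \<in> W\<close>] by simp
  thus "Re (c * cinner (analysis I e x) (analysis I f y)) = Re (c * 0)"
    using analysis_scaleC[OF e \<open>x \<in> V\<close> cx] by (simp add: cinner_scaleC_left)
qed

section \<open>Unitary representations\<close>

locale unitary_representation = group G for G (structure) +
  fixes V :: "'a::complex_hilbert set" and \<sigma> :: "'g \<Rightarrow> 'a \<Rightarrow> 'a"
  assumes rep: "unitary_rep G V \<sigma>"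
begin

lemma space: "closed_csubspace V"
  using rep by (simp add: unitary_rep_def)

lemmas spaceD = closed_csubspaceD[OF space]

lemma rep_image: "g \<in> carrier G \<Longrightarrow> \<sigma> g ` V = V"
  and rep_add: "g \<in> carrier G \<Longrightarrow> x \<in> V \<Longrightarrow> y \<in> V \<Longrightarrow> \<sigma> g (x + y) = \<sigma> g x + \<sigma> g y"
  and rep_scaleC: "g \<in> carrier G \<Longrightarrow> x \<in> V \<Longrightarrow> \<sigma> g (c *\<^sub>C x) = c *\<^sub>C \<sigma> g x"
  and rep_cinner: "g \<in> carrier G \<Longrightarrow> x \<in> V \<Longrightarrow> y \<in> V \<Longrightarrow> cinner (\<sigma> g x) (\<sigma> g y) = cinner x y"
  and rep_mult: "g \<in> carrier G \<Longrightarrow> h \<in> carrier G \<Longrightarrow> x \<in> V \<Longrightarrow> \<sigma> (g \<otimes> h) x = \<sigma> g (\<sigma> h x)"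
  using rep unfolding unitary_rep_def unitary_on_def by blast+

lemma rep_in: "g \<in> carrier G \<Longrightarrow> x \<in> V \<Longrightarrow> \<sigma> g x \<in> V"
  using rep_image imageI by (metis (no_types))

lemma rep_one: assumes "x \<in> V" shows "\<sigma> \<one> x = x"
proof -
  have "x \<in> \<sigma> \<one> ` V" unfolding rep_image[OF one_closed] by (rule assms)
  then obtain y where "y \<in> V" "x = \<sigma> \<one> y" by blast
  thus ?thesis using rep_mult[of \<one> \<one> y] by simp
qed

lemma rep_adjoint:
  assumes "g \<in> carrier G" "x \<in> V" "y \<in> V"
  shows "cinner (\<sigma> g x) y = cinner x (\<sigma> (inv g) y)"
proof -
  have "\<sigma> g (\<sigma> (inv g) y) = y" using rep_mult[of g "inv g" y] assms rep_one by simp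
  thus ?thesis using rep_cinner[of g x "\<sigma> (inv g) y"] assms rep_in by simp
qed

lemma rep_norm: assumes "g \<in> carrier G" "x \<in> V" shows "norm (\<sigma> g x) = norm x"
proof -
  have "complex_of_real ((norm (\<sigma> g x))\<^sup>2) = of_real ((norm x)\<^sup>2)"
    using rep_cinner[of g x x] assms unfolding cinner_self by simp
  hence "(norm (\<sigma> g x))\<^sup>2 = (norm x)\<^sup>2" by (simp only: of_real_eq_iff)
  thus ?thesis by (simp add: power2_eq_iff_nonneg)
qed

definition invariant :: "'a set \<Rightarrow> bool" where
  "invariant W \<longleftrightarrow> closed_csubspace W \<and> W \<subseteq> V \<and> (\<forall>g\<in>carrier G. \<forall>x\<in>W. \<sigma> g x \<in> W)"

lemma invariantD:
  assumes "invariant W"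
  shows "closed_csubspace W" "x \<in> W \<Longrightarrow> x \<in> V" "g \<in> carrier G \<Longrightarrow> x \<in> W \<Longrightarrow> \<sigma> g x \<in> W"
  using assms by (auto simp: invariant_def)

lemma invariant_unitary_rep:
  assumes W: "invariant W" shows "unitary_rep G W \<sigma>"
proof -
  have "\<sigma> g ` W = W" if "g \<in> carrier G" for g
  proof
    show "\<sigma> g ` W \<subseteq> W" using invariantD(3)[OF W that] by blast
    show "W \<subseteq> \<sigma> g ` W"
    proof
      fix x assume "x \<in> W"
      hence "x = \<sigma> g (\<sigma> (inv g) x)" using rep_mult[of g "inv g" x] that rep_one invariantD(2)[OF W] by simp
      thus "x \<in> \<sigma> g ` W" using invariantD(3)[OF W, of "inv g" x] that \<open>x \<in> W\<close> by auto
    qed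
  qed
  thus ?thesis
    unfolding unitary_rep_def unitary_on_def
    using invariantD[OF W] by (auto simp: rep_add rep_scaleC rep_cinner rep_mult)
qed

lemma invariant_orthogonal:
  assumes A: "A \<subseteq> V" "\<And>g x. g \<in> carrier G \<Longrightarrow> x \<in> A \<Longrightarrow> \<sigma> g x \<in> A"
  shows "invariant (V \<inter> {x. \<forall>y\<in>A. cinner x y = 0})"
  unfolding invariant_def
proof (intro conjI ballI closed_csubspace_Int closed_csubspace_orthogonal space)
  fix g x assume "g \<in> carrier G" "x \<in> V \<inter> {x. \<forall>y\<in>A. cinner x y = 0}"
  thus "\<sigma> g x \<in> V \<inter> {x. \<forall>y\<in>A. cinner x y = 0}"
    using A rep_in by (auto simp: rep_adjoint subset_eq)
qed auto

lemma proj_rep: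
  assumes W: "invariant W" and "g \<in> carrier G" "x \<in> V"
  shows "proj W (\<sigma> g x) = \<sigma> g (proj W x)"
proof (rule proj_eqI[OF invariantD(1)[OF W]])
  have P: "proj W x \<in> W" by (rule proj_in[OF invariantD(1)[OF W]])
  show "\<sigma> g (proj W x) \<in> W" using invariantD(3)[OF W] assms P by blast
  fix v assume "v \<in> W"
  hence "\<sigma> (inv g) v \<in> W" using invariantD(3)[OF W, of "inv g"] assms by simp
  thus "cinner (\<sigma> g x) v = cinner (\<sigma> g (proj W x)) v"
    using assms P \<open>v \<in> W\<close> invariantD(2)[OF W] by (simp add: rep_adjoint proj_cinner[OF invariantD(1)[OF W]])
qed

text \<open>
  The trace property.  The sum of \<open>|\<langle>\<xi>, \<sigma> g \<eta>\<rangle>|\<^sup>2\<close> over \<open>G\<close> is \<open>\<parallel>\<xi>\<parallel>\<^sup>2\<close> by the frame of \<open>\<eta>\<close>; replacing \<open>g\<close> by its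
  inverse turns it into the sum for \<open>\<eta>\<close> and the frame of \<open>\<xi>\<close>.
\<close>

lemma parseval_vectors_same_norm:
  assumes "parseval_frame V cinner (carrier G) (\<lambda>g. \<sigma> g \<xi>)" "parseval_frame V cinner (carrier G) (\<lambda>g. \<sigma> g \<eta>)"
    and "\<xi> \<in> V" "\<eta> \<in> V"
  shows "norm \<xi> = norm \<eta>"
proof -
  have "((\<lambda>g. (cmod (cinner \<xi> (\<sigma> g \<eta>)))\<^sup>2) has_sum (norm \<xi>)\<^sup>2) (carrier G)"
    using assms by (auto simp: parseval_frame_def Re_cinner power2_norm_eq_inner)
  moreover have "((\<lambda>g. (cmod (cinner \<xi> (\<sigma> g \<eta>)))\<^sup>2) has_sum (norm \<eta>)\<^sup>2) (carrier G)"
  proof (subst has_sum_reindex_bij_witness[of _ "\<lambda>g. inv g" "\<lambda>g. inv g" _ "\<lambda>g. (cmod (cinner \<eta> (\<sigma> g \<xi>)))\<^sup>2"])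
    fix g assume "g \<in> carrier G"
    hence "cinner \<xi> (\<sigma> g \<eta>) = cnj (cinner \<eta> (\<sigma> (inv g) \<xi>))"
      using rep_adjoint[of g \<eta> \<xi>] assms cinner_commute by metis
    thus "(cmod (cinner \<eta> (\<sigma> (inv g) \<xi>)))\<^sup>2 = (cmod (cinner \<xi> (\<sigma> g \<eta>)))\<^sup>2" by simp
  next
    show "((\<lambda>g. (cmod (cinner \<eta> (\<sigma> g \<xi>)))\<^sup>2) has_sum (norm \<eta>)\<^sup>2) (carrier G)"
      using assms by (auto simp: parseval_frame_def Re_cinner power2_norm_eq_inner)
  qed auto
  ultimately have "(norm \<xi>)\<^sup>2 = (norm \<eta>)\<^sup>2" by (rule has_sum_unique)
  thus ?thesis by (simp add: power2_eq_iff_nonneg)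
qed

end

section \<open>The regular representations\<close>

text \<open>
  The Hilbert space \<open>\<ell>\<^sup>2(A)\<close> inside \<open>'i ell2\<close>; the carrier of a group need not be its whole type.
\<close>

definition ell2_on :: "'i set \<Rightarrow> 'i ell2 set" where
  "ell2_on A = {f. \<forall>i. i \<notin> A \<longrightarrow> apply_ell2 f i = 0}"

lemma closed_csubspace_ell2_on: "closed_csubspace (ell2_on A)"
proof -
  have "ell2_on A = {f. \<forall>u\<in>unit_ell2 ` (- A). cinner f u = 0}"
    by (auto simp: ell2_on_def cinner_unit_ell2)
  thus ?thesis by (simp only: closed_csubspace_orthogonal)
qed

text \<open>
  The common form of left and right translation.
\<close>

definition reindex_ell2 :: "'i set \<Rightarrow> ('i \<Rightarrow> 'i) \<Rightarrow> 'i ell2 \<Rightarrow> 'i ell2" where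
  "reindex_ell2 A \<phi> f = Abs_ell2 (\<lambda>i. if i \<in> A then apply_ell2 f (\<phi> i) else 0)"

lemma reindex_ell2_has_sum:
  assumes "bij_betw \<phi> A A"
  shows "((\<lambda>i. (cmod (if i \<in> A then apply_ell2 f (\<phi> i) else 0))\<^sup>2) has_sum (\<Sum>\<^sub>\<infinity>i\<in>A. (cmod (apply_ell2 f i))\<^sup>2)) UNIV"
proof (rule has_sum_extend_zero)
  have "(\<lambda>i. (cmod (apply_ell2 f i))\<^sup>2) summable_on A"
    by (rule summable_on_subset_banach[OF ell2_summable]) simp
  hence "((\<lambda>i. (cmod (apply_ell2 f i))\<^sup>2) has_sum (\<Sum>\<^sub>\<infinity>i\<in>A. (cmod (apply_ell2 f i))\<^sup>2)) A"
    by (rule has_sum_infsum)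
  thus "((\<lambda>i. (cmod (apply_ell2 f (\<phi> i)))\<^sup>2) has_sum (\<Sum>\<^sub>\<infinity>i\<in>A. (cmod (apply_ell2 f i))\<^sup>2)) A"
    using has_sum_reindex_bij_betw[OF assms, of "\<lambda>i. (cmod (apply_ell2 f i))\<^sup>2"] by simp
qed auto

lemma apply_reindex_ell2:
  assumes "bij_betw \<phi> A A"
  shows "apply_ell2 (reindex_ell2 A \<phi> f) i = (if i \<in> A then apply_ell2 f (\<phi> i) else 0)"
  unfolding reindex_ell2_def
  by (subst apply_Abs_ell2[OF has_sum_imp_summable[OF reindex_ell2_has_sum[OF assms]]]) simp

lemma reindex_ell2_in: "bij_betw \<phi> A A \<Longrightarrow> reindex_ell2 A \<phi> f \<in> ell2_on A"
  by (simp add: ell2_on_def apply_reindex_ell2)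

lemma reindex_ell2_add:
  "bij_betw \<phi> A A \<Longrightarrow> reindex_ell2 A \<phi> (f + g) = reindex_ell2 A \<phi> f + reindex_ell2 A \<phi> g"
  by (rule ell2_eqI) (simp add: apply_reindex_ell2)

lemma reindex_ell2_scaleC:
  "bij_betw \<phi> A A \<Longrightarrow> reindex_ell2 A \<phi> (c *\<^sub>C f) = c *\<^sub>C reindex_ell2 A \<phi> f"
  by (rule ell2_eqI) (simp add: apply_reindex_ell2)

lemma norm_reindex_ell2_le:
  assumes "bij_betw \<phi> A A" shows "norm (reindex_ell2 A \<phi> f) \<le> norm f"
proof (rule power2_le_imp_le)
  have "((\<lambda>i. (cmod (apply_ell2 f i))\<^sup>2) has_sum (\<Sum>\<^sub>\<infinity>i\<in>A. (cmod (apply_ell2 f i))\<^sup>2)) A"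
    by (intro has_sum_infsum summable_on_subset_banach[OF ell2_summable]) simp
  hence "(\<Sum>\<^sub>\<infinity>i\<in>A. (cmod (apply_ell2 f i))\<^sup>2) \<le> (norm f)\<^sup>2"
    by (rule has_sum_mono2[OF _ norm_ell2_has_sum]) auto
  moreover have "(norm (reindex_ell2 A \<phi> f))\<^sup>2 = (\<Sum>\<^sub>\<infinity>i\<in>A. (cmod (apply_ell2 f i))\<^sup>2)"
    using norm_ell2_has_sum[of "reindex_ell2 A \<phi> f"] reindex_ell2_has_sum[OF assms, of f]
    unfolding apply_reindex_ell2[OF assms] by (rule has_sum_unique)
  ultimately show "(norm (reindex_ell2 A \<phi> f))\<^sup>2 \<le> (norm f)\<^sup>2" by simp
qed simp

lemma bounded_linear_reindex_ell2:
  assumes "bij_betw \<phi> A A" shows "bounded_linear (reindex_ell2 A \<phi>)"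
proof (rule bounded_linear_intro[where K = 1])
  fix f :: "'a ell2" and r
  show "reindex_ell2 A \<phi> (r *\<^sub>R f) = r *\<^sub>R reindex_ell2 A \<phi> f"
    using reindex_ell2_scaleC[OF assms, of "of_real r" f] unfolding scaleC_complex_of_real .
qed (use assms in \<open>auto simp: reindex_ell2_add norm_reindex_ell2_le\<close>)

lemma reindex_ell2_adjoint:
  assumes \<phi>: "bij_betw \<phi> A A" and \<psi>: "bij_betw \<psi> A A" and inv: "\<And>i. i \<in> A \<Longrightarrow> \<phi> (\<psi> i) = i"
  shows "cinner (reindex_ell2 A \<phi> f) g = cinner f (reindex_ell2 A \<psi> g)"
proof -
  have \<psi>A: "\<psi> i \<in> A" if "i \<in> A" for i using \<psi> that by (auto simp: bij_betw_def)
  let ?F = "\<lambda>i. (if i \<in> A then apply_ell2 f (\<phi> i) else 0) * cnj (apply_ell2 g i)"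
  have "(?F has_sum cinner (reindex_ell2 A \<phi> f) g) UNIV"
    using ell2_cinner_has_sum[of "reindex_ell2 A \<phi> f" g]
    by (simp add: apply_reindex_ell2[OF \<phi>] cinner_ell2_def)
  hence "(?F has_sum cinner (reindex_ell2 A \<phi> f) g) A"
    by (subst (asm) has_sum_cong_neutral[where T = A and g = ?F]) auto
  hence "((\<lambda>i. ?F (\<psi> i)) has_sum cinner (reindex_ell2 A \<phi> f) g) A"
    using has_sum_reindex_bij_betw[OF \<psi>, of ?F] by simp
  hence "((\<lambda>i. apply_ell2 f i * cnj (if i \<in> A then apply_ell2 g (\<psi> i) else 0))
      has_sum cinner (reindex_ell2 A \<phi> f) g) UNIV"
    by (rule has_sum_extend_zero) (auto simp: inv \<psi>A)
  moreover have "((\<lambda>i. apply_ell2 f i * cnj (if i \<in> A then apply_ell2 g (\<psi> i) else 0))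
      has_sum cinner f (reindex_ell2 A \<psi> g)) UNIV"
    using ell2_cinner_has_sum[of f "reindex_ell2 A \<psi> g"]
    by (simp add: apply_reindex_ell2[OF \<psi>] cinner_ell2_def)
  ultimately show ?thesis by (rule has_sum_unique)
qed

lemma constant_on_infinite_set_eq_0:
  assumes "infinite S" "\<And>i. i \<in> S \<Longrightarrow> apply_ell2 f i = c"
  shows "c = 0"
proof (rule ccontr)
  assume "c \<noteq> 0"
  hence c: "(cmod c)\<^sup>2 > 0" by simp
  obtain n :: nat where n: "(norm f)\<^sup>2 < real n * (cmod c)\<^sup>2"
    using reals_Archimedean3[OF c] by blast
  obtain F where F: "finite F" "card F = n" "F \<subseteq> S"
    using infinite_arbitrarily_large[OF assms(1)] by blast
  have "real n * (cmod c)\<^sup>2 = (\<Sum>i\<in>F. (cmod (apply_ell2 f i))\<^sup>2)"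
    using F assms(2) by (simp add: subset_eq)
  also have "\<dots> \<le> (norm f)\<^sup>2"
    by (rule has_sum_mono2[OF has_sum_finite[OF F(1)] norm_ell2_has_sum]) auto
  finally show False using n by simp
qed

context group
begin

definition left_translation :: "'a \<Rightarrow> 'a ell2 \<Rightarrow> 'a ell2" where
  "left_translation g = reindex_ell2 (carrier G) (\<lambda>i. inv g \<otimes> i)"

definition right_translation :: "'a \<Rightarrow> 'a ell2 \<Rightarrow> 'a ell2" where
  "right_translation h = reindex_ell2 (carrier G) (\<lambda>i. i \<otimes> h)"

lemma bij_left_mult: "g \<in> carrier G \<Longrightarrow> bij_betw (\<lambda>i. g \<otimes> i) (carrier G) (carrier G)"
  by (rule bij_betwI[where g = "\<lambda>i. inv g \<otimes> i"]) (auto simp: m_assoc[symmetric])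

lemma bij_right_mult: "h \<in> carrier G \<Longrightarrow> bij_betw (\<lambda>i. i \<otimes> h) (carrier G) (carrier G)"
  by (rule bij_betwI[where g = "\<lambda>i. i \<otimes> inv h"]) (auto simp: m_assoc)

lemma bij_left_translation: "g \<in> carrier G \<Longrightarrow> bij_betw (\<lambda>i. inv g \<otimes> i) (carrier G) (carrier G)"
  by (rule bij_left_mult) simp

lemma apply_left_translation:
  "g \<in> carrier G \<Longrightarrow> apply_ell2 (left_translation g f) i = (if i \<in> carrier G then apply_ell2 f (inv g \<otimes> i) else 0)"
  by (simp add: left_translation_def apply_reindex_ell2[OF bij_left_translation])

lemma apply_right_translation:
  "h \<in> carrier G \<Longrightarrow> apply_ell2 (right_translation h f) i = (if i \<in> carrier G then apply_ell2 f (i \<otimes> h) else 0)"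
  by (simp add: right_translation_def apply_reindex_ell2[OF bij_right_mult])

lemma left_right_translation_commute:
  "g \<in> carrier G \<Longrightarrow> h \<in> carrier G \<Longrightarrow>
    left_translation g (right_translation h f) = right_translation h (left_translation g f)"
  by (rule ell2_eqI) (simp add: apply_left_translation apply_right_translation m_assoc)

lemma left_translation_adjoint:
  "g \<in> carrier G \<Longrightarrow> cinner (left_translation g f) f' = cinner f (left_translation (inv g) f')"
  unfolding left_translation_def
  by (rule reindex_ell2_adjoint[OF bij_left_translation bij_left_translation]) (auto simp: m_assoc[symmetric])

lemma right_translation_adjoint:
  "g \<in> carrier G \<Longrightarrow> cinner (right_translation g f) f' = cinner f (right_translation (inv g) f')"
  unfolding right_translation_def
  by (rule reindex_ell2_adjoint[OF bij_right_mult bij_right_mult]) (auto simp: m_assoc)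

lemma left_translation_mult:
  "g \<in> carrier G \<Longrightarrow> h \<in> carrier G \<Longrightarrow> left_translation (g \<otimes> h) f = left_translation g (left_translation h f)"
  by (rule ell2_eqI) (simp add: apply_left_translation inv_mult_group m_assoc)

lemma left_translation_one: "f \<in> ell2_on (carrier G) \<Longrightarrow> left_translation \<one> f = f"
  by (rule ell2_eqI) (auto simp: apply_left_translation ell2_on_def)

lemma right_translation_one: "f \<in> ell2_on (carrier G) \<Longrightarrow> right_translation \<one> f = f"
  by (rule ell2_eqI) (auto simp: apply_right_translation ell2_on_def)

lemma left_translation_in: "g \<in> carrier G \<Longrightarrow> left_translation g f \<in> ell2_on (carrier G)"
  unfolding left_translation_def by (rule reindex_ell2_in[OF bij_left_translation])

lemma right_translation_in: "h \<in> carrier G \<Longrightarrow> right_translation h f \<in> ell2_on (carrier G)"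
  unfolding right_translation_def by (rule reindex_ell2_in[OF bij_right_mult])

lemma unit_in: "unit_ell2 \<one> \<in> ell2_on (carrier G)"
  by (auto simp: ell2_on_def apply_unit_ell2)

lemma left_translation_unit:
  assumes "g \<in> carrier G" "h \<in> carrier G"
  shows "left_translation g (unit_ell2 h) = unit_ell2 (g \<otimes> h)"
proof (rule ell2_eqI)
  fix i
  have "inv g \<otimes> i = h \<longleftrightarrow> i = g \<otimes> h" if "i \<in> carrier G"
    using assms that by (metis inv_solve_left)
  thus "apply_ell2 (left_translation g (unit_ell2 h)) i = apply_ell2 (unit_ell2 (g \<otimes> h)) i"
    using assms by (auto simp: apply_left_translation apply_unit_ell2)
qed

lemma cinner_left_translation_unit: "g \<in> carrier G \<Longrightarrow> cinner f (left_translation g (unit_ell2 \<one>)) = apply_ell2 f g"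
  by (simp add: left_translation_unit cinner_unit_ell2)

lemma unitary_rep_left_translation: "unitary_rep G (ell2_on (carrier G)) left_translation"
  unfolding unitary_rep_def unitary_on_def
proof (intro conjI ballI allI)
  fix g assume g: "g \<in> carrier G"
  show "left_translation g ` ell2_on (carrier G) = ell2_on (carrier G)"
  proof
    show "ell2_on (carrier G) \<subseteq> left_translation g ` ell2_on (carrier G)"
    proof
      fix f assume "f \<in> ell2_on (carrier G)"
      hence "f = left_translation g (left_translation (inv g) f)"
        using left_translation_mult[of g "inv g" f] g by (simp add: left_translation_one)
      thus "f \<in> left_translation g ` ell2_on (carrier G)" using left_translation_in[of "inv g" f] g by blast
    qed
  qed (use left_translation_in g in blast)
  { fix f f' assume f: "f \<in> ell2_on (carrier G)" "f' \<in> ell2_on (carrier G)"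
    show "cinner (left_translation g f) (left_translation g f') = cinner f f'"
      using left_translation_mult[of "inv g" g f'] f g by (simp add: left_translation_adjoint left_translation_one) }
  { fix f f' show "left_translation g (f + f') = left_translation g f + left_translation g f'"
      unfolding left_translation_def by (rule reindex_ell2_add[OF bij_left_translation[OF g]]) }
  { fix f c show "left_translation g (c *\<^sub>C f) = c *\<^sub>C left_translation g f"
      unfolding left_translation_def by (rule reindex_ell2_scaleC[OF bij_left_translation[OF g]]) }
qed (auto simp: left_translation_mult closed_csubspace_ell2_on)

sublocale regular: unitary_representation G "ell2_on (carrier G)" left_translation
  by standard (rule unitary_rep_left_translation)

section \<open>ICC groups have a factor as commutant\<close>

text \<open>
  The commutant of left translation is a factor.  If all right translates of \<open>X\<close> were orthogonal to \<open>Y\<close>, let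
  \<open>Z\<close> consist of all vectors with that property.  It is invariant under both translations, hence its projection
  commutes with both, and \<open>v = P\<^sub>Z \<delta>\<close> is a square-summable function that is constant on conjugacy classes.  By ICC it
  is a multiple of \<open>\<delta>\<close>, so \<open>P\<^sub>Z\<close> is a scalar.  As \<open>Z\<close> contains \<open>X\<close>, it is everything, and \<open>Y\<close> is orthogonal
  to itself.
\<close>

lemma icc_right_translates_meet:
  assumes icc: "icc G" and X: "regular.invariant X" "x\<^sub>0 \<in> X" "x\<^sub>0 \<noteq> 0" and Y: "regular.invariant Y" "y\<^sub>0 \<in> Y" "y\<^sub>0 \<noteq> 0"
  shows "\<exists>h\<in>carrier G. \<exists>x\<in>X. \<exists>y\<in>Y. cinner (right_translation h x) y \<noteq> 0"
proof (rule ccontr)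
  assume neg: "\<not> ?thesis"
  define A where "A = {right_translation h y | h y. h \<in> carrier G \<and> y \<in> Y}"
  define Z where "Z = ell2_on (carrier G) \<inter> {x. \<forall>y\<in>A. cinner x y = 0}"
  let ?\<delta> = "unit_ell2 \<one>"
  have Z: "regular.invariant Z"
    unfolding Z_def
  proof (rule regular.invariant_orthogonal)
    show "A \<subseteq> ell2_on (carrier G)" by (auto simp: A_def right_translation_in)
    fix g x assume "g \<in> carrier G" "x \<in> A"
    then obtain h y where "h \<in> carrier G" "y \<in> Y" "x = right_translation h y" by (auto simp: A_def)
    thus "left_translation g x \<in> A"
      using regular.invariantD(3)[OF Y(1), of g y] left_right_translation_commute[of g h y] \<open>g \<in> carrier G\<close>
      by (auto simp: A_def)
  qed
  note Zc = regular.invariantD(1)[OF Z]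
  have right_Z: "right_translation g z \<in> Z" if "g \<in> carrier G" "z \<in> Z" for g z
  proof -
    have "cinner (right_translation g z) (right_translation h y) = 0" if "h \<in> carrier G" "y \<in> Y" for h y
    proof -
      have "right_translation (inv g) (right_translation h y) = right_translation (inv g \<otimes> h) y"
        using \<open>g \<in> carrier G\<close> that by (intro ell2_eqI) (simp add: apply_right_translation m_assoc)
      hence "right_translation (inv g) (right_translation h y) \<in> A"
        using \<open>g \<in> carrier G\<close> that by (auto simp: A_def)
      thus ?thesis using \<open>z \<in> Z\<close> \<open>g \<in> carrier G\<close> by (simp add: Z_def right_translation_adjoint)
    qed
    thus ?thesis using \<open>g \<in> carrier G\<close> by (auto simp: Z_def A_def right_translation_in)
  qed
  have X_Z: "x \<in> Z" if "x \<in> X" for x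
  proof -
    have "cinner x (right_translation h y) = 0" if "h \<in> carrier G" "y \<in> Y" for h y
      using neg right_translation_adjoint[of "inv h" x y] that \<open>x \<in> X\<close> by auto
    thus ?thesis using regular.invariantD(2)[OF X(1) that] by (auto simp: Z_def A_def)
  qed
  \<comment> \<open>The projection onto \<open>Z\<close> commutes with both translations, so that \<open>v\<close> is a class function.\<close>
  define v where "v = proj Z ?\<delta>"
  have v_in: "v \<in> Z" unfolding v_def by (rule proj_in[OF Zc])
  have "apply_ell2 v (g \<otimes> i \<otimes> inv g) = apply_ell2 v i" if "g \<in> carrier G" "i \<in> carrier G" for g i
  proof -
    have "right_translation g ?\<delta> = unit_ell2 (inv g)"
    proof (rule ell2_eqI)
      fix j
      have "j \<otimes> g = \<one> \<longleftrightarrow> j = inv g" if "j \<in> carrier G"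
        using that \<open>g \<in> carrier G\<close> by (metis inv_equality inv_inv l_inv inv_closed)
      thus "apply_ell2 (right_translation g ?\<delta>) j = apply_ell2 (unit_ell2 (inv g)) j"
        using \<open>g \<in> carrier G\<close> by (auto simp: apply_right_translation apply_unit_ell2)
    qed
    hence "left_translation g (right_translation g ?\<delta>) = ?\<delta>"
      using that by (simp add: left_translation_unit)
    moreover have "proj Z (right_translation g ?\<delta>) = right_translation g v"
      unfolding v_def using that right_Z[of "inv g"] right_Z[of g]
      by (intro proj_commute[OF Zc, where U' = "right_translation (inv g)"]) (auto simp: right_translation_adjoint)
    ultimately have v: "left_translation g (right_translation g v) = v"
      using regular.proj_rep[OF Z, of g "right_translation g ?\<delta>"] that by (simp add: v_def right_translation_in)
    have "inv g \<otimes> (g \<otimes> i \<otimes> inv g) \<otimes> g = (inv g \<otimes> g) \<otimes> i \<otimes> (inv g \<otimes> g)"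
      using that by (simp only: m_assoc m_closed inv_closed)
    hence "inv g \<otimes> (g \<otimes> i \<otimes> inv g) \<otimes> g = i" using that by simp
    hence "apply_ell2 (left_translation g (right_translation g v)) (g \<otimes> i \<otimes> inv g) = apply_ell2 v i"
      using that by (simp add: apply_left_translation apply_right_translation)
    thus ?thesis using v by simp
  qed
  hence "apply_ell2 v i = 0" if "i \<in> carrier G" "i \<noteq> \<one>" for i
    using that icc by (intro constant_on_infinite_set_eq_0[of "{h \<otimes> i \<otimes> inv h | h. h \<in> carrier G}" v])
      (auto simp: icc_def)
  moreover have "apply_ell2 v i = 0" if "i \<notin> carrier G" for i
    using regular.invariantD(2)[OF Z v_in] that by (auto simp: ell2_on_def)
  ultimately have "apply_ell2 v i = 0" if "i \<noteq> \<one>" for i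
    using that by blast
  hence v_unit: "v = apply_ell2 v \<one> *\<^sub>C ?\<delta>"
    by (intro ell2_eqI) (auto simp: apply_unit_ell2)
  \<comment> \<open>On \<open>Z\<close>, the scalar that \<open>P\<^sub>Z\<close> has turned out to be acts as the identity.\<close>
  have coeff: "apply_ell2 z g = cnj (apply_ell2 v \<one>) * apply_ell2 z g" if "z \<in> Z" "g \<in> carrier G" for z g
  proof -
    have "left_translation (inv g) z \<in> Z" using regular.invariantD(3)[OF Z] that by simp
    hence "cinner (left_translation (inv g) z) ?\<delta> = cinner (left_translation (inv g) z) v"
      unfolding v_def by (simp add: proj_cinner[OF Zc])
    also have "\<dots> = cnj (apply_ell2 v \<one>) * cinner (left_translation (inv g) z) ?\<delta>"
      by (subst v_unit) (rule cinner_scaleC_right)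
    finally show ?thesis using that by (simp add: cinner_unit_ell2 apply_left_translation)
  qed
  have "\<exists>g\<in>carrier G. apply_ell2 x\<^sub>0 g \<noteq> 0"
  proof (rule ccontr)
    assume "\<not> ?thesis"
    hence "x\<^sub>0 = 0" using regular.invariantD(2)[OF X(1,2)] by (intro ell2_eqI) (auto simp: ell2_on_def)
    thus False using X(3) by simp
  qed
  hence "cnj (apply_ell2 v \<one>) = 1" using coeff X_Z[OF X(2)] by fastforce
  hence "v = ?\<delta>" using v_unit by (simp add: complex_cnj_cancel_iff[of _ 1, simplified])
  hence unit_Z: "?\<delta> \<in> Z" using v_in by simp
  have "apply_ell2 y\<^sub>0 g = 0" if "g \<in> carrier G" for g
  proof -
    have "left_translation g ?\<delta> \<in> Z" using regular.invariantD(3)[OF Z] unit_Z that by blast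
    moreover have "y\<^sub>0 \<in> A"
    proof -
      have "y\<^sub>0 = right_translation \<one> y\<^sub>0"
        using regular.invariantD(2)[OF Y(1,2)] by (simp add: right_translation_one)
      thus ?thesis using Y(2) unfolding A_def by blast
    qed
    ultimately have "cinner y\<^sub>0 (left_translation g ?\<delta>) = 0"
      by (auto simp: Z_def cinner_eq_0_commute[of y\<^sub>0])
    thus ?thesis using that by (simp add: cinner_left_translation_unit)
  qed
  hence "y\<^sub>0 = 0" using regular.invariantD(2)[OF Y(1,2)] by (intro ell2_eqI) (auto simp: ell2_on_def)
  thus False using Y(3) by simp
qed

text \<open>
  With \<open>T = P\<^sub>Y \<rho>\<^sub>h P\<^sub>X\<close>, its adjoint \<open>T'\<close> and \<open>R\<close> a self-adjoint square root of \<open>T' T\<close>,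
  \<open>\<langle>\<lambda>\<^sub>g R x, R x\<rangle> = \<langle>\<lambda>\<^sub>g x, T' T x\<rangle> = \<langle>\<lambda>\<^sub>g T x, T x\<rangle>\<close>.  This is the part of the polar decomposition of \<open>T\<close>
  that comparison needs.
\<close>

lemma icc_common_coefficient:
  assumes icc: "icc G" and X: "regular.invariant X" "x\<^sub>0 \<in> X" "x\<^sub>0 \<noteq> 0" and Y: "regular.invariant Y" "y\<^sub>0 \<in> Y" "y\<^sub>0 \<noteq> 0"
  shows "\<exists>a\<in>X. \<exists>b\<in>Y. a \<noteq> 0 \<and>
    (\<forall>g\<in>carrier G. cinner (left_translation g a) a = cinner (left_translation g b) b)"
proof -
  obtain h x y where h: "h \<in> carrier G" and x: "x \<in> X" and y: "y \<in> Y" and nz: "cinner (right_translation h x) y \<noteq> 0"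
    using icc_right_translates_meet[OF assms] by blast
  note Xc = regular.invariantD(1)[OF X(1)] and Yc = regular.invariantD(1)[OF Y(1)]
  define T where "T z = proj Y (right_translation h (proj X z))" for z
  define T' where "T' z = proj X (right_translation (inv h) (proj Y z))" for z
  define A where "A z = T' (T z)" for z
  have right: "bounded_linear (right_translation k)" if "k \<in> carrier G" for k
    unfolding right_translation_def by (rule bounded_linear_reindex_ell2[OF bij_right_mult[OF that]])
  have proj: "bounded_linear (proj X)" "bounded_linear (proj Y)"
    using is_projection_proj[OF Xc] is_projection_proj[OF Yc] by (auto simp: is_projection_def bounded_clinear_def)
  have left: "bounded_linear (left_translation k)" if "k \<in> carrier G" for k
    unfolding left_translation_def by (rule bounded_linear_reindex_ell2[OF bij_left_translation[OF that]])
  have "bounded_linear A"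
    unfolding A_def T_def T'_def using right[of h] right[of "inv h"] h
    by (intro bounded_linear_compose[OF proj(1)] bounded_linear_compose[OF right] bounded_linear_compose[OF proj(2)] proj) auto
  hence "linear A" by (rule bounded_linear.linear)
  have adj: "cinner (T z) w = cinner z (T' w)" for z w
    unfolding T_def T'_def proj_symmetric[OF Xc, symmetric] proj_symmetric[OF Yc]
    using h by (simp add: right_translation_adjoint)
  have adj': "cinner (T' z) w = cinner z (T w)" for z w
    using adj[of w z] cinner_commute by metis
  have le: "norm (T z) \<le> norm z" "norm (T' z) \<le> norm z" for z
  proof -
    have right_le: "norm (right_translation k w) \<le> norm w" if "k \<in> carrier G" for k w
      unfolding right_translation_def by (rule norm_reindex_ell2_le[OF bij_right_mult[OF that]])
    show "norm (T z) \<le> norm z"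
      unfolding T_def using h
      by (intro order_trans[OF norm_proj_le[OF Yc] order_trans[OF right_le norm_proj_le[OF Xc]]])
    show "norm (T' z) \<le> norm z"
      unfolding T'_def using h
      by (intro order_trans[OF norm_proj_le[OF Xc] order_trans[OF right_le norm_proj_le[OF Yc]]]) auto
  qed
  \<comment> \<open>\<open>\<parallel>z - A z\<parallel>\<^sup>2 = \<parallel>z\<parallel>\<^sup>2 - 2 \<parallel>T z\<parallel>\<^sup>2 + \<parallel>T' (T z)\<parallel>\<^sup>2\<close>, and the last term is at most \<open>\<parallel>T z\<parallel>\<^sup>2\<close>.\<close>
  have contr: "norm (z - A z) \<le> norm z" for z
  proof (rule power2_le_imp_le)
    have "cinner z (A z) = of_real ((norm (T z))\<^sup>2)"
      unfolding A_def adj[symmetric] by (rule cinner_self)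
    hence "Re (cinner z (- A z)) = - (norm (T z))\<^sup>2" by (simp del: of_real_power)
    hence "(norm (z - A z))\<^sup>2 = (norm z)\<^sup>2 - 2 * (norm (T z))\<^sup>2 + (norm (A z))\<^sup>2"
      using norm_add_sq[of z "- A z"] by simp
    moreover have "(norm (A z))\<^sup>2 \<le> (norm (T z))\<^sup>2" unfolding A_def by (intro power_mono le) simp
    moreover have "0 \<le> (norm (T z))\<^sup>2" by simp
    ultimately show "(norm (z - A z))\<^sup>2 \<le> (norm z)\<^sup>2" by linarith
  qed simp
  have sym: "cinner (A z) w = cinner z (A w)" for z w by (simp add: A_def adj adj')
  obtain R where R: "\<And>z. R (R z) = A z" "\<And>z w. cinner (R z) w = cinner z (R w)"
    "\<And>U z. bounded_linear U \<Longrightarrow> (\<And>z. U (A z) = A (U z)) \<Longrightarrow> U (R z) = R (U z)"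
    "\<And>W z. closed_csubspace W \<Longrightarrow> (\<And>z. z \<in> W \<Longrightarrow> A z \<in> W) \<Longrightarrow> z \<in> W \<Longrightarrow> R z \<in> W"
    using positive_operator_has_sqrt[of A, OF \<open>linear A\<close> contr sym] by blast
  have left_proj: "left_translation g (proj W z) = proj W (left_translation g z)"
    if "g \<in> carrier G" "regular.invariant W" for g z W
    using regular.invariantD[OF that(2)] that(1)
    by (intro proj_commute[symmetric, where U' = "left_translation (inv g)"]) (auto simp: left_translation_adjoint)
  have left_T: "left_translation g (T z) = T (left_translation g z)"
    and left_T': "left_translation g (T' z) = T' (left_translation g z)" if "g \<in> carrier G" for g z
    using that h X(1) Y(1) by (simp_all add: T_def T'_def left_proj left_right_translation_commute)
  have left_R: "left_translation g (R z) = R (left_translation g z)" if "g \<in> carrier G" for g z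
    using R(3)[OF left[OF that]] left_T left_T' that by (simp add: A_def)
  have coeff: "cinner (left_translation g (R x)) (R x) = cinner (left_translation g (T x)) (T x)" if "g \<in> carrier G" for g
    using that by (simp add: left_R left_T R(1) A_def adj' flip: R(2))
  have Rx: "R x \<in> X" by (rule R(4)[OF Xc _ x]) (simp add: A_def T'_def proj_in[OF Xc])
  have Tx: "T x \<in> Y" by (simp add: T_def proj_in[OF Yc])
  have "cinner (T x) y \<noteq> 0"
    using nz by (simp add: T_def proj_cinner[OF Yc y] proj_ident[OF Xc x])
  hence "T x \<noteq> 0" by auto
  have "R x \<noteq> 0"
  proof
    assume "R x = 0"
    hence "cinner (left_translation \<one> (T x)) (T x) = 0" using coeff[of \<one>] by simp
    thus False
      using \<open>T x \<noteq> 0\<close> left_translation_one[OF regular.invariantD(2)[OF Y(1) Tx]] by simp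
  qed
  thus ?thesis using Rx Tx coeff by blast
qed

end

section \<open>Comparison of representations\<close>

text \<open>
  \<open>M\<close> is the graph of an isometric intertwining map between closed invariant subspaces of \<open>V\<close> and of \<open>W\<close>.
  Single-valuedness and injectivity follow from the preservation of inner products, and graphs make the notion
  symmetric in \<open>V\<close> and \<open>W\<close>.
\<close>

definition isometric_intertwiner ::
    "('g, 'm) monoid_scheme \<Rightarrow> 'a::complex_hilbert set \<Rightarrow> ('g \<Rightarrow> 'a \<Rightarrow> 'a) \<Rightarrow>
     'b::complex_hilbert set \<Rightarrow> ('g \<Rightarrow> 'b \<Rightarrow> 'b) \<Rightarrow> ('a \<times> 'b) set \<Rightarrow> bool" where
  "isometric_intertwiner G V \<sigma> W \<tau> M \<longleftrightarrow> M \<subseteq> V \<times> W \<and> (0, 0) \<in> M \<and>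
    (\<forall>a b a' b'. (a, b) \<in> M \<longrightarrow> (a', b') \<in> M \<longrightarrow> (a + a', b + b') \<in> M \<and> cinner a a' = cinner b b') \<and>
    (\<forall>a b c. (a, b) \<in> M \<longrightarrow> (c *\<^sub>C a, c *\<^sub>C b) \<in> M) \<and>
    (\<forall>a b. \<forall>g\<in>carrier G. (a, b) \<in> M \<longrightarrow> (\<sigma> g a, \<tau> g b) \<in> M) \<and>
    (\<forall>f h a b. (\<forall>n. (f n, h n) \<in> M) \<longrightarrow> f \<longlonglongrightarrow> a \<longrightarrow> h \<longlonglongrightarrow> b \<longrightarrow> (a, b) \<in> M)"

lemma isometric_intertwinerD:
  assumes "isometric_intertwiner G V \<sigma> W \<tau> M"
  shows "(a, b) \<in> M \<Longrightarrow> a \<in> V" "(a, b) \<in> M \<Longrightarrow> b \<in> W" "(0, 0) \<in> M"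
    "(a, b) \<in> M \<Longrightarrow> (a', b') \<in> M \<Longrightarrow> (a + a', b + b') \<in> M"
    "(a, b) \<in> M \<Longrightarrow> (a', b') \<in> M \<Longrightarrow> cinner a a' = cinner b b'"
    "(a, b) \<in> M \<Longrightarrow> (c *\<^sub>C a, c *\<^sub>C b) \<in> M"
    "g \<in> carrier G \<Longrightarrow> (a, b) \<in> M \<Longrightarrow> (\<sigma> g a, \<tau> g b) \<in> M"
    "(\<And>n. (f n, h n) \<in> M) \<Longrightarrow> f \<longlonglongrightarrow> a \<Longrightarrow> h \<longlonglongrightarrow> b \<Longrightarrow> (a, b) \<in> M"
proof -
  note M = assms[unfolded isometric_intertwiner_def]
  from M have sub: "M \<subseteq> V \<times> W" by (elim conjE)
  show "(a, b) \<in> M \<Longrightarrow> a \<in> V" "(a, b) \<in> M \<Longrightarrow> b \<in> W" using sub by blast+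
  show "(0, 0) \<in> M" using M by (elim conjE)
  from M have *: "\<forall>a b a' b'. (a, b) \<in> M \<longrightarrow> (a', b') \<in> M \<longrightarrow> (a + a', b + b') \<in> M \<and> cinner a a' = cinner b b'"
    by (elim conjE)
  show "(a, b) \<in> M \<Longrightarrow> (a', b') \<in> M \<Longrightarrow> (a + a', b + b') \<in> M"
    "(a, b) \<in> M \<Longrightarrow> (a', b') \<in> M \<Longrightarrow> cinner a a' = cinner b b'"
    using * by blast+
  from M have *: "\<forall>a b c. (a, b) \<in> M \<longrightarrow> (c *\<^sub>C a, c *\<^sub>C b) \<in> M" by (elim conjE)
  show "(a, b) \<in> M \<Longrightarrow> (c *\<^sub>C a, c *\<^sub>C b) \<in> M" using * by blast
  from M have *: "\<forall>a b. \<forall>g\<in>carrier G. (a, b) \<in> M \<longrightarrow> (\<sigma> g a, \<tau> g b) \<in> M" by (elim conjE)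
  show "g \<in> carrier G \<Longrightarrow> (a, b) \<in> M \<Longrightarrow> (\<sigma> g a, \<tau> g b) \<in> M" using * by blast
  from M have *: "\<forall>f h a b. (\<forall>n. (f n, h n) \<in> M) \<longrightarrow> f \<longlonglongrightarrow> a \<longrightarrow> h \<longlonglongrightarrow> b \<longrightarrow> (a, b) \<in> M"
    by (elim conjE)
  show "(\<And>n. (f n, h n) \<in> M) \<Longrightarrow> f \<longlonglongrightarrow> a \<Longrightarrow> h \<longlonglongrightarrow> b \<Longrightarrow> (a, b) \<in> M" using * by blast
qed

lemma isometric_intertwiner_converse:
  assumes M: "isometric_intertwiner G V \<sigma> W \<tau> M"
  shows "isometric_intertwiner G W \<tau> V \<sigma> (M\<inverse>)"
  unfolding isometric_intertwiner_def converse_iff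
proof (intro conjI allI impI ballI)
  show "M\<inverse> \<subseteq> W \<times> V" using isometric_intertwinerD(1,2)[OF M] by auto
  show "(0, 0) \<in> M" by (rule isometric_intertwinerD(3)[OF M])
  fix a b a' b' assume "(b, a) \<in> M" "(b', a') \<in> M"
  thus "(b + b', a + a') \<in> M" "cinner a a' = cinner b b'"
    using isometric_intertwinerD(4,5)[OF M] by simp_all
next
  fix a b c assume "(b, a) \<in> M" thus "(c *\<^sub>C b, c *\<^sub>C a) \<in> M" by (rule isometric_intertwinerD(6)[OF M])
next
  fix a b g assume "g \<in> carrier G" "(b, a) \<in> M" thus "(\<sigma> g b, \<tau> g a) \<in> M" by (rule isometric_intertwinerD(7)[OF M])
next
  fix f h a b assume "\<forall>n. (h n, f n) \<in> M" "f \<longlonglongrightarrow> a" "h \<longlonglongrightarrow> b"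
  thus "(b, a) \<in> M"
    using isometric_intertwinerD(8)[OF M, of h f b a] by blast
qed

lemma isometric_intertwiner_norm_diff:
  assumes M: "isometric_intertwiner G V \<sigma> W \<tau> M" and "(a, b) \<in> M" "(a', b') \<in> M"
  shows "norm (a - a') = norm (b - b')"
proof -
  have "(- a', - b') \<in> M" using isometric_intertwinerD(6)[OF M assms(3), of "-1"] by (simp add: scaleC_minus_one)
  hence "(a - a', b - b') \<in> M" using isometric_intertwinerD(4)[OF M assms(2)] by fastforce
  from isometric_intertwinerD(5)[OF M this this]
  have "(norm (a - a'))\<^sup>2 = (norm (b - b'))\<^sup>2" unfolding cinner_self of_real_eq_iff .
  thus ?thesis by (simp add: power2_eq_iff_nonneg)
qed

text \<open>
  The domain is closed because partners of a Cauchy sequence form a Cauchy sequence and the graph is closed.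
\<close>

lemma (in unitary_representation) isometric_intertwiner_Domain:
  assumes M: "isometric_intertwiner G V \<sigma> W \<tau> M"
  shows "invariant (Domain M)"
  unfolding invariant_def
proof (intro conjI ballI closed_csubspaceI)
  show "0 \<in> Domain M" using isometric_intertwinerD(3)[OF M] by blast
  show "Domain M \<subseteq> V" using isometric_intertwinerD(1)[OF M] by blast
  show "\<sigma> g x \<in> Domain M" if "g \<in> carrier G" "x \<in> Domain M" for g x
    using that isometric_intertwinerD(7)[OF M] by blast
  show "x + y \<in> Domain M" if "x \<in> Domain M" "y \<in> Domain M" for x y
    using that isometric_intertwinerD(4)[OF M] by blast
  show "c *\<^sub>C x \<in> Domain M" if "x \<in> Domain M" for c x
    using that isometric_intertwinerD(6)[OF M] by blast
  fix f x assume "\<And>n. f n \<in> Domain M" and lim: "f \<longlonglongrightarrow> x"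
  hence "\<exists>b. (f n, b) \<in> M" for n by (auto simp: Domain_iff)
  then obtain h where h: "\<And>n. (f n, h n) \<in> M" by metis
  have "Cauchy h"
    using LIMSEQ_imp_Cauchy[OF lim] isometric_intertwiner_norm_diff[OF M h h] by (simp add: Cauchy_def dist_norm)
  then obtain y where "h \<longlonglongrightarrow> y" by (auto simp: Cauchy_convergent_iff convergent_def)
  from isometric_intertwinerD(8)[OF M h lim this] show "x \<in> Domain M" by blast
qed

lemma (in unitary_representation) complement_nonzero:
  assumes K: "invariant K" and "K \<noteq> V"
  obtains x where "x \<in> V \<inter> {x. \<forall>y\<in>K. cinner x y = 0}" "x \<noteq> 0"
proof -
  obtain z where z: "z \<in> V" "z \<notin> K" using assms invariantD(2)[OF K] by blast
  note P = proj_in[OF invariantD(1)[OF K], of z]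
  show ?thesis
  proof (rule that[of "z - proj K z"])
    show "z - proj K z \<in> V \<inter> {x. \<forall>y\<in>K. cinner x y = 0}"
      using z P spaceD(3) invariantD(2)[OF K] proj_orthogonal[OF invariantD(1)[OF K]] by auto
    show "z - proj K z \<noteq> 0" using z P by auto
  qed
qed

text \<open>
  Zorn's lemma is applied to sets of pairs \<open>(a, b)\<close> in which any two, possibly equal, members satisfy
  \<open>\<langle>\<sigma> g a, a'\<rangle> = \<langle>\<tau> g b, b'\<rangle>\<close> for all \<open>g\<close>.  The condition concerns two pairs at a time, so unions of chains need
  no completion.  It is stable under linear combinations, limits and the action of \<open>G\<close>, so a maximal set is
  the graph of an intertwiner.  If neither domain nor range were exhausted, a pair with a common coefficient function in
  the two orthogonal complements could be added.
\<close>

lemma comparison: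
  fixes V :: "'a::complex_hilbert set" and W :: "'b::complex_hilbert set"
  assumes "unitary_representation G V \<sigma>" "unitary_representation G W \<tau>"
    and common: "\<And>X Y x y. unitary_representation.invariant G V \<sigma> X \<Longrightarrow> x \<in> X \<Longrightarrow> x \<noteq> 0 \<Longrightarrow>
      unitary_representation.invariant G W \<tau> Y \<Longrightarrow> y \<in> Y \<Longrightarrow> y \<noteq> 0 \<Longrightarrow>
      \<exists>a\<in>X. \<exists>b\<in>Y. a \<noteq> 0 \<and> (\<forall>g\<in>carrier G. cinner (\<sigma> g a) a = cinner (\<tau> g b) b)"
  obtains M where "isometric_intertwiner G V \<sigma> W \<tau> M" "Domain M = V \<or> Range M = W"
proof -
  interpret S: unitary_representation G V \<sigma> by fact
  interpret T: unitary_representation G W \<tau> by fact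
  define compat where "compat p q \<longleftrightarrow>
    (\<forall>g\<in>carrier G. cinner (\<sigma> g (fst p)) (fst q) = cinner (\<tau> g (snd p)) (snd q))" for p q :: "'a \<times> 'b"
  define \<F> where "\<F> = {M. M \<subseteq> V \<times> W \<and> (\<forall>p\<in>M. \<forall>q\<in>M. compat p q)}"
  have "\<exists>M\<in>\<F>. \<forall>M'\<in>\<F>. M \<subseteq> M' \<longrightarrow> M' = M"
  proof (rule subset_Zorn')
    fix C assume C: "subset.chain \<F> C"
    have "compat p q" if pq: "p \<in> \<Union>C" "q \<in> \<Union>C" for p q
    proof -
      obtain P Q where PQ: "P \<in> C" "p \<in> P" "Q \<in> C" "q \<in> Q" using pq by blast
      hence "P \<subseteq> Q \<or> Q \<subseteq> P" using C by (auto simp: subset_chain_def)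
      moreover have "P \<in> \<F>" "Q \<in> \<F>" using C PQ by (auto simp: subset_chain_def)
      ultimately show ?thesis using PQ by (auto simp: \<F>_def)
    qed
    moreover have "\<Union>C \<subseteq> V \<times> W" using C unfolding subset_chain_def \<F>_def by blast
    ultimately show "\<Union>C \<in> \<F>" by (simp add: \<F>_def)
  qed
  then obtain M where "M \<in> \<F>" and max: "\<And>M'. M' \<in> \<F> \<Longrightarrow> M \<subseteq> M' \<Longrightarrow> M' = M" by blast
  hence sub: "\<And>a b. (a, b) \<in> M \<Longrightarrow> a \<in> V \<and> b \<in> W" and compat: "\<And>p q. p \<in> M \<Longrightarrow> q \<in> M \<Longrightarrow> compat p q"
    by (auto simp: \<F>_def)
  have compat_sym: "compat q p" if "compat p q" "p \<in> V \<times> W" "q \<in> V \<times> W" for p q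
    unfolding compat_def
  proof
    fix g assume g: "g \<in> carrier G"
    have "cinner (\<sigma> g (fst q)) (fst p) = cnj (cinner (\<sigma> (inv\<^bsub>G\<^esub> g) (fst p)) (fst q))"
      using S.rep_adjoint[of g "fst q" "fst p"] that g cinner_commute by (metis mem_Times_iff)
    also have "\<dots> = cnj (cinner (\<tau> (inv\<^bsub>G\<^esub> g) (snd p)) (snd q))"
      using that(1) S.inv_closed[OF g] by (simp add: compat_def)
    also have "\<dots> = cinner (\<tau> g (snd q)) (snd p)"
      using T.rep_adjoint[of g "snd q" "snd p"] that g cinner_commute by (metis mem_Times_iff)
    finally show "cinner (\<sigma> g (fst q)) (fst p) = cinner (\<tau> g (snd q)) (snd p)" .
  qed
  \<comment> \<open>Maximality: a pair that is compatible with itself and with all of \<open>M\<close> belongs to \<open>M\<close>.\<close>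
  have memI: "(a, b) \<in> M" if "a \<in> V" "b \<in> W" "compat (a, b) (a, b)" "\<And>q. q \<in> M \<Longrightarrow> compat (a, b) q" for a b
  proof -
    have "insert (a, b) M \<in> \<F>"
      using that sub compat compat_sym[of "(a, b)"] by (auto simp: \<F>_def)
    from max[OF this] show ?thesis by blast
  qed
  have coeff: "cinner (\<sigma> g a) a' = cinner (\<tau> g b) b'" if "(a, b) \<in> M" "(a', b') \<in> M" "g \<in> carrier G" for a b a' b' g
    using compat[OF that(1,2)] that(3) by (simp add: compat_def)
  have isometric: "cinner a a' = cinner b b'" if "(a, b) \<in> M" "(a', b') \<in> M" for a b a' b'
    using coeff[OF that S.one_closed] sub that by (simp add: S.rep_one T.rep_one)
  have M: "isometric_intertwiner G V \<sigma> W \<tau> M"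
    unfolding isometric_intertwiner_def
  proof (intro conjI allI impI ballI)
    show "M \<subseteq> V \<times> W" using sub by auto
    have zero: "\<sigma> g 0 = 0" "\<tau> g 0 = 0" if "g \<in> carrier G" for g
      using S.rep_norm[OF that S.spaceD(1)] T.rep_norm[OF that T.spaceD(1)] by simp_all
    show "(0, 0) \<in> M" by (rule memI) (auto simp: S.spaceD T.spaceD compat_def zero)
  next
    fix a b a' b' assume p: "(a, b) \<in> M" "(a', b') \<in> M"
    show "cinner a a' = cinner b b'" by (rule isometric[OF p])
    show "(a + a', b + b') \<in> M"
      using sub[OF p(1)] sub[OF p(2)] coeff[OF p(1,1)] coeff[OF p(1,2)] coeff[OF p(2,1)] coeff[OF p(2,2)] coeff[OF p(1)] coeff[OF p(2)]
      by (intro memI) (auto simp: compat_def S.spaceD T.spaceD S.rep_add T.rep_add cinner_add_left cinner_add_right)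
  next
    fix a b c assume p: "(a, b) \<in> M"
    show "(c *\<^sub>C a, c *\<^sub>C b) \<in> M"
      using sub[OF p] coeff[OF p] coeff[OF p p]
      by (intro memI) (auto simp: compat_def S.spaceD T.spaceD S.rep_scaleC T.rep_scaleC cinner_scaleC_left cinner_scaleC_right)
  next
    fix a b h assume p: "(a, b) \<in> M" and h: "h \<in> carrier G"
    have in_VW: "\<sigma> h a \<in> V" "\<tau> h b \<in> W" using sub[OF p] h by (auto simp: S.rep_in T.rep_in)
    have c: "cinner (\<sigma> g (\<sigma> h a)) a' = cinner (\<tau> g (\<tau> h b)) b'" if "g \<in> carrier G" "(a', b') \<in> M" for g a' b'
      using coeff[OF p that(2), of "g \<otimes>\<^bsub>G\<^esub> h"] that h sub[OF p] by (simp add: S.rep_mult T.rep_mult)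
    show "(\<sigma> h a, \<tau> h b) \<in> M"
    proof (rule memI[OF in_VW])
      show "compat (\<sigma> h a, \<tau> h b) q" if "q \<in> M" for q
        using c that by (cases q) (auto simp: compat_def)
      have "cinner (\<sigma> g (\<sigma> h a)) (\<sigma> h a) = cinner (\<tau> g (\<tau> h b)) (\<tau> h b)" if g: "g \<in> carrier G" for g
      proof -
        have "cinner (\<sigma> g (\<sigma> h a)) (\<sigma> h a) = cinner (\<sigma> (inv\<^bsub>G\<^esub> h) (\<sigma> g (\<sigma> h a))) a"
          using S.rep_adjoint[of "inv\<^bsub>G\<^esub> h" "\<sigma> g (\<sigma> h a)" a] g h in_VW sub[OF p] by (simp add: S.rep_in)
        also have "\<dots> = cinner (\<sigma> (inv\<^bsub>G\<^esub> h \<otimes>\<^bsub>G\<^esub> g) (\<sigma> h a)) a"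
          using g h in_VW by (simp add: S.rep_mult)
        also have "\<dots> = cinner (\<tau> (inv\<^bsub>G\<^esub> h \<otimes>\<^bsub>G\<^esub> g) (\<tau> h b)) b"
          using c[OF _ p] g h by simp
        also have "\<dots> = cinner (\<tau> (inv\<^bsub>G\<^esub> h) (\<tau> g (\<tau> h b))) b"
          using g h in_VW by (simp add: T.rep_mult)
        also have "\<dots> = cinner (\<tau> g (\<tau> h b)) (\<tau> h b)"
          using T.rep_adjoint[of "inv\<^bsub>G\<^esub> h" "\<tau> g (\<tau> h b)" b] g h in_VW sub[OF p] by (simp add: T.rep_in)
        finally show ?thesis .
      qed
      thus "compat (\<sigma> h a, \<tau> h b) (\<sigma> h a, \<tau> h b)" by (simp add: compat_def)
    qed
  next
    fix f h a b assume p: "\<forall>n. (f n, h n) \<in> M" and lim: "f \<longlonglongrightarrow> a" "h \<longlonglongrightarrow> b"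
    have in_VW: "a \<in> V" "b \<in> W"
      using closed_csubspace_limit[OF S.space _ lim(1)] closed_csubspace_limit[OF T.space _ lim(2)] p sub by blast+
    have c: "cinner (\<sigma> g a) a' = cinner (\<tau> g b) b'" if g: "g \<in> carrier G" and q: "(a', b') \<in> M" for g a' b'
    proof -
      have "(\<lambda>n. cinner (f n) (\<sigma> (inv\<^bsub>G\<^esub> g) a')) \<longlonglongrightarrow> cinner a (\<sigma> (inv\<^bsub>G\<^esub> g) a')"
        by (intro tendsto_cinner lim tendsto_const)
      moreover have "(\<lambda>n. cinner (h n) (\<tau> (inv\<^bsub>G\<^esub> g) b')) \<longlonglongrightarrow> cinner b (\<tau> (inv\<^bsub>G\<^esub> g) b')"
        by (intro tendsto_cinner lim tendsto_const)
      moreover have "cinner (f n) (\<sigma> (inv\<^bsub>G\<^esub> g) a') = cinner (h n) (\<tau> (inv\<^bsub>G\<^esub> g) b')" for n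
        using coeff[OF p[rule_format, of n] q g] sub[OF p[rule_format, of n]] sub[OF q] g
        by (simp add: S.rep_adjoint T.rep_adjoint)
      ultimately have "cinner a (\<sigma> (inv\<^bsub>G\<^esub> g) a') = cinner b (\<tau> (inv\<^bsub>G\<^esub> g) b')"
        using LIMSEQ_unique by simp
      thus ?thesis using in_VW sub[OF q] g by (simp add: S.rep_adjoint T.rep_adjoint)
    qed
    show "(a, b) \<in> M"
    proof (rule memI[OF in_VW])
      show "compat (a, b) q" if "q \<in> M" for q using c that by (cases q) (auto simp: compat_def)
      have "cinner (\<sigma> g a) a = cinner (\<tau> g b) b" if g: "g \<in> carrier G" for g
      proof (rule LIMSEQ_unique)
        show "(\<lambda>n. cinner (\<sigma> g a) (f n)) \<longlonglongrightarrow> cinner (\<sigma> g a) a" by (intro tendsto_cinner lim tendsto_const)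
        show "(\<lambda>n. cinner (\<sigma> g a) (f n)) \<longlonglongrightarrow> cinner (\<tau> g b) b"
          using c[OF g p[rule_format]] by (simp, intro tendsto_cinner lim tendsto_const)
      qed
      thus "compat (a, b) (a, b)" by (simp add: compat_def)
    qed
  qed
  have "Domain M = V \<or> Range M = W"
  proof (rule ccontr)
    assume neg: "\<not> ?thesis"
    have K: "S.invariant (Domain M)" by (rule S.isometric_intertwiner_Domain[OF M])
    have L: "T.invariant (Range M)"
      using T.isometric_intertwiner_Domain[OF isometric_intertwiner_converse[OF M]] by simp
    define X where "X = V \<inter> {x. \<forall>y\<in>Domain M. cinner x y = 0}"
    define Y where "Y = W \<inter> {x. \<forall>y\<in>Range M. cinner x y = 0}"
    have "Domain M \<noteq> V" "Range M \<noteq> W" using neg by auto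
    obtain x where "x \<in> X" "x \<noteq> 0"
      unfolding X_def by (rule S.complement_nonzero[OF K \<open>Domain M \<noteq> V\<close>])
    moreover obtain y where "y \<in> Y" "y \<noteq> 0"
      unfolding Y_def by (rule T.complement_nonzero[OF L \<open>Range M \<noteq> W\<close>])
    moreover have X: "S.invariant X"
      unfolding X_def using S.invariantD[OF K] by (intro S.invariant_orthogonal) auto
    moreover have Y: "T.invariant Y"
      unfolding Y_def using T.invariantD[OF L] by (intro T.invariant_orthogonal) auto
    ultimately obtain a b where ab: "a \<in> X" "b \<in> Y" "a \<noteq> 0"
      "\<And>g. g \<in> carrier G \<Longrightarrow> cinner (\<sigma> g a) a = cinner (\<tau> g b) b"
      using common[of X x Y y] by blast
    have "(a, b) \<in> M"
    proof (rule memI)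
      show "a \<in> V" "b \<in> W" using ab by (auto simp: X_def Y_def)
      show "compat (a, b) (a, b)" using ab by (simp add: compat_def)
      fix q assume q: "q \<in> M"
      have "cinner (\<sigma> g a) (fst q) = 0" "cinner (\<tau> g b) (snd q) = 0" if "g \<in> carrier G" for g
        using S.invariantD(3)[OF X that ab(1)] T.invariantD(3)[OF Y that ab(2)] q
        by (cases q, auto simp: X_def Y_def)+
      thus "compat (a, b) q" by (simp add: compat_def)
    qed
    hence "cinner a a = 0" using ab(1) unfolding X_def by blast
    thus False using ab(3) by simp
  qed
  with M show ?thesis by (rule that)
qed

section \<open>Parseval frame vectors and the regular representation\<close>

lemma unitary_representationI: "group G \<Longrightarrow> unitary_rep G V \<sigma> \<Longrightarrow> unitary_representation G V \<sigma>"
  by (simp add: unitary_representation_def unitary_representation_axioms_def)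

lemma unitary_rep_cong:
  assumes "group G" "unitary_rep G V \<sigma>"
    and eq: "\<And>g x. g \<in> carrier G \<Longrightarrow> x \<in> V \<Longrightarrow> \<tau> g x = \<sigma> g x"
  shows "unitary_rep G V \<tau>"
proof -
  interpret unitary_representation G V \<sigma> by (rule unitary_representationI) fact+
  have "\<tau> g ` V = V" if "g \<in> carrier G" for g
    using rep_image[OF that] eq[OF that] by (simp cong: image_cong)
  thus ?thesis
    unfolding unitary_rep_def unitary_on_def
    by (auto simp: eq space spaceD rep_in rep_add rep_scaleC rep_cinner rep_mult)
qed

definition coefficient :: "('g, 'm) monoid_scheme \<Rightarrow> ('g \<Rightarrow> 'a::complex_hilbert \<Rightarrow> 'a) \<Rightarrow> 'a \<Rightarrow> 'a \<Rightarrow> 'g ell2" where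
  "coefficient G \<sigma> \<xi> = analysis (carrier G) (\<lambda>g. \<sigma> g \<xi>)"

locale parseval_vector = unitary_representation G V \<sigma> for G (structure) and V and \<sigma> +
  fixes \<xi>
  assumes vector: "\<xi> \<in> V" and frame: "parseval_frame V cinner (carrier G) (\<lambda>g. \<sigma> g \<xi>)"
begin

abbreviation "\<Theta> \<equiv> coefficient G \<sigma> \<xi>"

lemma apply_coefficient:
  "x \<in> V \<Longrightarrow> apply_ell2 (\<Theta> x) g = (if g \<in> carrier G then cinner x (\<sigma> g \<xi>) else 0)"
  unfolding coefficient_def by (rule apply_analysis[OF frame])

lemma cinner_coefficient: "x \<in> V \<Longrightarrow> y \<in> V \<Longrightarrow> cinner (\<Theta> x) (\<Theta> y) = cinner x y"
  unfolding coefficient_def by (rule cinner_analysis[OF frame space])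

lemma cinner_coefficient_unit: "x \<in> V \<Longrightarrow> cinner (\<Theta> x) (unit_ell2 \<one>) = cinner x \<xi>"
  by (simp add: cinner_unit_ell2 apply_coefficient rep_one vector)

lemma coefficient_in: "x \<in> V \<Longrightarrow> \<Theta> x \<in> ell2_on (carrier G)"
  by (simp add: ell2_on_def apply_coefficient)

lemma left_translation_coefficient:
  "g \<in> carrier G \<Longrightarrow> x \<in> V \<Longrightarrow> left_translation g (\<Theta> x) = \<Theta> (\<sigma> g x)"
  by (rule ell2_eqI)
    (simp add: apply_left_translation apply_coefficient rep_in rep_adjoint rep_mult vector)

lemma invariant_coefficient_image:
  assumes X: "invariant X" shows "regular.invariant (\<Theta> ` X)"
  unfolding regular.invariant_def
proof (intro conjI ballI)
  show "closed_csubspace (\<Theta> ` X)"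
    unfolding coefficient_def
    using invariantD[OF X] by (intro closed_csubspace_analysis_image[OF frame space]) auto
  show "\<Theta> ` X \<subseteq> ell2_on (carrier G)" using invariantD(2)[OF X] coefficient_in by blast
  fix g f assume "g \<in> carrier G" "f \<in> \<Theta> ` X"
  thus "left_translation g f \<in> \<Theta> ` X"
    using invariantD(2,3)[OF X] left_translation_coefficient by auto
qed

text \<open>
  The coefficient map identifies \<open>X\<close> with an invariant subspace of the regular representation.
\<close>

lemma icc_common_coefficient_regular:
  assumes icc: "icc G" and X: "invariant X" "x \<in> X" "x \<noteq> 0" and Y: "regular.invariant Y" "y \<in> Y" "y \<noteq> 0"
  shows "\<exists>a\<in>X. \<exists>b\<in>Y. a \<noteq> 0 \<and> (\<forall>g\<in>carrier G. cinner (\<sigma> g a) a = cinner (left_translation g b) b)"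
proof -
  have zero: "\<Theta> z = 0 \<longleftrightarrow> z = 0" if "z \<in> V" for z
    using cinner_coefficient[OF that that] cinner_self_eq_0 by metis
  have "\<Theta> x \<noteq> 0" using zero X invariantD(2) by blast
  then obtain a b where ab: "a \<in> X" "b \<in> Y" "\<Theta> a \<noteq> 0"
    "\<And>g. g \<in> carrier G \<Longrightarrow> cinner (left_translation g (\<Theta> a)) (\<Theta> a) = cinner (left_translation g b) b"
    using icc_common_coefficient[OF icc invariant_coefficient_image[OF X(1)] _ _ Y, of "\<Theta> x"] X(2) by blast
  note aV = invariantD(2)[OF X(1) ab(1)]
  have "cinner (\<sigma> g a) a = cinner (left_translation g b) b" if "g \<in> carrier G" for g
    using ab(4)[OF that] that aV by (simp add: left_translation_coefficient cinner_coefficient rep_in)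
  thus ?thesis using ab zero[OF aV] by blast
qed

text \<open>
  Compare \<open>V\<close> with \<open>F\<close>, and let \<open>K\<close> and \<open>L\<close> be the domain and the range of the resulting intertwiner \<open>x \<mapsto> y\<close>.  The
  vector \<open>\<zeta>\<close> is the preimage of \<open>P\<^sub>L \<delta>\<close>.  Then \<open>\<langle>x, \<sigma> g \<zeta>\<rangle> = \<langle>y, \<lambda>\<^sub>g P\<^sub>L \<delta>\<rangle> = y g\<close>, so the coefficients of \<open>x\<close> are \<open>y\<close>
  itself, and \<open>\<zeta>\<close> is a Parseval frame vector because \<open>x\<close> and \<open>y\<close> have the same norm.
\<close>

lemma parseval_vector_with_coefficients_in:
  assumes icc: "icc G" and F: "regular.invariant F"
  obtains K \<zeta> where "invariant K" "parseval_vector G K \<sigma> \<zeta>" "\<And>x. x \<in> K \<Longrightarrow> coefficient G \<sigma> \<zeta> x \<in> F"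
    "norm \<zeta> \<le> norm (proj F (unit_ell2 \<one>))" "K = V \<or> norm \<zeta> = norm (proj F (unit_ell2 \<one>))"
proof -
  let ?\<delta> = "unit_ell2 \<one> :: 'a ell2"
  interpret F: unitary_representation G F left_translation
    by (rule unitary_representationI[OF is_group regular.invariant_unitary_rep[OF F]])
  have F_inv: "regular.invariant Y" if "F.invariant Y" for Y
    using F.invariantD[OF that] regular.invariantD(2)[OF F] unfolding regular.invariant_def by blast
  have common: "\<exists>a\<in>X. \<exists>b\<in>Y. a \<noteq> 0 \<and> (\<forall>g\<in>carrier G. cinner (\<sigma> g a) a = cinner (left_translation g b) b)"
    if "invariant X" "x \<in> X" "x \<noteq> 0" "F.invariant Y" "y \<in> Y" "y \<noteq> 0" for X Y x y
    by (rule icc_common_coefficient_regular[OF icc that(1-3) F_inv[OF that(4)] that(5,6)])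
  obtain M where M: "isometric_intertwiner G V \<sigma> F left_translation M" "Domain M = V \<or> Range M = F"
    by (rule comparison[OF unitary_representation_axioms F.unitary_representation_axioms common])
  define K where "K = Domain M"
  define L where "L = Range M"
  have K: "invariant K" unfolding K_def by (rule isometric_intertwiner_Domain[OF M(1)])
  have "F.invariant L"
    using F.isometric_intertwiner_Domain[OF isometric_intertwiner_converse[OF M(1)]] by (simp add: L_def)
  hence L: "regular.invariant L" "L \<subseteq> F" using F_inv F.invariantD(2) by blast+
  note Lc = regular.invariantD(1)[OF L(1)] and Fc = regular.invariantD(1)[OF F]
  have "proj L ?\<delta> \<in> Range M" using proj_in[OF Lc] by (simp add: L_def)
  then obtain \<zeta> where \<zeta>: "(\<zeta>, proj L ?\<delta>) \<in> M" by blast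
  have "\<zeta> \<in> K" using \<zeta> by (auto simp: K_def)
  have coeff: "cinner x (\<sigma> g \<zeta>) = apply_ell2 y g" if "(x, y) \<in> M" "g \<in> carrier G" for x y g
  proof -
    have y: "y \<in> L" using that by (auto simp: L_def)
    have "cinner x (\<sigma> g \<zeta>) = cinner y (left_translation g (proj L ?\<delta>))"
      using isometric_intertwinerD(5)[OF M(1) that(1) isometric_intertwinerD(7)[OF M(1) that(2) \<zeta>]] .
    also have "\<dots> = cinner (left_translation (inv g) y) (proj L ?\<delta>)"
      using that left_translation_adjoint[of "inv g"] by simp
    also have "\<dots> = cinner (left_translation (inv g) y) ?\<delta>"
      using regular.invariantD(3)[OF L(1) _ y, of "inv g"] that by (simp add: proj_cinner[OF Lc])
    also have "\<dots> = apply_ell2 y g"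
      using that by (simp add: cinner_unit_ell2 apply_left_translation)
    finally show ?thesis .
  qed
  have norm_eq: "norm x = norm y" if "(x, y) \<in> M" for x y
    using isometric_intertwiner_norm_diff[OF M(1) that isometric_intertwinerD(3)[OF M(1)]] by simp
  have in_L: "y \<in> L" "apply_ell2 y g = 0" if "(x, y) \<in> M" "g \<notin> carrier G" for x y g
  proof -
    show "y \<in> L" using that by (auto simp: L_def)
    thus "apply_ell2 y g = 0" using regular.invariantD(2)[OF L(1)] that by (auto simp: ell2_on_def)
  qed
  have pv: "parseval_vector G K \<sigma> \<zeta>"
    unfolding parseval_vector_def parseval_vector_axioms_def
  proof (intro conjI)
    show "unitary_representation G K \<sigma>"
      by (rule unitary_representationI[OF is_group invariant_unitary_rep[OF K]])
    show "\<zeta> \<in> K" by fact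
    show "parseval_frame K cinner (carrier G) (\<lambda>g. \<sigma> g \<zeta>)"
      unfolding parseval_frame_def
    proof (intro conjI ballI)
      show "\<sigma> g \<zeta> \<in> K" if "g \<in> carrier G" for g using invariantD(3)[OF K that \<open>\<zeta> \<in> K\<close>] .
      fix x assume "x \<in> K"
      then obtain y where y: "(x, y) \<in> M" by (auto simp: K_def)
      have "((\<lambda>g. (cmod (apply_ell2 y g))\<^sup>2) has_sum (norm y)\<^sup>2) (carrier G)"
        using norm_ell2_has_sum[of y] in_L(2)[OF y]
        by (subst (asm) has_sum_cong_neutral[where T = "carrier G" and g = "\<lambda>g. (cmod (apply_ell2 y g))\<^sup>2"]) auto
      hence "((\<lambda>g. (cmod (cinner x (\<sigma> g \<zeta>)))\<^sup>2) has_sum (norm y)\<^sup>2) (carrier G)"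
        using coeff[OF y] by (simp cong: has_sum_cong)
      thus "((\<lambda>g. (cmod (cinner x (\<sigma> g \<zeta>)))\<^sup>2) has_sum Re (cinner x x)) (carrier G)"
        unfolding cinner_self norm_eq[OF y] Re_complex_of_real .
    qed
  qed
  interpret Z: parseval_vector G K \<sigma> \<zeta> by (rule pv)
  have range: "Z.\<Theta> x \<in> F" if x: "x \<in> K" for x
  proof -
    obtain y where y: "(x, y) \<in> M" using x by (auto simp: K_def)
    have "Z.\<Theta> x = y"
      by (rule ell2_eqI) (simp add: Z.apply_coefficient x coeff[OF y] in_L(2)[OF y])
    thus ?thesis using y isometric_intertwinerD(2)[OF M(1)] by simp
  qed
  have le: "norm (proj L ?\<delta>) \<le> norm (proj F ?\<delta>)"
  proof -
    have "proj L ?\<delta> = proj L (proj F ?\<delta>)"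
    proof (rule proj_eqI[OF Lc proj_in[OF Lc]])
      fix v assume "v \<in> L"
      hence "v \<in> F" using L(2) by blast
      thus "cinner ?\<delta> v = cinner (proj L (proj F ?\<delta>)) v"
        using \<open>v \<in> L\<close> by (simp add: proj_cinner[OF Lc] proj_cinner[OF Fc])
    qed
    thus ?thesis using norm_proj_le[OF Lc, of "proj F ?\<delta>"] by simp
  qed
  have eq: "norm \<zeta> = norm (proj L ?\<delta>)" by (rule norm_eq[OF \<zeta>])
  show ?thesis
  proof (rule that[OF K pv range])
    show "norm \<zeta> \<le> norm (proj F ?\<delta>)" using eq le by simp
    show "K = V \<or> norm \<zeta> = norm (proj F ?\<delta>)" using M(2) eq by (auto simp: K_def L_def)
  qed
qed

lemma parseval_vector_proj:
  assumes K: "invariant K"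
  shows "parseval_vector G K \<sigma> (proj K \<xi>)"
  unfolding parseval_vector_def parseval_vector_axioms_def
proof (intro conjI)
  note Kc = invariantD(1)[OF K]
  show "unitary_representation G K \<sigma>"
    by (rule unitary_representationI[OF is_group invariant_unitary_rep[OF K]])
  show P: "proj K \<xi> \<in> K" by (rule proj_in[OF Kc])
  show "parseval_frame K cinner (carrier G) (\<lambda>g. \<sigma> g (proj K \<xi>))"
    unfolding parseval_frame_def
  proof (intro conjI ballI)
    show "\<sigma> g (proj K \<xi>) \<in> K" if "g \<in> carrier G" for g using invariantD(3)[OF K that P] .
    fix x assume x: "x \<in> K"
    have "cinner x (\<sigma> g (proj K \<xi>)) = cinner x (\<sigma> g \<xi>)" if "g \<in> carrier G" for g
      using proj_rep[OF K that vector, symmetric] x by (simp add: proj_cinner[OF Kc])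
    moreover have "((\<lambda>g. (cmod (cinner x (\<sigma> g \<xi>)))\<^sup>2) has_sum Re (cinner x x)) (carrier G)"
      using frame invariantD(2)[OF K x] by (simp add: parseval_frame_def)
    ultimately show "((\<lambda>g. (cmod (cinner x (\<sigma> g (proj K \<xi>))))\<^sup>2) has_sum Re (cinner x x)) (carrier G)"
      by (simp cong: has_sum_cong)
  qed
qed

lemma parseval_vector_norm_unique: "parseval_vector G V \<sigma> \<eta> \<Longrightarrow> norm \<eta> = norm \<xi>"
  using parseval_vectors_same_norm[of \<eta> \<xi>] frame vector
  by (simp add: parseval_vector_def parseval_vector_axioms_def)

text \<open>
  Strict monotonicity of the dimension: the projection of \<open>\<xi>\<close> to \<open>K\<close> is a Parseval frame vector for \<open>K\<close>, so it
  has the norm of \<open>\<zeta>\<close>; if that is not smaller than the norm of \<open>\<xi>\<close>, then \<open>\<xi>\<close> lies in \<open>K\<close>, and a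
  vector orthogonal to \<open>K\<close> has no nonzero coefficient.
\<close>

lemma invariant_whole_if_norm_le:
  assumes K: "invariant K" and "parseval_vector G K \<sigma> \<zeta>" and le: "norm \<xi> \<le> norm \<zeta>"
  shows "K = V"
proof -
  note Kc = invariantD(1)[OF K]
  have "norm (proj K \<xi>) = norm \<zeta>"
    using parseval_vector.parseval_vector_norm_unique[OF assms(2) parseval_vector_proj[OF K]] .
  hence "(norm \<xi>)\<^sup>2 \<le> (norm (proj K \<xi>))\<^sup>2" using le by (simp add: power_mono)
  hence "(norm (\<xi> - proj K \<xi>))\<^sup>2 \<le> 0" using norm_proj_sq[OF Kc, of \<xi>] by linarith
  hence "\<xi> = proj K \<xi>" by simp
  hence "\<xi> \<in> K" by (rule ssubst) (rule proj_in[OF Kc])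
  show ?thesis
  proof (rule ccontr)
    assume "K \<noteq> V"
    obtain x where "x \<in> V \<inter> {x. \<forall>y\<in>K. cinner x y = 0}" "x \<noteq> 0"
      by (rule complement_nonzero[OF K \<open>K \<noteq> V\<close>])
    hence x: "x \<in> V" "\<And>y. y \<in> K \<Longrightarrow> cinner x y = 0" "x \<noteq> 0" by auto
    have "\<Theta> x = 0"
      using x invariantD(3)[OF K _ \<open>\<xi> \<in> K\<close>] by (intro ell2_eqI) (simp add: apply_coefficient)
    hence "cinner x x = 0" using cinner_coefficient[OF x(1) x(1)] by simp
    thus False using x(3) by simp
  qed
qed

end

lemma parseval_frame_vector_iff:
  "group G \<Longrightarrow> parseval_frame_vector G V \<sigma> \<xi> \<longleftrightarrow> parseval_vector G V \<sigma> \<xi>"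
  by (auto simp: parseval_frame_vector_def parseval_vector_def parseval_vector_axioms_def
      unitary_representation_def unitary_representation_axioms_def)

section \<open>Strongly disjoint tuples\<close>

context group
begin

lemma strongly_disjoint_vectors_iff:
  "strongly_disjoint_vectors G n V \<sigma> \<xi> \<longleftrightarrow> (\<forall>k\<in>{1..n}. parseval_vector G (V k) (\<sigma> k) (\<xi> k)) \<and>
    (\<forall>j\<in>{1..n}. \<forall>k\<in>{1..n}. j \<noteq> k \<longrightarrow> (\<forall>x\<in>V j. \<forall>y\<in>V k.
      cinner (coefficient G (\<sigma> j) (\<xi> j) x) (coefficient G (\<sigma> k) (\<xi> k) y) = 0))"
proof (cases "\<forall>k\<in>{1..n}. parseval_vector G (V k) (\<sigma> k) (\<xi> k)")
  case True
  hence "closed_csubspace (V k)" "parseval_frame (V k) cinner (carrier G) (\<lambda>g. \<sigma> k g (\<xi> k))"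
    if "k \<in> {1..n}" for k
    using that by (auto simp: parseval_vector_def parseval_vector_axioms_def unitary_representation_def
        unitary_representation_axioms_def unitary_rep_def)
  from strongly_disjoint_tuple_iff[of n V "carrier G" "\<lambda>k g. \<sigma> k g (\<xi> k)", OF this] show ?thesis
    using True unfolding strongly_disjoint_vectors_def parseval_frame_vector_iff[OF is_group] coefficient_def by blast
qed (auto simp: strongly_disjoint_vectors_def parseval_frame_vector_iff[OF is_group])

definition residual_space :: "nat \<Rightarrow> (nat \<Rightarrow> 'c::complex_hilbert set) \<Rightarrow> (nat \<Rightarrow> 'a \<Rightarrow> 'c \<Rightarrow> 'c) \<Rightarrow> (nat \<Rightarrow> 'c) \<Rightarrow> 'a ell2 set" where
  "residual_space n V \<sigma> \<xi> = ell2_on (carrier G) \<inter>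
    {f. \<forall>u\<in>(\<Union>k\<in>{1..n}. coefficient G (\<sigma> k) (\<xi> k) ` V k). cinner f u = 0}"

context
  fixes n :: nat and V :: "nat \<Rightarrow> 'c::complex_hilbert set" and \<sigma> \<xi>
  assumes disj: "strongly_disjoint_vectors G n V \<sigma> \<xi>"
begin

lemma tuple_parseval_vector: "k \<in> {1..n} \<Longrightarrow> parseval_vector G (V k) (\<sigma> k) (\<xi> k)"
  using disj unfolding strongly_disjoint_vectors_iff by blast

lemma invariant_residual_space: "regular.invariant (residual_space n V \<sigma> \<xi>)"
  unfolding residual_space_def
proof (rule regular.invariant_orthogonal)
  show "(\<Union>k\<in>{1..n}. coefficient G (\<sigma> k) (\<xi> k) ` V k) \<subseteq> ell2_on (carrier G)"
    using parseval_vector.coefficient_in[OF tuple_parseval_vector] by blast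
  fix g u assume g: "g \<in> carrier G" and "u \<in> (\<Union>k\<in>{1..n}. coefficient G (\<sigma> k) (\<xi> k) ` V k)"
  then obtain k x where k: "k \<in> {1..n}" "x \<in> V k" "u = coefficient G (\<sigma> k) (\<xi> k) x" by blast
  interpret parseval_vector G "V k" "\<sigma> k" "\<xi> k" by (rule tuple_parseval_vector[OF k(1)])
  show "left_translation g u \<in> (\<Union>k\<in>{1..n}. coefficient G (\<sigma> k) (\<xi> k) ` V k)"
    using k g left_translation_coefficient rep_in by blast
qed

text \<open>
  In \<open>\<delta> - (\<Theta>\<^sub>1 \<xi>\<^sub>1 + \<dots> + \<Theta>\<^sub>n \<xi>\<^sub>n)\<close> each term \<open>\<Theta>\<^sub>k \<xi>\<^sub>k\<close> is the projection of \<open>\<delta>\<close> to the range of \<open>\<Theta>\<^sub>k\<close>, and these ranges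
  are mutually orthogonal.
\<close>

lemma proj_residual_space:
  "proj (residual_space n V \<sigma> \<xi>) (unit_ell2 \<one>) = unit_ell2 \<one> - (\<Sum>k=1..n. coefficient G (\<sigma> k) (\<xi> k) (\<xi> k))"
  (is "proj ?F ?\<delta> = ?\<delta> - ?S")
proof (rule proj_eqI)
  show "closed_csubspace ?F" by (rule regular.invariantD(1)[OF invariant_residual_space])
  have in_range: "\<xi> k \<in> V k" if "k \<in> {1..n}" for k
    using parseval_vector.vector[OF tuple_parseval_vector[OF that]] .
  have "?S \<in> ell2_on (carrier G)"
    using closed_csubspace_ell2_on parseval_vector.coefficient_in[OF tuple_parseval_vector in_range]
    by (intro subspace_sum) (auto simp: closed_csubspace_def)
  moreover have "cinner (?\<delta> - ?S) u = 0" if k: "k \<in> {1..n}" "x \<in> V k" "u = coefficient G (\<sigma> k) (\<xi> k) x" for k x u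
  proof -
    interpret parseval_vector G "V k" "\<sigma> k" "\<xi> k" by (rule tuple_parseval_vector[OF k(1)])
    have "cinner ?S u = (\<Sum>j=1..n. cinner (coefficient G (\<sigma> j) (\<xi> j) (\<xi> j)) u)"
      by (rule cinner_sum_left)
    also have "\<dots> = (\<Sum>j=1..n. if j = k then cinner (\<Theta> (\<xi> k)) u else 0)"
    proof (rule sum.cong[OF refl])
      fix j assume j: "j \<in> {1..n}"
      show "cinner (coefficient G (\<sigma> j) (\<xi> j) (\<xi> j)) u = (if j = k then cinner (\<Theta> (\<xi> k)) u else 0)"
        using disj j k in_range[OF j] unfolding strongly_disjoint_vectors_iff by simp
    qed
    also have "\<dots> = cinner (\<xi> k) x" using k vector by (simp add: cinner_coefficient)
    also have "\<dots> = cinner ?\<delta> u"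
      using cinner_coefficient_unit[OF k(2)] k(3) cinner_commute by metis
    finally show ?thesis by (simp add: cinner_diff_left)
  qed
  ultimately show in_F: "?\<delta> - ?S \<in> ?F"
    using closed_csubspaceD(3)[OF closed_csubspace_ell2_on unit_in] unfolding residual_space_def by blast
  fix v assume v: "v \<in> ?F"
  have "cinner (coefficient G (\<sigma> k) (\<xi> k) (\<xi> k)) v = 0" if "k \<in> {1..n}" for k
    using v in_range[OF that] that by (subst cinner_eq_0_commute) (auto simp: residual_space_def)
  thus "cinner ?\<delta> v = cinner (?\<delta> - ?S) v" by (simp add: cinner_diff_left cinner_sum_left)
qed

lemma norm_proj_residual_space:
  "(norm (proj (residual_space n V \<sigma> \<xi>) (unit_ell2 \<one>)))\<^sup>2 = 1 - (\<Sum>k=1..n. (norm (\<xi> k))\<^sup>2)"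
proof -
  let ?P = "proj (residual_space n V \<sigma> \<xi>) (unit_ell2 \<one>)"
  have "complex_of_real ((norm ?P)\<^sup>2) = cinner ?P ?P" by (rule cinner_self[symmetric])
  also have "\<dots> = cinner ?P (unit_ell2 \<one>)"
    using regular.invariantD(1)[OF invariant_residual_space] by (simp add: proj_cinner proj_in)
  also have "\<dots> = 1 - (\<Sum>k=1..n. cinner (coefficient G (\<sigma> k) (\<xi> k) (\<xi> k)) (unit_ell2 \<one>))"
    unfolding proj_residual_space cinner_diff_left cinner_sum_left by (simp add: cinner_self norm_unit_ell2)
  also have "(\<Sum>k=1..n. cinner (coefficient G (\<sigma> k) (\<xi> k) (\<xi> k)) (unit_ell2 \<one>)) = (\<Sum>k=1..n. of_real ((norm (\<xi> k))\<^sup>2))"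
  proof (rule sum.cong[OF refl])
    fix k assume k: "k \<in> {1..n}"
    interpret parseval_vector G "V k" "\<sigma> k" "\<xi> k" by (rule tuple_parseval_vector[OF k])
    show "cinner (\<Theta> (\<xi> k)) (unit_ell2 \<one>) = of_real ((norm (\<xi> k))\<^sup>2)"
      using cinner_coefficient_unit[OF vector] unfolding cinner_self .
  qed
  also have "1 - \<dots> = complex_of_real (1 - (\<Sum>k=1..n. (norm (\<xi> k))\<^sup>2))" by simp
  finally show ?thesis unfolding of_real_eq_iff .
qed

text \<open>
  The extended tuple is given by primed families that agree with the old ones up to \<open>n\<close>, so that both
  updated families and families defined by cases are instances.
\<close>

lemma strongly_disjoint_vectors_extend:
  assumes "parseval_vector G W \<tau> \<zeta>" and res: "\<And>x. x \<in> W \<Longrightarrow> coefficient G \<tau> \<zeta> x \<in> residual_space n V \<sigma> \<xi>"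
    and eq: "\<And>k. k \<in> {1..n} \<Longrightarrow> V' k = V k \<and> \<sigma>' k = \<sigma> k \<and> \<xi>' k = \<xi> k"
    and new: "V' (Suc n) = W" "\<sigma>' (Suc n) = \<tau>" "\<xi>' (Suc n) = \<zeta>"
  shows "strongly_disjoint_vectors G (Suc n) V' \<sigma>' \<xi>'"
  unfolding strongly_disjoint_vectors_iff
proof (intro conjI ballI impI)
  fix k assume "k \<in> {1..Suc n}"
  then consider "k \<in> {1..n}" | "k = Suc n" by force
  thus "parseval_vector G (V' k) (\<sigma>' k) (\<xi>' k)"
    using assms(1) tuple_parseval_vector[of k] eq[of k] new by cases simp_all
next
  fix j k x y assume jk: "j \<in> {1..Suc n}" "k \<in> {1..Suc n}" "j \<noteq> k" and xy: "x \<in> V' j" "y \<in> V' k"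
  have orth: "cinner (coefficient G \<tau> \<zeta> y) (coefficient G (\<sigma> i) (\<xi> i) x) = 0" if "y \<in> W" "i \<in> {1..n}" "x \<in> V i" for i x y
    using res[OF that(1)] that(2,3) by (auto simp: residual_space_def)
  consider "j \<in> {1..n}" "k \<in> {1..n}" | "j \<in> {1..n}" "k = Suc n" | "j = Suc n" "k \<in> {1..n}"
    using jk by force
  thus "cinner (coefficient G (\<sigma>' j) (\<xi>' j) x) (coefficient G (\<sigma>' k) (\<xi>' k) y) = 0"
  proof cases
    case 1
    thus ?thesis using disj xy \<open>j \<noteq> k\<close> eq[of j] eq[of k] unfolding strongly_disjoint_vectors_iff by simp
  next
    case 2
    thus ?thesis using orth[of y j x] xy eq[of j] new by (subst cinner_eq_0_commute) simp
  next
    case 3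
    thus ?thesis using orth[of x k y] xy eq[of k] new by simp
  qed
qed

end

end

section \<open>Completing strongly disjoint tuples\<close>

locale icc_parseval_vector = parseval_vector G UNIV \<pi> \<xi>\<^sub>1
  for G (structure) and \<pi> and \<xi>\<^sub>1 +
  assumes icc: "icc G" and nonzero: "\<xi>\<^sub>1 \<noteq> 0"
begin

abbreviation "disjoint_tuple M \<xi> \<equiv> strongly_disjoint_vectors G M (\<lambda>_. UNIV) (\<lambda>_. \<pi>) \<xi>"

lemma disjoint_tuple_norm: "disjoint_tuple M \<xi> \<Longrightarrow> k \<in> {1..M} \<Longrightarrow> norm (\<xi> k) = norm \<xi>\<^sub>1"
  using parseval_vector_norm_unique tuple_parseval_vector by blast

lemma norm_proj_residual_space_tuple:
  assumes "disjoint_tuple M \<xi>"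
  shows "(norm (proj (residual_space M (\<lambda>_. UNIV) (\<lambda>_. \<pi>) \<xi>) (unit_ell2 \<one>)))\<^sup>2 = 1 - real M * (norm \<xi>\<^sub>1)\<^sup>2"
  unfolding norm_proj_residual_space[OF assms] by (simp add: disjoint_tuple_norm[OF assms])

lemma disjoint_tuple_one: "disjoint_tuple 1 (\<lambda>_. \<xi>\<^sub>1)"
  unfolding strongly_disjoint_vectors_iff using parseval_vector_axioms by auto

text \<open>
  Only \<open>N \<ge> 1\<close> is more than rounding: \<open>\<parallel>\<xi>\<^sub>1\<parallel>\<^sup>2 \<le> 1\<close> because the residual space of \<open>\<xi>\<^sub>1\<close> has nonnegative
  dimension.
\<close>

lemma floor_bounds:
  assumes "N = nat \<lfloor>1 / (norm \<xi>\<^sub>1)\<^sup>2\<rfloor>"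
  shows "1 \<le> N" "real N * (norm \<xi>\<^sub>1)\<^sup>2 \<le> 1" "1 < (real N + 1) * (norm \<xi>\<^sub>1)\<^sup>2"
proof -
  have pos: "(norm \<xi>\<^sub>1)\<^sup>2 > 0" using nonzero by simp
  have "(norm \<xi>\<^sub>1)\<^sup>2 \<le> 1"
    using norm_proj_residual_space_tuple[OF disjoint_tuple_one] zero_le_power2 by (metis diff_ge_0_iff_ge mult_1 of_nat_1)
  hence "1 \<le> 1 / (norm \<xi>\<^sub>1)\<^sup>2" using pos by simp
  hence "1 \<le> \<lfloor>1 / (norm \<xi>\<^sub>1)\<^sup>2\<rfloor>" by (simp only: one_le_floor)
  hence N: "real N = of_int \<lfloor>1 / (norm \<xi>\<^sub>1)\<^sup>2\<rfloor>" and "1 \<le> N" unfolding assms by linarith+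
  show "1 \<le> N" by fact
  have "real N \<le> 1 / (norm \<xi>\<^sub>1)\<^sup>2" unfolding N by (rule of_int_floor_le)
  thus "real N * (norm \<xi>\<^sub>1)\<^sup>2 \<le> 1" using pos by (simp add: pos_le_divide_eq)
  have "1 / (norm \<xi>\<^sub>1)\<^sup>2 < real N + 1" unfolding N by linarith
  thus "1 < (real N + 1) * (norm \<xi>\<^sub>1)\<^sup>2" using pos by (simp add: pos_divide_less_eq)
qed

text \<open>
  If the vector supplied by the comparison were one for a proper subspace \<open>K\<close>, it would have the norm of
  the projection of \<open>\<delta>\<close> to the residual space, which is at least that of \<open>\<xi>\<^sub>1\<close>; but then \<open>K\<close> would not be proper.
\<close>

lemma disjoint_tuple_Suc:
  assumes disj: "disjoint_tuple M \<xi>" and room: "real (Suc M) * (norm \<xi>\<^sub>1)\<^sup>2 \<le> 1"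
  shows "\<exists>\<zeta>. disjoint_tuple (Suc M) (\<xi>(Suc M := \<zeta>))"
proof -
  let ?F = "residual_space M (\<lambda>_. UNIV) (\<lambda>_. \<pi>) \<xi>"
  obtain K \<zeta> where K: "invariant K" and \<zeta>: "parseval_vector G K \<pi> \<zeta>"
    and range: "\<And>x. x \<in> K \<Longrightarrow> coefficient G \<pi> \<zeta> x \<in> ?F"
    and norm: "K = UNIV \<or> norm \<zeta> = norm (proj ?F (unit_ell2 \<one>))"
    using parseval_vector_with_coefficients_in[OF icc invariant_residual_space[OF disj]] by metis
  have "K = UNIV"
  proof (rule ccontr)
    assume "K \<noteq> UNIV"
    hence "(norm \<zeta>)\<^sup>2 = 1 - real M * (norm \<xi>\<^sub>1)\<^sup>2"
      using norm norm_proj_residual_space_tuple[OF disj] by simp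
    moreover have "real (Suc M) * (norm \<xi>\<^sub>1)\<^sup>2 = real M * (norm \<xi>\<^sub>1)\<^sup>2 + (norm \<xi>\<^sub>1)\<^sup>2"
      by (simp add: algebra_simps)
    ultimately have "(norm \<xi>\<^sub>1)\<^sup>2 \<le> (norm \<zeta>)\<^sup>2" using room by linarith
    hence "norm \<xi>\<^sub>1 \<le> norm \<zeta>" by (rule power2_le_imp_le) simp
    thus False using invariant_whole_if_norm_le[OF K \<zeta>] \<open>K \<noteq> UNIV\<close> by simp
  qed
  hence "disjoint_tuple (Suc M) (\<xi>(Suc M := \<zeta>))"
    using \<zeta> range by (intro strongly_disjoint_vectors_extend[OF disj \<zeta>]) auto
  thus ?thesis ..
qed

lemma disjoint_tuple_extend:
  assumes "disjoint_tuple M \<xi>" "M \<le> N" "real N * (norm \<xi>\<^sub>1)\<^sup>2 \<le> 1"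
  shows "\<exists>\<xi>'. (\<forall>k\<in>{1..M}. \<xi>' k = \<xi> k) \<and> disjoint_tuple N \<xi>'"
  using assms(2,3)
proof (induction N rule: dec_induct)
  case base
  thus ?case using assms(1) by blast
next
  case (step N)
  have "real N * (norm \<xi>\<^sub>1)\<^sup>2 \<le> real (Suc N) * (norm \<xi>\<^sub>1)\<^sup>2" by (intro mult_right_mono) auto
  then obtain \<xi>' where \<xi>': "\<forall>k\<in>{1..M}. \<xi>' k = \<xi> k" "disjoint_tuple N \<xi>'"
    using step by (meson order_trans)
  obtain \<zeta> where "disjoint_tuple (Suc N) (\<xi>'(Suc N := \<zeta>))"
    using disjoint_tuple_Suc[OF \<xi>'(2) step.prems] by blast
  moreover have "\<forall>k\<in>{1..M}. (\<xi>'(Suc N := \<zeta>)) k = \<xi> k" using \<xi>'(1) \<open>M \<le> N\<close> by auto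
  ultimately show ?case by blast
qed

lemma compress_eq:
  assumes "invariant K" "g \<in> carrier G" "x \<in> K"
  shows "compress (proj K) \<pi> g x = \<pi> g x"
  using assms invariantD[OF assms(1)] by (simp add: compress_def proj_ident)

lemma proj_in_commutant:
  assumes K: "invariant K" shows "proj K \<in> commutant (\<pi> ` carrier G)"
  unfolding commutant_def
  using is_projection_proj[OF invariantD(1)[OF K]] proj_rep[OF K] by (auto simp: is_projection_def fun_eq_iff)

text \<open>
  For this \<open>N\<close> the residual space has smaller dimension than \<open>H\<close>, so comparison can only embed it into \<open>H\<close>; its image is the
  range of \<open>p'\<close>.
\<close>

lemma complete_disjoint_tuple:
  assumes disj: "disjoint_tuple N \<xi>" and "\<xi> 1 = \<xi>\<^sub>1" and N: "N = nat \<lfloor>1 / (norm \<xi>\<^sub>1)\<^sup>2\<rfloor>"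
  shows "\<exists>\<zeta> p. properties_abc G \<pi> N (\<xi>(N + 1 := \<zeta>)) p"
proof -
  let ?F = "residual_space N (\<lambda>_. UNIV) (\<lambda>_. \<pi>) \<xi>"
  note bounds = floor_bounds[OF N]
  have small: "1 - real N * (norm \<xi>\<^sub>1)\<^sup>2 < (norm \<xi>\<^sub>1)\<^sup>2" using bounds(3) by (simp add: algebra_simps)
  obtain K \<zeta> where K: "invariant K" and \<zeta>: "parseval_vector G K \<pi> \<zeta>"
    and range: "\<And>x. x \<in> K \<Longrightarrow> coefficient G \<pi> \<zeta> x \<in> ?F"
    and le: "norm \<zeta> \<le> norm (proj ?F (unit_ell2 \<one>))"
    and norm: "K = UNIV \<or> norm \<zeta> = norm (proj ?F (unit_ell2 \<one>))"
    using parseval_vector_with_coefficients_in[OF icc invariant_residual_space[OF disj]] by metis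
  have "K \<noteq> UNIV"
  proof
    assume "K = UNIV"
    hence "norm \<zeta> = norm \<xi>\<^sub>1" using parseval_vector_norm_unique \<zeta> by blast
    hence "(norm \<xi>\<^sub>1)\<^sup>2 \<le> 1 - real N * (norm \<xi>\<^sub>1)\<^sup>2"
      using le power_mono[OF le, of 2] norm_proj_residual_space_tuple[OF disj] by simp
    thus False using small by simp
  qed
  hence norm_\<zeta>: "(norm \<zeta>)\<^sup>2 = 1 - real N * (norm \<xi>\<^sub>1)\<^sup>2"
    using norm norm_proj_residual_space_tuple[OF disj] by simp
  note Kc = invariantD(1)[OF K]
  interpret Z: parseval_vector G K \<pi> \<zeta> by (rule \<zeta>)
  have comp: "compress (proj K) \<pi> g \<zeta> = \<pi> g \<zeta>" if "g \<in> carrier G" for g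
    by (rule compress_eq[OF K that Z.vector])
  have compressed: "parseval_vector G K (compress (proj K) \<pi>) \<zeta>"
    unfolding parseval_vector_def parseval_vector_axioms_def
  proof (intro conjI Z.vector unitary_representationI[OF is_group])
    show "unitary_rep G K (compress (proj K) \<pi>)"
      by (rule unitary_rep_cong[OF is_group Z.rep compress_eq[OF K]])
    show "parseval_frame K cinner (carrier G) (\<lambda>g. compress (proj K) \<pi> g \<zeta>)"
      using Z.frame comp unfolding parseval_frame_def by (simp cong: has_sum_cong)
  qed
  have coeff: "coefficient G (compress (proj K) \<pi>) \<zeta> = coefficient G \<pi> \<zeta>"
    unfolding coefficient_def analysis_def by (auto simp: fun_eq_iff comp intro!: arg_cong[where f = Abs_ell2])
  have "properties_abc G \<pi> N (\<xi>(N + 1 := \<zeta>)) (proj K)"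
    unfolding properties_abc_def range_proj[OF Kc]
  proof (intro conjI ballI)
    show "parseval_frame_vector G UNIV \<pi> ((\<xi>(N + 1 := \<zeta>)) k)" if "k \<in> {2..N}" for k
      using tuple_parseval_vector[OF disj, of k] that by (simp add: parseval_frame_vector_iff[OF is_group])
    show "(norm ((\<xi>(N + 1 := \<zeta>)) (N + 1)))\<^sup>2 = 1 - real N * (norm ((\<xi>(N + 1 := \<zeta>)) 1))\<^sup>2"
      "1 - real N * (norm ((\<xi>(N + 1 := \<zeta>)) 1))\<^sup>2 < (norm ((\<xi>(N + 1 := \<zeta>)) 1))\<^sup>2"
      using norm_\<zeta> small bounds(1) \<open>\<xi> 1 = \<xi>\<^sub>1\<close> by simp_all
    show "is_projection (proj K)" by (rule is_projection_proj[OF Kc])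
    show "proj K \<in> commutant (\<pi> ` carrier G)" by (rule proj_in_commutant[OF K])
    show "parseval_frame K cinner (carrier G) (\<lambda>g. \<pi> g ((\<xi>(N + 1 := \<zeta>)) (N + 1)))"
      using Z.frame by simp
    show "parseval_frame_vector G K (compress (proj K) \<pi>) ((\<xi>(N + 1 := \<zeta>)) (N + 1))"
      using compressed by (simp add: parseval_frame_vector_iff[OF is_group])
    show "strongly_disjoint_vectors G (N + 1) (tuple_space N (proj K)) (tuple_rep N (proj K) \<pi>) (\<xi>(N + 1 := \<zeta>))"
      unfolding Suc_eq_plus1[symmetric]
    proof (rule strongly_disjoint_vectors_extend[OF disj compressed])
      show "coefficient G (compress (proj K) \<pi>) \<zeta> x \<in> ?F" if "x \<in> K" for x
        using range[OF that] by (simp add: coeff)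
    qed (auto simp: tuple_space_def tuple_rep_def range_proj[OF Kc])
  qed
  thus ?thesis by blast
qed

text \<open>
  The squared norms of a complete tuple add up to \<open>1\<close>, so the projection of \<open>\<delta>\<close> to the residual space is \<open>0\<close>,
  that is, \<open>\<delta>\<close> is the sum of the \<open>\<Theta>\<^sub>i \<xi>\<^sub>i\<close>.
\<close>

lemma no_further_disjoint_vector:
  assumes abc: "properties_abc G \<pi> N \<xi> p" and "\<xi> 1 = \<xi>\<^sub>1" "1 \<le> N"
    and \<eta>: "parseval_frame_vector G K \<sigma> \<eta>"
    and disj: "\<And>i. i \<in> {1..N + 1} \<Longrightarrow> strongly_disjoint (tuple_space N p i) K (carrier G)
      (\<lambda>g. tuple_rep N p \<pi> i g (\<xi> i)) (\<lambda>g. \<sigma> g \<eta>)"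
  shows "\<eta> = 0"
proof -
  let ?V = "tuple_space N p" and ?\<sigma> = "tuple_rep N p \<pi>"
  have sdv: "strongly_disjoint_vectors G (N + 1) ?V ?\<sigma> \<xi>" using abc by (simp add: properties_abc_def)
  interpret E: parseval_vector G K \<sigma> \<eta> using \<eta> by (simp add: parseval_frame_vector_iff[OF is_group])
  have "norm (\<xi> k) = norm \<xi>\<^sub>1" if "k \<in> {1..N}" for k
    using tuple_parseval_vector[OF sdv, of k] that
    by (intro parseval_vector_norm_unique) (simp add: tuple_space_def tuple_rep_def)
  hence "(\<Sum>k=1..N. (norm (\<xi> k))\<^sup>2) = real N * (norm \<xi>\<^sub>1)\<^sup>2" by simp
  moreover have "(norm (\<xi> (N + 1)))\<^sup>2 = 1 - real N * (norm \<xi>\<^sub>1)\<^sup>2"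
    using abc \<open>\<xi> 1 = \<xi>\<^sub>1\<close> by (simp add: properties_abc_def)
  ultimately have "(\<Sum>k=1..N+1. (norm (\<xi> k))\<^sup>2) = 1" by simp
  hence "proj (residual_space (N + 1) ?V ?\<sigma> \<xi>) (unit_ell2 \<one>) = 0"
    using norm_proj_residual_space[OF sdv] by simp
  hence unit: "unit_ell2 \<one> = (\<Sum>k=1..N+1. coefficient G (?\<sigma> k) (\<xi> k) (\<xi> k))"
    using proj_residual_space[OF sdv] by simp
  have "cinner (coefficient G (?\<sigma> k) (\<xi> k) (\<xi> k)) (E.\<Theta> \<eta>) = 0" if k: "k \<in> {1..N+1}" for k
  proof -
    interpret P: parseval_vector G "?V k" "?\<sigma> k" "\<xi> k" by (rule tuple_parseval_vector[OF sdv k])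
    show ?thesis
      unfolding coefficient_def by (rule strongly_disjoint_imp_orthogonal[OF P.space disj[OF k] P.vector E.vector])
  qed
  hence "cinner (unit_ell2 \<one>) (E.\<Theta> \<eta>) = 0" unfolding unit cinner_sum_left by simp
  hence "cinner \<eta> \<eta> = 0"
    using E.cinner_coefficient_unit[OF E.vector] cinner_eq_0_commute by metis
  thus ?thesis by simp
qed

end

theorem theorem2p2:
  fixes G :: "('g, 'm) monoid_scheme"
    and \<pi> :: "'g \<Rightarrow> 'h::complex_hilbert \<Rightarrow> 'h"
    and \<xi>\<^sub>1 :: 'h
    and N :: nat
  assumes "group G" and "countable (carrier G)" and "icc G"
    and "\<exists>x::'h. x \<noteq> 0"
    and "unitary_rep G UNIV \<pi>"
    and "parseval_frame_vector G UNIV \<pi> \<xi>\<^sub>1"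
    and "N = nat \<lfloor>1 / (norm \<xi>\<^sub>1)\<^sup>2\<rfloor>"
  shows
    \<comment> \<open>(i)\<close>
    "(\<exists>\<xi> p. \<xi> 1 = \<xi>\<^sub>1 \<and> properties_abc G \<pi> N \<xi> p) \<and>
     \<comment> \<open>(ii)\<close>
     (\<forall>\<xi> p. \<xi> 1 = \<xi>\<^sub>1 \<and> properties_abc G \<pi> N \<xi> p \<longrightarrow>
        \<not> (\<exists>(K :: 'k::complex_hilbert set) \<sigma> \<eta>.
             \<eta> \<noteq> 0 \<and> parseval_frame_vector G K \<sigma> \<eta> \<and>
             (\<forall>i\<in>{1..N + 1}.
                strongly_disjoint (tuple_space N p i) K (carrier G)
                  (\<lambda>g. tuple_rep N p \<pi> i g (\<xi> i)) (\<lambda>g. \<sigma> g \<eta>)))) \<and>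
     \<comment> \<open>(iii)\<close>
     (\<forall>M \<xi>. 1 \<le> M \<and> M \<le> N \<and> \<xi> 1 = \<xi>\<^sub>1 \<and>
        strongly_disjoint_vectors G M (\<lambda>_. UNIV) (\<lambda>_. \<pi>) \<xi> \<longrightarrow>
        (\<exists>\<xi>' p. (\<forall>k\<in>{1..M}. \<xi>' k = \<xi> k) \<and> properties_abc G \<pi> N \<xi>' p))"
proof -
  interpret parseval_vector G UNIV \<pi> \<xi>\<^sub>1
    using parseval_frame_vector_iff[OF assms(1)] assms(6) by blast
  have "\<xi>\<^sub>1 \<noteq> 0"
  proof
    assume "\<xi>\<^sub>1 = 0"
    obtain x :: 'h where "x \<noteq> 0" using assms(4) by blast
    have "\<pi> g \<xi>\<^sub>1 = 0" if "g \<in> carrier G" for g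
      using rep_norm[OF that, of \<xi>\<^sub>1] \<open>\<xi>\<^sub>1 = 0\<close> by simp
    hence "\<Theta> x = 0" by (intro ell2_eqI) (simp add: apply_coefficient)
    thus False using cinner_coefficient[of x x] \<open>x \<noteq> 0\<close> by simp
  qed
  interpret icc_parseval_vector G \<pi> \<xi>\<^sub>1
    by unfold_locales fact+
  have N: "1 \<le> N" "real N * (norm \<xi>\<^sub>1)\<^sup>2 \<le> 1" using floor_bounds[OF assms(7)] by auto
  have iii: "\<exists>\<xi>' p. (\<forall>k\<in>{1..M}. \<xi>' k = \<xi> k) \<and> properties_abc G \<pi> N \<xi>' p"
    if M: "1 \<le> M" "M \<le> N" "\<xi> 1 = \<xi>\<^sub>1" and disj: "disjoint_tuple M \<xi>" for M \<xi>
  proof -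
    obtain \<xi>' where \<xi>': "\<forall>k\<in>{1..M}. \<xi>' k = \<xi> k" "disjoint_tuple N \<xi>'"
      using disjoint_tuple_extend[OF disj M(2) N(2)] by blast
    have "\<xi>' 1 = \<xi>\<^sub>1" using \<xi>'(1) M by simp
    then obtain \<zeta> p where "properties_abc G \<pi> N (\<xi>'(N + 1 := \<zeta>)) p"
      using complete_disjoint_tuple[OF \<xi>'(2) _ assms(7)] by blast
    moreover have "\<forall>k\<in>{1..M}. (\<xi>'(N + 1 := \<zeta>)) k = \<xi> k" using \<xi>'(1) M by auto
    ultimately show ?thesis by blast
  qed
  have i: "\<exists>\<xi> p. \<xi> 1 = \<xi>\<^sub>1 \<and> properties_abc G \<pi> N \<xi> p"
    using iii[OF _ N(1) _ disjoint_tuple_one] by force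
  have ii: "\<eta> = 0" if "\<xi> 1 = \<xi>\<^sub>1" "properties_abc G \<pi> N \<xi> p" "parseval_frame_vector G K \<sigma> \<eta>"
    "\<forall>i\<in>{1..N + 1}. strongly_disjoint (tuple_space N p i) K (carrier G)
      (\<lambda>g. tuple_rep N p \<pi> i g (\<xi> i)) (\<lambda>g. \<sigma> g \<eta>)" for \<xi> p and K :: "'k set" and \<sigma> \<eta>
    using no_further_disjoint_vector[OF that(2,1) N(1) that(3)] that(4) by blast
  show ?thesis
    using i ii iii by blast
qed

end
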